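(* Let $A$ be a cellularly stratified algebra with stratification data $(B_0,V_0,\dots,B_r,V_r)$, where the $B_l$ are isomorphic to group algebras of symmetric groups or to their Iwahori–Hecke algebras, with embeddings of algebras $B_l\hookrightarrow e_lAe_l$ for $0\le l\le r$, and assume $e_lAe_l\simeq B_l\oplus e_lJ_{l-1}e_l$ as $(B_l,B_l)$-bimodules for all $l$. Let $(l,\lambda),(l,\kappa)\in\Lambda_r$. If $(l,\lambda)\ne(l,\kappa)$, then $Y(l,\lambda)\not\simeq Y(l,\kappa)$.
   Context: $k$ is an algebraically closed field; modules are finite-dimensional left modules unless stated otherwise. $\Sigma_m$ is the symmetric group on $m$ letters and $\mathcal H_{k,q}(\Sigma_m)$ its Iwahori–Hecke algebra, $q\in k$ a unit. Cellularly stratified algebras: a $k$-algebra $A$ is cellularly stratified with stratification data $(B_0,V_0,\dots,B_r,V_r)$ if (1) each $B_l$ is a (finite-dimensional) cellular algebra, each $V_l$ a finite-dimensional vector space, and $A=\bigoplus_{l=0}^rB_l\otimes_kV_l\otimes_kV_l$ is an iterated inflation (in the sense of König and Xi) of the $B_l$ along the $V_l$; in particular $J_l:=\bigoplus_{j\le l}B_j\otimes V_j\otimes V_j$ is a two-sided ideal of $A$, and in $J_l/J_{l-1}$ (with $J_{-1}:=0$) one has $(b\otimes x\otimes y)(b'\otimes x'\otimes y')=b\varphi_l(y,x')b'\otimes x\otimes y'$ for a bilinear form $\varphi_l:V_l\otimes_kV_l\to B_l$; (2) for every $l$ there are $u_l,v_l\in V_l\setminus\{0\}$ such that $e_l:=1_{B_l}\otimes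 u_l\otimes v_l$ is an idempotent and $e_le_{l'}=e_l=e_{l'}e_l$ for all $l'\ge l$. Then $J_l=Ae_lA$ and $e_lAe_l/e_lJ_{l-1}e_l\simeq B_l$. The input algebra $B_l$ is viewed as a subalgebra of $e_lAe_l$ by identifying $b$ with $b\otimes u_l\otimes v_l$. Functors $B_l\text{-mod}\to A\text{-mod}$: $\mathrm{ind}_lX:=Ae_l\otimes_{e_lAe_l}X$, where $e_lAe_l$ acts on $X$ through $e_lAe_l\twoheadrightarrow B_l$, and $\mathrm{Ind}_lX:=Ae_l\otimes_{B_l}X$. Write $l'$ for the index of the symmetric group with $B_l\simeq k\Sigma_{l'}$ or $B_l\simeq\mathcal H_{k,q}(\Sigma_{l'})$. $\Lambda_r:=\{(l,\lambda)\mid 0\le l\le r,\ \lambda\vdash l'\}$. For $\lambda\vdash l'$, $M^\lambda$ is the permutation module of $B_l$ ($k\Sigma_{l'}\otimes_{k\Sigma_\lambda}k$, respectively $\mathcal H x_\lambda$ with $x_\lambda=\sum_{w\in\Sigma_\lambda}T_w$), and $Y^\lambda$ is the Young module, the unique indecomposable direct summand of $M^\lambda$ containing the Specht module $S^\lambda\subseteq M^\lambda$. The Young module $Y(l,\lambda)$ of $A$ is the unique indecomposable direct summand of $\mathrm{Ind}_lY^\lambda$ that has a quotient isomorphic to $\mathrm{ind}_lY^\lambda$ (it exists and is unique under the stated bimodule assumption). *)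

theory Defs
  imports "HOL-Algebra.Algebra"
begin

section \<open>Modules over not necessarily commutative rings\<close>

text \<open>
  The library locale for modules needs a commutative ring of scalars.  Its record type is reused
  for left modules over an arbitrary ring; the ring fields \<open>mult\<close> and \<open>one\<close> of the record carry
  no meaning for a module.
\<close>

locale left_module = R?: ring R + M?: abelian_group M
  for R :: "('r, 's) ring_scheme" (structure) and M :: "('r, 'm) module" (structure) +
  assumes smult_closed: "\<lbrakk>a \<in> carrier R; x \<in> carrier M\<rbrakk> \<Longrightarrow> a \<odot>\<^bsub>M\<^esub> x \<in> carrier M"
    and smult_l_distr: "\<lbrakk>a \<in> carrier R; b \<in> carrier R; x \<in> carrier M\<rbrakk> \<Longrightarrow>
      (a \<oplus>\<^bsub>R\<^esub> b) \<odot>\<^bsub>M\<^esub> x = a \<odot>\<^bsub>M\<^esub> x \<oplus>\<^bsub>M\<^esub> b \<odot>\<^bsub>M\<^esub> x"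
    and smult_r_distr: "\<lbrakk>a \<in> carrier R; x \<in> carrier M; y \<in> carrier M\<rbrakk> \<Longrightarrow>
      a \<odot>\<^bsub>M\<^esub> (x \<oplus>\<^bsub>M\<^esub> y) = a \<odot>\<^bsub>M\<^esub> x \<oplus>\<^bsub>M\<^esub> a \<odot>\<^bsub>M\<^esub> y"
    and smult_assoc: "\<lbrakk>a \<in> carrier R; b \<in> carrier R; x \<in> carrier M\<rbrakk> \<Longrightarrow>
      (a \<otimes>\<^bsub>R\<^esub> b) \<odot>\<^bsub>M\<^esub> x = a \<odot>\<^bsub>M\<^esub> (b \<odot>\<^bsub>M\<^esub> x)"
    and smult_one: "x \<in> carrier M \<Longrightarrow> \<one>\<^bsub>R\<^esub> \<odot>\<^bsub>M\<^esub> x = x"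

definition mk_module ::
  "'m set \<Rightarrow> 'm \<Rightarrow> ('m \<Rightarrow> 'm \<Rightarrow> 'm) \<Rightarrow> ('r \<Rightarrow> 'm \<Rightarrow> 'm) \<Rightarrow> ('r, 'm) module"
  where "mk_module C z p s =
    \<lparr>carrier = C, monoid.mult = undefined, one = undefined, ring.zero = z, ring.add = p, smult = s\<rparr>"

definition module_homs ::
  "('r, 's) ring_scheme \<Rightarrow> ('r, 'm) module \<Rightarrow> ('r, 'n) module \<Rightarrow> ('m \<Rightarrow> 'n) set"
  where "module_homs R M N = {f \<in> carrier M \<rightarrow> carrier N.
    (\<forall>x\<in>carrier M. \<forall>y\<in>carrier M. f (x \<oplus>\<^bsub>M\<^esub> y) = f x \<oplus>\<^bsub>N\<^esub> f y) \<and>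
    (\<forall>a\<in>carrier R. \<forall>x\<in>carrier M. f (a \<odot>\<^bsub>M\<^esub> x) = a \<odot>\<^bsub>N\<^esub> f x)}"

definition module_isomorphic ::
  "('r, 's) ring_scheme \<Rightarrow> ('r, 'm) module \<Rightarrow> ('r, 'n) module \<Rightarrow> bool"
  where "module_isomorphic R M N \<longleftrightarrow>
    (\<exists>f \<in> module_homs R M N. bij_betw f (carrier M) (carrier N))"

definition complementary ::
  "('r, 's) ring_scheme \<Rightarrow> ('r, 'm) module \<Rightarrow> 'm set \<Rightarrow> 'm set \<Rightarrow> bool"
  where "complementary R M N N' \<longleftrightarrow> submodule N R M \<and> submodule N' R M \<and>
    N \<inter> N' = {\<zero>\<^bsub>M\<^esub>} \<and> N <+>\<^bsub>M\<^esub> N' = carrier M"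

definition direct_summand :: "('r, 's) ring_scheme \<Rightarrow> ('r, 'm) module \<Rightarrow> 'm set \<Rightarrow> bool"
  where "direct_summand R M N \<longleftrightarrow> (\<exists>N'. complementary R M N N')"

definition indecomposable :: "('r, 's) ring_scheme \<Rightarrow> ('r, 'm) module \<Rightarrow> bool"
  where "indecomposable R M \<longleftrightarrow> carrier M \<noteq> {\<zero>\<^bsub>M\<^esub>} \<and>
    (\<forall>N N'. complementary R M N N' \<longrightarrow> N = {\<zero>\<^bsub>M\<^esub>} \<or> N' = {\<zero>\<^bsub>M\<^esub>})"

definition quotient_module :: "('r, 'm) module \<Rightarrow> 'm set \<Rightarrow> ('r, 'm set) module"
  where "quotient_module M N = mk_module (a_rcosets\<^bsub>M\<^esub> N) N (set_add M)
    (\<lambda>a C. \<Union>x\<in>C. N +>\<^bsub>M\<^esub> (a \<odot>\<^bsub>M\<^esub> x))"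

definition direct_sum :: "('r, 'm) module \<Rightarrow> ('r, 'n) module \<Rightarrow> ('r, 'm \<times> 'n) module"
  where "direct_sum M N = mk_module (carrier M \<times> carrier N) (\<zero>\<^bsub>M\<^esub>, \<zero>\<^bsub>N\<^esub>)
    (\<lambda>x y. (fst x \<oplus>\<^bsub>M\<^esub> fst y, snd x \<oplus>\<^bsub>N\<^esub> snd y)) (\<lambda>a x. (a \<odot>\<^bsub>M\<^esub> fst x, a \<odot>\<^bsub>N\<^esub> snd x))"

definition restrict_scalars :: "('s \<Rightarrow> 'r) \<Rightarrow> ('r, 'm) module \<Rightarrow> ('s, 'm) module"
  where "restrict_scalars f M =
    mk_module (carrier M) \<zero>\<^bsub>M\<^esub> (ring.add M) (\<lambda>a x. f a \<odot>\<^bsub>M\<^esub> x)"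

definition regular_module :: "('a, 's) ring_scheme \<Rightarrow> ('a, 'a) module"
  where "regular_module A = mk_module (carrier A) \<zero>\<^bsub>A\<^esub> (ring.add A) (monoid.mult A)"

definition left_ideal_module :: "('a, 's) ring_scheme \<Rightarrow> 'a \<Rightarrow> ('a, 'a) module"
  where "left_ideal_module A e = (regular_module A)\<lparr>carrier := {a \<otimes>\<^bsub>A\<^esub> e | a. a \<in> carrier A}\<rparr>"

text \<open>
  A bimodule is a left module together with a right action, a function \<open>rM x b\<close> for \<open>x \<cdot> b\<close>.
\<close>

definition bimodule_isomorphic ::
  "('r, 's) ring_scheme \<Rightarrow> ('r, 'm) module \<Rightarrow> ('m \<Rightarrow> 'r \<Rightarrow> 'm) \<Rightarrow>
    ('r, 'n) module \<Rightarrow> ('n \<Rightarrow> 'r \<Rightarrow> 'n) \<Rightarrow> bool"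
  where "bimodule_isomorphic R M rM N rN \<longleftrightarrow>
    (\<exists>f \<in> module_homs R M N. bij_betw f (carrier M) (carrier N) \<and>
      (\<forall>x\<in>carrier M. \<forall>b\<in>carrier R. f (rM x b) = rN (f x) b))"

section \<open>Tensor products\<close>

text \<open>
  \<open>P \<otimes>\<^sub>R U\<close> for a bimodule \<open>P\<close> (right action \<open>rP\<close> of \<open>R\<close>) and a left \<open>R\<close>-module \<open>U\<close>:
  the free abelian group on pairs modulo the usual relations, as a left module via \<open>P\<close>.
\<close>

type_synonym ('p, 'x) tens = "('p \<times> 'x \<Rightarrow>\<^sub>0 int) set"

definition tensor_rels ::
  "('r, 's) ring_scheme \<Rightarrow> ('a, 'p) module \<Rightarrow> ('p \<Rightarrow> 'r \<Rightarrow> 'p) \<Rightarrow> ('r, 'x) module \<Rightarrow> ('p, 'x) tens"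
  where "tensor_rels R P rP U = generate (free_Abelian_group (carrier P \<times> carrier U))
    ({frag_of (p \<oplus>\<^bsub>P\<^esub> p', x) - frag_of (p, x) - frag_of (p', x) | p p' x.
        p \<in> carrier P \<and> p' \<in> carrier P \<and> x \<in> carrier U}
     \<union> {frag_of (p, x \<oplus>\<^bsub>U\<^esub> x') - frag_of (p, x) - frag_of (p, x') | p x x'.
        p \<in> carrier P \<and> x \<in> carrier U \<and> x' \<in> carrier U}
     \<union> {frag_of (rP p c, x) - frag_of (p, c \<odot>\<^bsub>U\<^esub> x) | p c x.
        p \<in> carrier P \<and> c \<in> carrier R \<and> x \<in> carrier U})"

definition tensor ::
  "('r, 's) ring_scheme \<Rightarrow> ('a, 'p) module \<Rightarrow> ('p \<Rightarrow> 'r \<Rightarrow> 'p) \<Rightarrow> ('r, 'x) module \<Rightarrow>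
    ('a, ('p, 'x) tens) module"
  where "tensor R P rP U =
    (let F = free_Abelian_group (carrier P \<times> carrier U); N = tensor_rels R P rP U
     in mk_module (carrier (F Mod N)) \<one>\<^bsub>F Mod N\<^esub> (monoid.mult (F Mod N))
          (\<lambda>a C. \<Union>z\<in>C. N #>\<^bsub>F\<^esub> frag_extend (\<lambda>(p, x). frag_of (a \<odot>\<^bsub>P\<^esub> p, x)) z))"

definition pure_tensor ::
  "('r, 's) ring_scheme \<Rightarrow> ('a, 'p) module \<Rightarrow> ('p \<Rightarrow> 'r \<Rightarrow> 'p) \<Rightarrow> ('r, 'x) module \<Rightarrow>
    'p \<Rightarrow> 'x \<Rightarrow> ('p, 'x) tens"
  where "pure_tensor R P rP U p x =
    tensor_rels R P rP U #>\<^bsub>free_Abelian_group (carrier P \<times> carrier U)\<^esub> frag_of (p, x)"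

section \<open>Algebras over a field\<close>

definition k_algebra :: "'k ring \<Rightarrow> ('k, 'a) module \<Rightarrow> bool"
  where "k_algebra K A \<longleftrightarrow> field K \<and> Module.module K A \<and> ring A \<and>
    (\<forall>c\<in>carrier K. \<forall>x\<in>carrier A. \<forall>y\<in>carrier A.
      c \<odot>\<^bsub>A\<^esub> (x \<otimes>\<^bsub>A\<^esub> y) = (c \<odot>\<^bsub>A\<^esub> x) \<otimes>\<^bsub>A\<^esub> y \<and>
      c \<odot>\<^bsub>A\<^esub> (x \<otimes>\<^bsub>A\<^esub> y) = x \<otimes>\<^bsub>A\<^esub> (c \<odot>\<^bsub>A\<^esub> y))"

definition lin_comb :: "('k, 'v) module \<Rightarrow> 'i set \<Rightarrow> ('i \<Rightarrow> 'v) \<Rightarrow> ('i \<Rightarrow> 'k) \<Rightarrow> 'v"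
  where "lin_comb V I b c = (\<Oplus>\<^bsub>V\<^esub>i\<in>I. c i \<odot>\<^bsub>V\<^esub> b i)"

definition lin_span :: "'k ring \<Rightarrow> ('k, 'v) module \<Rightarrow> 'i set \<Rightarrow> ('i \<Rightarrow> 'v) \<Rightarrow> 'v set"
  where "lin_span K V I b = {lin_comb V I b c | c. c \<in> I \<rightarrow> carrier K}"

definition finite_basis :: "'k ring \<Rightarrow> ('k, 'v) module \<Rightarrow> 'i set \<Rightarrow> ('i \<Rightarrow> 'v) \<Rightarrow> bool"
  where "finite_basis K V I b \<longleftrightarrow> finite I \<and> b \<in> I \<rightarrow> carrier V \<and>
    (\<forall>x\<in>carrier V. \<exists>!c. c \<in> I \<rightarrow>\<^sub>E carrier K \<and> x = lin_comb V I b c)"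

definition fin_dim :: "'k ring \<Rightarrow> ('k, 'v) module \<Rightarrow> bool"
  where "fin_dim K V \<longleftrightarrow> (\<exists>S. finite S \<and> S \<subseteq> carrier V \<and> lin_span K V S (\<lambda>x. x) = carrier V)"

definition bilinear ::
  "'k ring \<Rightarrow> ('k, 'v) module \<Rightarrow> ('k, 'w) module \<Rightarrow> ('k, 'z) module \<Rightarrow> ('v \<Rightarrow> 'w \<Rightarrow> 'z) \<Rightarrow> bool"
  where "bilinear K V W Z f \<longleftrightarrow> (\<forall>x\<in>carrier V. f x \<in> module_homs K W Z) \<and>
    (\<forall>y\<in>carrier W. (\<lambda>x. f x y) \<in> module_homs K V Z)"

definition algebra_embedding ::
  "'k ring \<Rightarrow> ('k, 'b) module \<Rightarrow> ('k, 'a) module \<Rightarrow> ('b \<Rightarrow> 'a) \<Rightarrow> bool"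
  where "algebra_embedding K B A f \<longleftrightarrow>
    f \<in> ring_hom B A \<and> f \<in> module_homs K B A \<and> inj_on f (carrier B)"

definition corner :: "('k, 'a) module \<Rightarrow> 'a \<Rightarrow> ('k, 'a) module"
  where "corner A e = A\<lparr>carrier := {e \<otimes>\<^bsub>A\<^esub> a \<otimes>\<^bsub>A\<^esub> e | a. a \<in> carrier A}, one := e\<rparr>"

definition anti_involution :: "'k ring \<Rightarrow> ('k, 'a) module \<Rightarrow> ('a \<Rightarrow> 'a) \<Rightarrow> bool"
  where "anti_involution K A i \<longleftrightarrow> i \<in> module_homs K A A \<and>
    (\<forall>x\<in>carrier A. i (i x) = x) \<and>
    (\<forall>x\<in>carrier A. \<forall>y\<in>carrier A. i (x \<otimes>\<^bsub>A\<^esub> y) = i y \<otimes>\<^bsub>A\<^esub> i x)"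

text \<open>
  Cellular algebras after Graham and Lehrer, for finite-dimensional algebras.  Elements of the
  poset with empty index set are irrelevant, so a finite poset of natural numbers is no restriction.
\<close>

definition cell_datum ::
  "'k ring \<Rightarrow> ('k, 'a) module \<Rightarrow> ('a \<Rightarrow> 'a) \<Rightarrow>
    nat set \<Rightarrow> nat rel \<Rightarrow> (nat \<Rightarrow> nat set) \<Rightarrow> (nat \<Rightarrow> nat \<Rightarrow> nat \<Rightarrow> 'a) \<Rightarrow> bool"
  where "cell_datum K A i L R I C \<longleftrightarrow>
    finite L \<and> partial_order_on L R \<and> (\<forall>m\<in>L. finite (I m)) \<and>
    finite_basis K A (SIGMA m:L. I m \<times> I m) (\<lambda>(m, s, t). C m s t) \<and>
    anti_involution K A i \<and> (\<forall>m\<in>L. \<forall>s\<in>I m. \<forall>t\<in>I m. i (C m s t) = C m t s) \<and>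
    (\<forall>a\<in>carrier A. \<forall>m\<in>L. \<exists>c \<in> I m \<rightarrow> I m \<rightarrow> carrier K. \<forall>s\<in>I m. \<forall>t\<in>I m.
      a \<otimes>\<^bsub>A\<^esub> C m s t \<ominus>\<^bsub>A\<^esub> (\<Oplus>\<^bsub>A\<^esub>s'\<in>I m. c s' s \<odot>\<^bsub>A\<^esub> C m s' t)
        \<in> lin_span K A (SIGMA m':{m'\<in>L. (m', m) \<in> R \<and> m' \<noteq> m}. I m' \<times> I m')
            (\<lambda>(m', s, t). C m' s t))"

definition cellular_algebra :: "'k ring \<Rightarrow> ('k, 'a) module \<Rightarrow> ('a \<Rightarrow> 'a) \<Rightarrow> bool"
  where "cellular_algebra K A i \<longleftrightarrow>
    k_algebra K A \<and> fin_dim K A \<and> (\<exists>L R I C. cell_datum K A i L R I C)"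

section \<open>Cellularly stratified algebras\<close>

definition tensor_K ::
  "'k ring \<Rightarrow> ('k, 'v) module \<Rightarrow> ('k, 'w) module \<Rightarrow> ('k, ('v, 'w) tens) module"
  where "tensor_K K V W = tensor K V (\<lambda>x c. c \<odot>\<^bsub>V\<^esub> x) W"

definition pure_K ::
  "'k ring \<Rightarrow> ('k, 'v) module \<Rightarrow> ('k, 'w) module \<Rightarrow> 'v \<Rightarrow> 'w \<Rightarrow> ('v, 'w) tens"
  where "pure_K K V W = pure_tensor K V (\<lambda>x c. c \<odot>\<^bsub>V\<^esub> x) W"

text \<open>
  The data \<open>(B\<^sub>0, V\<^sub>0, \<dots>, B\<^sub>r, V\<^sub>r)\<close>: \<open>top_layer\<close> is \<open>r\<close>; \<open>incl l\<close> is the inclusion of the summand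
  \<open>B\<^sub>l \<otimes>\<^sub>k V\<^sub>l \<otimes>\<^sub>k V\<^sub>l\<close> into \<open>A\<close>; \<open>uvec l\<close> and \<open>vvec l\<close> are the vectors defining \<open>e\<^sub>l\<close>.
\<close>

record ('k, 'b, 'v, 'a) strat_data =
  top_layer :: nat
  inp :: "nat \<Rightarrow> ('k, 'b) module"
  vsp :: "nat \<Rightarrow> ('k, 'v) module"
  incl :: "nat \<Rightarrow> (('b, 'v) tens, 'v) tens \<Rightarrow> 'a"
  uvec :: "nat \<Rightarrow> 'v"
  vvec :: "nat \<Rightarrow> 'v"

definition layer ::
  "'k ring \<Rightarrow> ('k, 'b, 'v, 'a) strat_data \<Rightarrow> nat \<Rightarrow> ('k, (('b, 'v) tens, 'v) tens) module"
  where "layer K D l = tensor_K K (tensor_K K (inp D l) (vsp D l)) (vsp D l)"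

text \<open>The element \<open>b \<otimes> x \<otimes> y\<close> of \<open>A\<close>.\<close>

definition elt ::
  "'k ring \<Rightarrow> ('k, 'b, 'v, 'a) strat_data \<Rightarrow> nat \<Rightarrow> 'b \<Rightarrow> 'v \<Rightarrow> 'v \<Rightarrow> 'a"
  where "elt K D l b x y = incl D l
    (pure_K K (tensor_K K (inp D l) (vsp D l)) (vsp D l) (pure_K K (inp D l) (vsp D l) b x) y)"

text \<open>
  \<open>below K A D l\<close> is the sum of the layers \<open>j < l\<close>, that is \<open>J\<^sub>l\<^sub>-\<^sub>1\<close>, with \<open>J\<^sub>-\<^sub>1 = 0\<close> for \<open>l = 0\<close>.
\<close>

definition below ::
  "'k ring \<Rightarrow> ('k, 'a) module \<Rightarrow> ('k, 'b, 'v, 'a) strat_data \<Rightarrow> nat \<Rightarrow> 'a set"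
  where "below K A D l =
    {\<Oplus>\<^bsub>A\<^esub>j\<in>{..<l}. incl D j (t j) | t. t \<in> (\<Pi> j\<in>{..<l}. carrier (layer K D j))}"

definition idem :: "'k ring \<Rightarrow> ('k, 'b, 'v, 'a) strat_data \<Rightarrow> nat \<Rightarrow> 'a"
  where "idem K D l = elt K D l \<one>\<^bsub>inp D l\<^esub> (uvec D l) (vvec D l)"

text \<open>
  Iterated inflation of the cellular algebras \<open>(B\<^sub>l, i\<^sub>l)\<close> along the \<open>V\<^sub>l\<close> after Koenig and Xi:
  \<open>iA\<close> is the involution of \<open>A\<close>, glued from those of the layers, and \<open>\<phi> l\<close> the bilinear form
  of layer \<open>l\<close>.
\<close>

definition iterated_inflation ::
  "'k ring \<Rightarrow> ('k, 'a) module \<Rightarrow> ('k, 'b, 'v, 'a) strat_data \<Rightarrow>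
    ('a \<Rightarrow> 'a) \<Rightarrow> (nat \<Rightarrow> 'b \<Rightarrow> 'b) \<Rightarrow> (nat \<Rightarrow> 'v \<Rightarrow> 'v \<Rightarrow> 'b) \<Rightarrow> bool"
  where "iterated_inflation K A D iA iB \<phi> \<longleftrightarrow>
    (\<forall>l\<le>top_layer D. cellular_algebra K (inp D l) (iB l) \<and>
      Module.module K (vsp D l) \<and> fin_dim K (vsp D l)) \<and>
    (\<forall>l\<le>top_layer D. incl D l \<in> module_homs K (layer K D l) A) \<and>
    (\<forall>a\<in>carrier A. \<exists>!t. t \<in> (\<Pi>\<^sub>E l\<in>{..top_layer D}. carrier (layer K D l)) \<and>
      a = (\<Oplus>\<^bsub>A\<^esub>l\<in>{..top_layer D}. incl D l (t l))) \<and>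
    (\<forall>l\<le>top_layer D. ideal (below K A D (Suc l)) A) \<and>
    (\<forall>l\<le>top_layer D. bilinear K (vsp D l) (vsp D l) (inp D l) (\<phi> l)) \<and>
    (\<forall>l\<le>top_layer D. \<forall>b\<in>carrier (inp D l). \<forall>b'\<in>carrier (inp D l).
      \<forall>x\<in>carrier (vsp D l). \<forall>y\<in>carrier (vsp D l).
      \<forall>x'\<in>carrier (vsp D l). \<forall>y'\<in>carrier (vsp D l).
        elt K D l b x y \<otimes>\<^bsub>A\<^esub> elt K D l b' x' y' \<ominus>\<^bsub>A\<^esub>
          elt K D l (b \<otimes>\<^bsub>inp D l\<^esub> \<phi> l y x' \<otimes>\<^bsub>inp D l\<^esub> b') x y' \<in> below K A D l) \<and>
    anti_involution K A iA \<and>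
    (\<forall>l\<le>top_layer D. \<forall>b\<in>carrier (inp D l). \<forall>x\<in>carrier (vsp D l). \<forall>y\<in>carrier (vsp D l).
        iA (elt K D l b x y) = elt K D l (iB l b) y x) \<and>
    (\<forall>l\<le>top_layer D. \<forall>x\<in>carrier (vsp D l). \<forall>y\<in>carrier (vsp D l). iB l (\<phi> l x y) = \<phi> l y x)"

definition cellularly_stratified ::
  "'k ring \<Rightarrow> ('k, 'a) module \<Rightarrow> ('k, 'b, 'v, 'a) strat_data \<Rightarrow> bool"
  where "cellularly_stratified K A D \<longleftrightarrow> k_algebra K A \<and>
    (\<exists>iA iB \<phi>. iterated_inflation K A D iA iB \<phi>) \<and>
    (\<forall>l\<le>top_layer D.
      uvec D l \<in> carrier (vsp D l) - {\<zero>\<^bsub>vsp D l\<^esub>} \<and> vvec D l \<in> carrier (vsp D l) - {\<zero>\<^bsub>vsp D l\<^esub>} \<and>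
      idem K D l \<otimes>\<^bsub>A\<^esub> idem K D l = idem K D l) \<and>
    (\<forall>l l'. l \<le> l' \<and> l' \<le> top_layer D \<longrightarrow>
      idem K D l \<otimes>\<^bsub>A\<^esub> idem K D l' = idem K D l \<and> idem K D l' \<otimes>\<^bsub>A\<^esub> idem K D l = idem K D l)"

text \<open>The identification of \<open>B\<^sub>l\<close> with a subset of \<open>e\<^sub>l A e\<^sub>l\<close>.\<close>

definition emb :: "'k ring \<Rightarrow> ('k, 'b, 'v, 'a) strat_data \<Rightarrow> nat \<Rightarrow> 'b \<Rightarrow> 'a"
  where "emb K D l b = elt K D l b (uvec D l) (vvec D l)"

text \<open>
  The surjection \<open>e\<^sub>l A e\<^sub>l \<rightarrow> B\<^sub>l\<close> with kernel \<open>e\<^sub>l J\<^sub>l\<^sub>-\<^sub>1 e\<^sub>l\<close>: every element of \<open>e\<^sub>l A e\<^sub>l\<close> is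
  congruent to exactly one \<open>b \<otimes> u\<^sub>l \<otimes> v\<^sub>l\<close> modulo \<open>J\<^sub>l\<^sub>-\<^sub>1\<close>.
\<close>

definition proj :: "'k ring \<Rightarrow> ('k, 'a) module \<Rightarrow> ('k, 'b, 'v, 'a) strat_data \<Rightarrow> nat \<Rightarrow> 'a \<Rightarrow> 'b"
  where "proj K A D l a =
    (THE b. b \<in> carrier (inp D l) \<and> a \<ominus>\<^bsub>A\<^esub> emb K D l b \<in> below K A D l)"

definition ind_quot ::
  "'k ring \<Rightarrow> ('k, 'a) module \<Rightarrow> ('k, 'b, 'v, 'a) strat_data \<Rightarrow> nat \<Rightarrow> ('b, 'x) module \<Rightarrow>
    ('a, ('a, 'x) tens) module"
  where "ind_quot K A D l U =
    tensor (corner A (idem K D l)) (left_ideal_module A (idem K D l)) (monoid.mult A)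
      (restrict_scalars (proj K A D l) U)"

definition Ind_sub ::
  "'k ring \<Rightarrow> ('k, 'a) module \<Rightarrow> ('k, 'b, 'v, 'a) strat_data \<Rightarrow> nat \<Rightarrow> ('b, 'x) module \<Rightarrow>
    ('a, ('a, 'x) tens) module"
  where "Ind_sub K A D l U =
    tensor (inp D l) (left_ideal_module A (idem K D l)) (\<lambda>a b. a \<otimes>\<^bsub>A\<^esub> emb K D l b) U"

text \<open>\<open>e\<^sub>l A e\<^sub>l \<simeq> B\<^sub>l \<oplus> e\<^sub>l J\<^sub>l\<^sub>-\<^sub>1 e\<^sub>l\<close> as \<open>(B\<^sub>l, B\<^sub>l)\<close>-bimodules.\<close>

definition bimodule_split ::
  "'k ring \<Rightarrow> ('k, 'a) module \<Rightarrow> ('k, 'b, 'v, 'a) strat_data \<Rightarrow> nat \<Rightarrow> bool"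
  where "bimodule_split K A D l \<longleftrightarrow>
    (let e = idem K D l; \<iota> = emb K D l; B = inp D l;
         A\<^sub>B = restrict_scalars \<iota> (regular_module A);
         eJe = {e \<otimes>\<^bsub>A\<^esub> a \<otimes>\<^bsub>A\<^esub> e | a. a \<in> below K A D l}
     in bimodule_isomorphic B
          (A\<^sub>B\<lparr>carrier := carrier (corner A e)\<rparr>) (\<lambda>a b. a \<otimes>\<^bsub>A\<^esub> \<iota> b)
          (direct_sum (regular_module B) (A\<^sub>B\<lparr>carrier := eJe\<rparr>))
          (\<lambda>(c, a) b. (c \<otimes>\<^bsub>B\<^esub> b, a \<otimes>\<^bsub>A\<^esub> \<iota> b)))"

section \<open>Symmetric groups, Hecke algebras and Young modules\<close>

definition perm_length :: "nat \<Rightarrow> (nat \<Rightarrow> nat) \<Rightarrow> nat"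
  where "perm_length m w = card {(i, j). 1 \<le> i \<and> i < j \<and> j \<le> m \<and> w j < w i}"

text \<open>
  \<open>T\<close> identifies \<open>B\<close> with the group algebra of the symmetric group, respectively with its
  Iwahori-Hecke algebra, by being the standard basis.  Permutations compose from right to left.
\<close>

definition group_algebra_basis ::
  "'k ring \<Rightarrow> nat \<Rightarrow> ('k, 'b) module \<Rightarrow> ((nat \<Rightarrow> nat) \<Rightarrow> 'b) \<Rightarrow> bool"
  where "group_algebra_basis K m B T \<longleftrightarrow> k_algebra K B \<and>
    finite_basis K B (carrier (sym_group m)) T \<and> T \<in> hom (sym_group m) B"

definition hecke_algebra_basis ::
  "'k ring \<Rightarrow> 'k \<Rightarrow> nat \<Rightarrow> ('k, 'b) module \<Rightarrow> ((nat \<Rightarrow> nat) \<Rightarrow> 'b) \<Rightarrow> bool"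
  where "hecke_algebra_basis K q m B T \<longleftrightarrow> k_algebra K B \<and>
    finite_basis K B (carrier (sym_group m)) T \<and> T id = \<one>\<^bsub>B\<^esub> \<and>
    (\<forall>w\<in>carrier (sym_group m). \<forall>i\<in>{1..<m}. let s = Transposition.transpose i (Suc i) in
      T s \<otimes>\<^bsub>B\<^esub> T w =
        (if perm_length m w < perm_length m (s \<circ> w) then T (s \<circ> w)
         else q \<odot>\<^bsub>B\<^esub> T (s \<circ> w) \<oplus>\<^bsub>B\<^esub> (q \<ominus>\<^bsub>K\<^esub> \<one>\<^bsub>K\<^esub>) \<odot>\<^bsub>B\<^esub> T w))"

definition partition_of :: "nat list \<Rightarrow> nat \<Rightarrow> bool"
  where "partition_of lam m \<longleftrightarrow> sorted_wrt (\<ge>) lam \<and> 0 \<notin> set lam \<and> sum_list lam = m"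

definition conjugate :: "nat list \<Rightarrow> nat list"
  where "conjugate lam =
    map (\<lambda>j. card {i. i < length lam \<and> j < lam ! i}) [0..<(if lam = [] then 0 else hd lam)]"

text \<open>Entry \<open>(i, j)\<close> (counted from 0) of the tableau filled with \<open>1, 2, \<dots>\<close> row by row.\<close>

definition row_tableau :: "nat list \<Rightarrow> nat \<Rightarrow> nat \<Rightarrow> nat"
  where "row_tableau lam i j = sum_list (take i lam) + j + 1"

definition young_subgroup :: "nat \<Rightarrow> nat list \<Rightarrow> (nat \<Rightarrow> nat) set"
  where "young_subgroup m lam = {w \<in> carrier (sym_group m).
    \<forall>i < length lam. w ` (row_tableau lam i ` {..<lam ! i}) = row_tableau lam i ` {..<lam ! i}}"

text \<open>The permutation taking the row by row filling to the column by column filling.\<close>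

definition col_perm :: "nat \<Rightarrow> nat list \<Rightarrow> nat \<Rightarrow> nat"
  where "col_perm m lam = (THE w. w \<in> carrier (sym_group m) \<and>
    (\<forall>i < length lam. \<forall>j < lam ! i. w (row_tableau lam i j) = row_tableau (conjugate lam) j i))"

definition x_elt :: "nat \<Rightarrow> ('k, 'b) module \<Rightarrow> ((nat \<Rightarrow> nat) \<Rightarrow> 'b) \<Rightarrow> nat list \<Rightarrow> 'b"
  where "x_elt m B T lam = (\<Oplus>\<^bsub>B\<^esub>w\<in>young_subgroup m lam. T w)"

definition y_elt ::
  "'k ring \<Rightarrow> 'k \<Rightarrow> nat \<Rightarrow> ('k, 'b) module \<Rightarrow> ((nat \<Rightarrow> nat) \<Rightarrow> 'b) \<Rightarrow> nat list \<Rightarrow> 'b"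
  where "y_elt K q m B T lam =
    (\<Oplus>\<^bsub>B\<^esub>w\<in>young_subgroup m lam. ((inv\<^bsub>K\<^esub> (\<ominus>\<^bsub>K\<^esub> q)) [^]\<^bsub>K\<^esub> perm_length m w) \<odot>\<^bsub>B\<^esub> T w)"

text \<open>
  The Specht submodule of a permutation module \<open>M\<close> with generator \<open>g\<close>, after Dipper and James:
  it is generated by \<open>y\<^bsub>\<lambda>'\<^esub> T\<^bsub>w\<^esub> g\<close> with \<open>w = col_perm m lam\<close>.  For group algebras (\<open>q = 1\<close>, where
  the coefficients of \<open>y_elt\<close> are signs) this generator is, up to a translate, the polytabloid
  of the row by row tableau.
\<close>

definition specht_in ::
  "'k ring \<Rightarrow> 'k \<Rightarrow> nat \<Rightarrow> ('k, 'b) module \<Rightarrow> ((nat \<Rightarrow> nat) \<Rightarrow> 'b) \<Rightarrow> nat list \<Rightarrow>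
    ('b, 'm) module \<Rightarrow> 'm \<Rightarrow> 'm set"
  where "specht_in K q m B T lam M g =
    {(b \<otimes>\<^bsub>B\<^esub> y_elt K q m B T (conjugate lam) \<otimes>\<^bsub>B\<^esub> T (col_perm m lam)) \<odot>\<^bsub>M\<^esub> g | b. b \<in> carrier B}"

text \<open>
  For group algebras \<open>M\<^sup>\<lambda>\<close> is induced from the trivial module of \<open>k\<Sigma>\<^sub>\<lambda>\<close>, on which an element
  acts by its augmentation, the sum of its coefficients.
\<close>

definition young_subalgebra ::
  "'k ring \<Rightarrow> nat \<Rightarrow> ('k, 'b) module \<Rightarrow> ((nat \<Rightarrow> nat) \<Rightarrow> 'b) \<Rightarrow> nat list \<Rightarrow> ('k, 'b) module"
  where "young_subalgebra K m B T lam = B\<lparr>carrier := lin_span K B (young_subgroup m lam) T\<rparr>"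

definition augmentation ::
  "'k ring \<Rightarrow> nat \<Rightarrow> ('k, 'b) module \<Rightarrow> ((nat \<Rightarrow> nat) \<Rightarrow> 'b) \<Rightarrow> 'b \<Rightarrow> 'k"
  where "augmentation K m B T b = (THE e. \<exists>c \<in> carrier (sym_group m) \<rightarrow> carrier K.
    b = lin_comb B (carrier (sym_group m)) T c \<and> e = (\<Oplus>\<^bsub>K\<^esub>w\<in>carrier (sym_group m). c w))"

definition trivial_module ::
  "'k ring \<Rightarrow> nat \<Rightarrow> ('k, 'b) module \<Rightarrow> ((nat \<Rightarrow> nat) \<Rightarrow> 'b) \<Rightarrow> ('b, 'k) module"
  where "trivial_module K m B T =
    restrict_scalars (augmentation K m B T) (regular_module K)"

definition group_perm_module ::
  "'k ring \<Rightarrow> nat \<Rightarrow> ('k, 'b) module \<Rightarrow> ((nat \<Rightarrow> nat) \<Rightarrow> 'b) \<Rightarrow> nat list \<Rightarrow>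
    ('b, ('b, 'k) tens) module"
  where "group_perm_module K m B T lam =
    tensor (young_subalgebra K m B T lam) (regular_module B) (monoid.mult B) (trivial_module K m B T)"

definition group_perm_gen ::
  "'k ring \<Rightarrow> nat \<Rightarrow> ('k, 'b) module \<Rightarrow> ((nat \<Rightarrow> nat) \<Rightarrow> 'b) \<Rightarrow> nat list \<Rightarrow> ('b, 'k) tens"
  where "group_perm_gen K m B T lam =
    pure_tensor (young_subalgebra K m B T lam) (regular_module B) (monoid.mult B)
      (trivial_module K m B T) \<one>\<^bsub>B\<^esub> \<one>\<^bsub>K\<^esub>"

definition hecke_perm_module ::
  "nat \<Rightarrow> ('k, 'b) module \<Rightarrow> ((nat \<Rightarrow> nat) \<Rightarrow> 'b) \<Rightarrow> nat list \<Rightarrow> ('b, 'b) module"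
  where "hecke_perm_module m B T lam = left_ideal_module B (x_elt m B T lam)"

definition isomorphic_to_summand_containing ::
  "('r, 's) ring_scheme \<Rightarrow> ('r, 'm) module \<Rightarrow> 'm set \<Rightarrow> ('r, 'x) module \<Rightarrow> bool"
  where "isomorphic_to_summand_containing R M S U \<longleftrightarrow> left_module R U \<and>
    (\<exists>N. direct_summand R M N \<and> S \<subseteq> N \<and> indecomposable R (M\<lparr>carrier := N\<rparr>) \<and>
      module_isomorphic R U (M\<lparr>carrier := N\<rparr>))"

text \<open>\<open>U\<close> is (isomorphic to) the Young module \<open>Y\<^sup>\<lambda>\<close> of \<open>B\<close>.\<close>

definition young_module ::
  "'k ring \<Rightarrow> 'k \<Rightarrow> nat \<Rightarrow> ('k, 'b) module \<Rightarrow> ((nat \<Rightarrow> nat) \<Rightarrow> 'b) \<Rightarrow> nat list \<Rightarrow>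
    ('b, 'x) module \<Rightarrow> bool"
  where "young_module K q m B T lam U \<longleftrightarrow>
    (group_algebra_basis K m B T \<and>
      (let M = group_perm_module K m B T lam
       in isomorphic_to_summand_containing B M
            (specht_in K \<one>\<^bsub>K\<^esub> m B T lam M (group_perm_gen K m B T lam)) U)) \<or>
    (hecke_algebra_basis K q m B T \<and>
      (let M = hecke_perm_module m B T lam
       in isomorphic_to_summand_containing B M
            (specht_in K q m B T lam M (x_elt m B T lam)) U))"

text \<open>\<open>Y\<close> is (isomorphic to) the Young module \<open>Y(l, \<lambda>)\<close> of \<open>A\<close>, where \<open>U\<close> is \<open>Y\<^sup>\<lambda>\<close>.\<close>

definition strat_young_module ::
  "'k ring \<Rightarrow> ('k, 'a) module \<Rightarrow> ('k, 'b, 'v, 'a) strat_data \<Rightarrow> nat \<Rightarrow> ('b, 'x) module \<Rightarrow>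
    ('a, 'y) module \<Rightarrow> bool"
  where "strat_young_module K A D l U Y \<longleftrightarrow> left_module A Y \<and>
    (\<exists>N. direct_summand A (Ind_sub K A D l U) N \<and>
      indecomposable A ((Ind_sub K A D l U)\<lparr>carrier := N\<rparr>) \<and>
      module_isomorphic A Y ((Ind_sub K A D l U)\<lparr>carrier := N\<rparr>)) \<and>
    (\<exists>Q. submodule Q A Y \<and> module_isomorphic A (quotient_module Y Q) (ind_quot K A D l U))"

definition Lambda :: "nat \<Rightarrow> (nat \<Rightarrow> nat) \<Rightarrow> (nat \<times> nat list) set"
  where "Lambda r n = {(l, lam). l \<le> r \<and> partition_of lam (n l)}"

end

theory Submission
  imports Defs
begin

text \<open>
  Let \<open>J\<close> be the ideal below the layer \<open>l\<close> and \<open>e = e\<^sub>l\<close>.  The functor \<open>X \<mapsto> e X / e J X\<close> sends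
  \<open>Ind\<^sub>l U\<close> to \<open>U\<close> and does not annihilate \<open>ind\<^sub>l U\<close>.  Hence it sends \<open>Y(l, \<lambda>)\<close>, a summand of
  \<open>Ind\<^sub>l Y\<^sup>\<lambda>\<close> with quotient \<open>ind\<^sub>l Y\<^sup>\<lambda>\<close>, to a nonzero summand of the indecomposable module
  \<open>Y\<^sup>\<lambda>\<close>, that is to \<open>Y\<^sup>\<lambda>\<close> itself, and \<open>Y(l, \<lambda>)\<close> determines \<open>Y\<^sup>\<lambda>\<close> up to isomorphism.

  An isomorphism between \<open>Y\<^sup>\<lambda>\<close> and \<open>Y\<^sup>\<kappa>\<close> yields a map \<open>M\<^sup>\<lambda> \<rightarrow> M\<^sup>\<kappa>\<close> that does not vanish on the
  generator \<open>y\<^bsub>\<lambda>'\<^esub> T\<^bsub>w\<^esub> x\<^bsub>\<lambda>\<^esub>\<close> of the Specht module.  Then \<open>y\<^bsub>\<lambda>'\<^esub> H x\<^bsub>\<kappa>\<^esub> \<noteq> 0\<close>, which forces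
  \<open>\<kappa>\<close> to be dominated by \<open>\<lambda>\<close>: if \<open>w\<close> maps two letters of a row of \<open>\<kappa>\<close> into one column of
  \<open>\<lambda>\<close>, then \<open>y\<^bsub>\<lambda>'\<^esub> T\<^bsub>w\<^esub> x\<^bsub>\<kappa>\<^esub>\<close> contains a factor
  \<open>(1 - q\<^sup>-\<^sup>1 T\<^bsub>s\<^esub>) T\<^bsub>d\<^esub> (1 + T\<^bsub>s'\<^esub>)\<close> with \<open>s d = d s'\<close>, which is zero.  By symmetry \<open>\<lambda> = \<kappa>\<close>.
\<close>

section \<open>Modules and additive maps\<close>

text \<open>The quotient \<open>e X / e J X\<close> is never formed. It is replaced by an additive
  surjection onto \<open>U\<close> that is compatible with the corner through \<open>pr\<close> and
  whose kernel is described inside \<open>X\<close> alone: \<open>y\<close> is killed exactly if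
  \<open>e y\<close> lies in \<open>J X\<close>. As \<open>J\<close> is an ideal, this is the kernel
  of the passage to \<open>e X / e J X\<close>, and isomorphisms of modules preserve it.
  Indecomposability of \<open>U\<close> enters through the complement: the images of a summand of
  \<open>Ind\<^sub>l U\<close> and of its complement are complementary in \<open>U\<close>, so one
  of them is zero, and the quotient \<open>ind\<^sub>l U\<close> decides which one.

  On the Hecke side the obstacle is that a Young module is given only up to isomorphism, and that
  permutation modules come in two models, a tensor product and a left ideal. The argument is
  therefore phrased for a cyclic generator on which the adjacent transpositions of the Young
  subgroup act by \<open>q\<close> and which the Specht element does not kill. Such generators pass
  to summands and along isomorphisms. The group algebra is the case \<open>q = 1\<close>.\<close>

lemma mk_module_simps [simp]:
  "carrier (mk_module C z p s) = C" "ring.zero (mk_module C z p s) = z"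
  "ring.add (mk_module C z p s) = p" "smult (mk_module C z p s) = s"
  by (simp_all add: mk_module_def)

text \<open>Records that agree in carrier, product and unit may still differ in further fields. The
  tensor product, the regular module and modules with restricted scalars obtain their additive
  groups by this comparison.\<close>

lemma comm_group_cong:
  assumes "comm_group G" "carrier H = carrier G" "monoid.mult H = monoid.mult G" "one H = one G"
  shows "comm_group H"
proof -
  interpret G: comm_group G by fact
  show ?thesis
  proof (rule comm_groupI)
    show "\<exists>y\<in>carrier H. y \<otimes>\<^bsub>H\<^esub> x = \<one>\<^bsub>H\<^esub>" if "x \<in> carrier H" for x
      using that G.l_inv G.inv_closed assms by metis
  qed (simp_all add: assms G.m_assoc G.m_comm G.m_lcomm)
qed

lemma abelian_groupI_comm_group: "comm_group (add_monoid G) \<Longrightarrow> abelian_group G"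
  by (simp add: abelian_group_def abelian_monoid_def abelian_group_axioms_def comm_group_def)

lemma abelian_group_update_carrier:
  fixes M :: "('r, 'm) module"
  assumes "abelian_group M" "subgroup N (add_monoid M)"
  shows "abelian_group (M\<lparr>carrier := N\<rparr>)"
proof -
  interpret M: abelian_group M by fact
  have "comm_group ((add_monoid M)\<lparr>carrier := N\<rparr>)"
    by (rule group.group_comm_groupI)
      (use subgroup.subgroup_is_group[OF assms(2) M.a_group] subgroup.subset[OF assms(2)] in
        \<open>auto simp: subset_iff intro: M.a_comm\<close>)
  then show ?thesis
    by (intro abelian_groupI_comm_group) simp
qed

lemma module_homsD:
  assumes "f \<in> module_homs R M N"
  shows "x \<in> carrier M \<Longrightarrow> f x \<in> carrier N"
    and "\<lbrakk>x \<in> carrier M; y \<in> carrier M\<rbrakk> \<Longrightarrow> f (x \<oplus>\<^bsub>M\<^esub> y) = f x \<oplus>\<^bsub>N\<^esub> f y"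
    and "\<lbrakk>a \<in> carrier R; x \<in> carrier M\<rbrakk> \<Longrightarrow> f (a \<odot>\<^bsub>M\<^esub> x) = a \<odot>\<^bsub>N\<^esub> f x"
  using assms by (auto simp: module_homs_def)

lemma module_homs_comp:
  assumes "f \<in> module_homs R M N" "g \<in> module_homs R N L"
  shows "(\<lambda>x. g (f x)) \<in> module_homs R M L"
  using module_homsD[OF assms(1)] module_homsD[OF assms(2)] by (simp add: module_homs_def)

text \<open>Additivity alone is isolated because many maps below connect modules over different
  rings or are linear over none: the action of one scalar, the scalar multiples of one vector, one
  slot of a pure tensor, the evaluation \<open>Phi\<close>.\<close>

definition add_hom :: "('m, 'a) ring_scheme \<Rightarrow> ('n, 'b) ring_scheme \<Rightarrow> ('m \<Rightarrow> 'n) \<Rightarrow> bool"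
  where "add_hom M N f \<longleftrightarrow> f \<in> carrier M \<rightarrow> carrier N \<and>
    (\<forall>x\<in>carrier M. \<forall>y\<in>carrier M. f (x \<oplus>\<^bsub>M\<^esub> y) = f x \<oplus>\<^bsub>N\<^esub> f y)"

lemma add_hom_module_homs: "f \<in> module_homs R M N \<Longrightarrow> add_hom M N f"
  by (auto simp: module_homs_def add_hom_def)

lemma add_homD:
  assumes "add_hom M N f"
  shows "x \<in> carrier M \<Longrightarrow> f x \<in> carrier N"
    and "\<lbrakk>x \<in> carrier M; y \<in> carrier M\<rbrakk> \<Longrightarrow> f (x \<oplus>\<^bsub>M\<^esub> y) = f x \<oplus>\<^bsub>N\<^esub> f y"
  using assms by (auto simp: add_hom_def)

lemma add_hom_abelian_group_hom:
  assumes "abelian_group M" "abelian_group N" "add_hom M N f"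
  shows "abelian_group_hom M N f"
proof -
  interpret M: abelian_group M by fact
  interpret N: abelian_group N by fact
  show ?thesis
    using assms(3) M.a_group N.a_group
    by unfold_locales (auto simp: hom_def add_hom_def)
qed

lemma add_hom_zero_minus:
  assumes "abelian_group M" "abelian_group N" "add_hom M N f"
  shows "f \<zero>\<^bsub>M\<^esub> = \<zero>\<^bsub>N\<^esub>"
    and "x \<in> carrier M \<Longrightarrow> f (\<ominus>\<^bsub>M\<^esub> x) = \<ominus>\<^bsub>N\<^esub> f x"
    and "\<lbrakk>x \<in> carrier M; y \<in> carrier M\<rbrakk> \<Longrightarrow> f (x \<ominus>\<^bsub>M\<^esub> y) = f x \<ominus>\<^bsub>N\<^esub> f y"
proof -
  interpret abelian_group_hom M N f by (rule add_hom_abelian_group_hom[OF assms])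
  show "f \<zero>\<^bsub>M\<^esub> = \<zero>\<^bsub>N\<^esub>" and m: "x \<in> carrier M \<Longrightarrow> f (\<ominus>\<^bsub>M\<^esub> x) = \<ominus>\<^bsub>N\<^esub> f x" for x
    by simp_all
  show "\<lbrakk>x \<in> carrier M; y \<in> carrier M\<rbrakk> \<Longrightarrow> f (x \<ominus>\<^bsub>M\<^esub> y) = f x \<ominus>\<^bsub>N\<^esub> f y"
    by (simp add: a_minus_def)
qed

lemma add_hom_finsum:
  assumes "abelian_group M" "abelian_group N" "add_hom M N f" "finite I" "g \<in> I \<rightarrow> carrier M"
  shows "f (\<Oplus>\<^bsub>M\<^esub>i\<in>I. g i) = (\<Oplus>\<^bsub>N\<^esub>i\<in>I. f (g i))"
proof -
  interpret M: abelian_group M by fact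
  interpret N: abelian_group N by fact
  show ?thesis
    using assms(4,5)
  proof (induction rule: finite_induct)
    case empty
    then show ?case by (simp add: add_hom_zero_minus(1)[OF assms(1-3)])
  next
    case (insert i I)
    have "f (g j) \<in> carrier N" if "j \<in> insert i I" for j
      using insert.prems that add_homD(1)[OF assms(3)] by blast
    then show ?case
      using insert by (simp add: Pi_iff add_homD(2)[OF assms(3)])
  qed
qed

lemma (in abelian_group) eq_of_diff:
  assumes "x \<ominus> y = \<zero>" "x \<in> carrier G" "y \<in> carrier G"
  shows "x = y"
proof -
  have "x = x \<ominus> y \<oplus> y" using assms(2,3) by (simp add: a_minus_def a_assoc l_neg)
  then show ?thesis using assms by simp
qed

section \<open>Submodules, direct decompositions and quotient modules\<close>

context left_module
begin

lemma left_module: "left_module R M" ..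

lemma add_hom_smult: "a \<in> carrier R \<Longrightarrow> add_hom M M (\<lambda>x. a \<odot>\<^bsub>M\<^esub> x)"
  by (simp add: add_hom_def smult_closed smult_r_distr)

lemma add_hom_scalar: "x \<in> carrier M \<Longrightarrow> add_hom R M (\<lambda>a. a \<odot>\<^bsub>M\<^esub> x)"
  by (simp add: add_hom_def smult_closed smult_l_distr)

lemmas smult_r_zero = add_hom_zero_minus(1)[OF M.abelian_group_axioms M.abelian_group_axioms add_hom_smult]
lemmas smult_r_diff = add_hom_zero_minus(3)[OF M.abelian_group_axioms M.abelian_group_axioms add_hom_smult]
lemmas smult_l_zero = add_hom_zero_minus(1)[OF R.abelian_group_axioms M.abelian_group_axioms add_hom_scalar]
lemmas smult_l_neg = add_hom_zero_minus(2)[OF R.abelian_group_axioms M.abelian_group_axioms add_hom_scalar]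
lemmas smult_l_diff = add_hom_zero_minus(3)[OF R.abelian_group_axioms M.abelian_group_axioms add_hom_scalar]

lemma submoduleD:
  assumes "submodule N R M"
  shows "N \<subseteq> carrier M" "\<zero>\<^bsub>M\<^esub> \<in> N" "x \<in> N \<Longrightarrow> \<ominus>\<^bsub>M\<^esub> x \<in> N"
    "\<lbrakk>x \<in> N; y \<in> N\<rbrakk> \<Longrightarrow> x \<oplus>\<^bsub>M\<^esub> y \<in> N" "\<lbrakk>x \<in> N; y \<in> N\<rbrakk> \<Longrightarrow> x \<ominus>\<^bsub>M\<^esub> y \<in> N"
    "\<lbrakk>a \<in> carrier R; x \<in> N\<rbrakk> \<Longrightarrow> a \<odot>\<^bsub>M\<^esub> x \<in> N"
proof -
  interpret N: submodule N R M by fact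
  show "N \<subseteq> carrier M" "\<zero>\<^bsub>M\<^esub> \<in> N" "\<lbrakk>x \<in> N; y \<in> N\<rbrakk> \<Longrightarrow> x \<oplus>\<^bsub>M\<^esub> y \<in> N"
    "\<lbrakk>a \<in> carrier R; x \<in> N\<rbrakk> \<Longrightarrow> a \<odot>\<^bsub>M\<^esub> x \<in> N" for x y
    using N.subset N.one_closed N.m_closed[of x y] by auto
  show m: "x \<in> N \<Longrightarrow> \<ominus>\<^bsub>M\<^esub> x \<in> N" for x
    using N.m_inv_closed[of x] by (simp add: a_inv_def)
  show "\<lbrakk>x \<in> N; y \<in> N\<rbrakk> \<Longrightarrow> x \<ominus>\<^bsub>M\<^esub> y \<in> N"
    using N.m_closed[OF _ m[of y]] by (simp add: a_minus_def)
qed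

lemma submoduleI':
  assumes "N \<subseteq> carrier M" "\<zero>\<^bsub>M\<^esub> \<in> N" "\<And>x. x \<in> N \<Longrightarrow> \<ominus>\<^bsub>M\<^esub> x \<in> N"
    "\<And>x y. \<lbrakk>x \<in> N; y \<in> N\<rbrakk> \<Longrightarrow> x \<oplus>\<^bsub>M\<^esub> y \<in> N" "\<And>a x. \<lbrakk>a \<in> carrier R; x \<in> N\<rbrakk> \<Longrightarrow> a \<odot>\<^bsub>M\<^esub> x \<in> N"
  shows "submodule N R M"
  using assms by (auto intro!: submodule.intro subgroup.intro simp: submodule_axioms_def a_inv_def)

lemma submodule_left_module:
  assumes "submodule N R M"
  shows "left_module R (M\<lparr>carrier := N\<rparr>)"
proof -
  interpret N: submodule N R M by fact
  have N: "x \<in> N \<Longrightarrow> x \<in> carrier M" for x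
    using submoduleD(1)[OF assms] by blast
  interpret MN: abelian_group "M\<lparr>carrier := N\<rparr>"
    by (rule abelian_group_update_carrier) (rule M.abelian_group_axioms, rule N.subgroup_axioms)
  show ?thesis
    by unfold_locales
      (auto simp: N submoduleD(6)[OF assms] smult_l_distr smult_r_distr smult_assoc smult_one)
qed

lemma complementary_decomp:
  assumes "complementary R M N N'" "x \<in> carrier M"
  obtains y z where "y \<in> N" "z \<in> N'" "x = y \<oplus>\<^bsub>M\<^esub> z"
proof -
  have "x \<in> N <+>\<^bsub>M\<^esub> N'" using assms by (simp add: complementary_def)
  then show ?thesis using that by (auto simp: set_add_def')
qed

text \<open>The element \<open>y - y'\<close> equals \<open>z' - z\<close>, so it lies in both
  summands and vanishes.\<close>

lemma complementary_unique:
  assumes "complementary R M N N'" "y \<in> N" "z \<in> N'" "y' \<in> N" "z' \<in> N'"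
    "y \<oplus>\<^bsub>M\<^esub> z = y' \<oplus>\<^bsub>M\<^esub> z'"
  shows "y = y'" "z = z'"
proof -
  have N: "submodule N R M" and N': "submodule N' R M" and int: "N \<inter> N' = {\<zero>\<^bsub>M\<^esub>}"
    using assms(1) by (auto simp: complementary_def)
  have c: "y \<in> carrier M" "z \<in> carrier M" "y' \<in> carrier M" "z' \<in> carrier M"
    using assms submoduleD(1)[OF N] submoduleD(1)[OF N'] by auto
  have "y \<ominus>\<^bsub>M\<^esub> y' = (y \<oplus>\<^bsub>M\<^esub> z) \<ominus>\<^bsub>M\<^esub> (y' \<oplus>\<^bsub>M\<^esub> z)"
    using c by (simp add: a_minus_def M.minus_add M.a_assoc M.a_lcomm[of z] M.r_neg)
  also have "\<dots> = (y' \<oplus>\<^bsub>M\<^esub> z') \<ominus>\<^bsub>M\<^esub> (y' \<oplus>\<^bsub>M\<^esub> z)" by (simp add: assms(6))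
  also have "\<dots> = z' \<ominus>\<^bsub>M\<^esub> z"
    using c by (simp add: a_minus_def M.minus_add M.a_assoc M.a_lcomm[of z'] M.r_neg1 M.r_neg2)
  finally have eq: "y \<ominus>\<^bsub>M\<^esub> y' = z' \<ominus>\<^bsub>M\<^esub> z" .
  moreover have "y \<ominus>\<^bsub>M\<^esub> y' \<in> N" "z' \<ominus>\<^bsub>M\<^esub> z \<in> N'"
    using assms submoduleD(5)[OF N] submoduleD(5)[OF N'] by auto
  ultimately have "y \<ominus>\<^bsub>M\<^esub> y' = \<zero>\<^bsub>M\<^esub>" "z' \<ominus>\<^bsub>M\<^esub> z = \<zero>\<^bsub>M\<^esub>" using int by auto
  then show "y = y'" "z = z'" using c M.eq_of_diff by auto
qed

text \<open>The component in \<open>N\<close> is chosen for every element; uniqueness of components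
  makes the choice linear.\<close>

lemma complementary_projection:
  assumes "complementary R M N N'"
  obtains p where "p \<in> module_homs R M (M\<lparr>carrier := N\<rparr>)" "\<And>x. x \<in> N \<Longrightarrow> p x = x"
    "\<And>x. x \<in> N' \<Longrightarrow> p x = \<zero>\<^bsub>M\<^esub>"
proof -
  have N: "submodule N R M" and N': "submodule N' R M"
    using assms(1) by (auto simp: complementary_def)
  note c = subsetD[OF submoduleD(1)[OF N]] subsetD[OF submoduleD(1)[OF N']]
  have "\<forall>x\<in>carrier M. \<exists>y. y \<in> N \<and> (\<exists>z\<in>N'. y \<oplus>\<^bsub>M\<^esub> z = x)"
    by (metis complementary_decomp[OF assms])
  then obtain p where p: "\<And>x. x \<in> carrier M \<Longrightarrow> p x \<in> N \<and> (\<exists>z\<in>N'. p x \<oplus>\<^bsub>M\<^esub> z = x)"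
    by metis
  \<comment> \<open>Any decomposition of \<open>x\<close> may be used to compute \<open>p x\<close>.
    All remaining properties of \<open>p\<close> are obtained by exhibiting a suitable
    decomposition.\<close>
  have u: "p x = y" if "y \<in> N" "z \<in> N'" "x = y \<oplus>\<^bsub>M\<^esub> z" for x y z
  proof -
    have "x \<in> carrier M" using that c by simp
    then obtain z' where "p x \<in> N" "z' \<in> N'" "p x \<oplus>\<^bsub>M\<^esub> z' = x" using p by blast
    then show ?thesis using complementary_unique(1)[OF assms, of "p x" z' y z] that by simp
  qed
  have "p \<in> module_homs R M (M\<lparr>carrier := N\<rparr>)"
    unfolding module_homs_def
  proof (intro CollectI conjI ballI)
    show "p \<in> carrier M \<rightarrow> carrier (M\<lparr>carrier := N\<rparr>)" using p by simp
  next
    fix x y assume xy: "x \<in> carrier M" "y \<in> carrier M"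
    obtain z where z: "z \<in> N'" "p x \<oplus>\<^bsub>M\<^esub> z = x" using p xy by blast
    obtain z' where z': "z' \<in> N'" "p y \<oplus>\<^bsub>M\<^esub> z' = y" using p xy by blast
    have "p x \<in> carrier M" "p y \<in> carrier M" "z \<in> carrier M" "z' \<in> carrier M"
      using p xy c z z' by auto
    then have "(p x \<oplus>\<^bsub>M\<^esub> z) \<oplus>\<^bsub>M\<^esub> (p y \<oplus>\<^bsub>M\<^esub> z') = (p x \<oplus>\<^bsub>M\<^esub> p y) \<oplus>\<^bsub>M\<^esub> (z \<oplus>\<^bsub>M\<^esub> z')"
      by (simp add: M.a_ac)
    then have "x \<oplus>\<^bsub>M\<^esub> y = (p x \<oplus>\<^bsub>M\<^esub> p y) \<oplus>\<^bsub>M\<^esub> (z \<oplus>\<^bsub>M\<^esub> z')"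
      using z(2) z'(2) by simp
    then have "p (x \<oplus>\<^bsub>M\<^esub> y) = p x \<oplus>\<^bsub>M\<^esub> p y"
      by (intro u[of _ "z \<oplus>\<^bsub>M\<^esub> z'"] submoduleD(4)[OF N] submoduleD(4)[OF N'] z z')
        (use p xy in blast)+
    then show "p (x \<oplus>\<^bsub>M\<^esub> y) = p x \<oplus>\<^bsub>M\<lparr>carrier := N\<rparr>\<^esub> p y"
      by simp
  next
    fix a x assume ax: "a \<in> carrier R" "x \<in> carrier M"
    obtain z where z: "z \<in> N'" "p x \<oplus>\<^bsub>M\<^esub> z = x" using p ax by blast
    have "p x \<in> carrier M" "z \<in> carrier M" using p ax c z by auto
    then have "a \<odot>\<^bsub>M\<^esub> (p x \<oplus>\<^bsub>M\<^esub> z) = a \<odot>\<^bsub>M\<^esub> p x \<oplus>\<^bsub>M\<^esub> a \<odot>\<^bsub>M\<^esub> z"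
      using smult_r_distr ax by blast
    then have "a \<odot>\<^bsub>M\<^esub> x = a \<odot>\<^bsub>M\<^esub> p x \<oplus>\<^bsub>M\<^esub> a \<odot>\<^bsub>M\<^esub> z" using z(2) by simp
    then have "p (a \<odot>\<^bsub>M\<^esub> x) = a \<odot>\<^bsub>M\<^esub> p x"
      by (intro u[of _ "a \<odot>\<^bsub>M\<^esub> z"] submoduleD(6)[OF N] submoduleD(6)[OF N'] z ax)
        (use p ax in blast)+
    then show "p (a \<odot>\<^bsub>M\<^esub> x) = a \<odot>\<^bsub>M\<lparr>carrier := N\<rparr>\<^esub> p x"
      by simp
  qed
  moreover have "p x = x" if "x \<in> N" for x
    using u[of x "\<zero>\<^bsub>M\<^esub>" x] that c submoduleD(2)[OF N'] by simp
  moreover have "p x = \<zero>\<^bsub>M\<^esub>" if "x \<in> N'" for x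
    using u[of "\<zero>\<^bsub>M\<^esub>" x x] that c submoduleD(2)[OF N] by simp
  ultimately show ?thesis using that by blast
qed

lemma quotient_hom:
  assumes "submodule Q R M"
  shows "(\<lambda>x. Q +>\<^bsub>M\<^esub> x) \<in> module_homs R M (quotient_module M Q)"
    and "(\<lambda>x. Q +>\<^bsub>M\<^esub> x) ` carrier M = carrier (quotient_module M Q)"
proof -
  interpret Q: submodule Q R M by fact
  interpret Q: normal Q "add_monoid M"
    by (rule comm_group.subgroup_imp_normal) (rule M.a_comm_group, rule Q.subgroup_axioms)
  note Qc = submoduleD(1)[OF assms]
  show "(\<lambda>x. Q +>\<^bsub>M\<^esub> x) ` carrier M = carrier (quotient_module M Q)"
    by (auto simp: quotient_module_def A_RCOSETS_def')
  \<comment> \<open>The action on cosets is defined as a union over representatives. The cosets in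
    this union coincide because \<open>Q\<close> is a submodule, and the union is not empty because
    \<open>x\<close> lies in its own coset.\<close>
  have s: "(\<Union>y\<in>Q +>\<^bsub>M\<^esub> x. Q +>\<^bsub>M\<^esub> (a \<odot>\<^bsub>M\<^esub> y)) = Q +>\<^bsub>M\<^esub> (a \<odot>\<^bsub>M\<^esub> x)"
    if a: "a \<in> carrier R" and x: "x \<in> carrier M" for a x
  proof -
    have "Q +>\<^bsub>M\<^esub> (a \<odot>\<^bsub>M\<^esub> y) = Q +>\<^bsub>M\<^esub> (a \<odot>\<^bsub>M\<^esub> x)" if "y \<in> Q +>\<^bsub>M\<^esub> x" for y
    proof -
      obtain h where h: "h \<in> Q" "y = h \<oplus>\<^bsub>M\<^esub> x" using \<open>y \<in> Q +>\<^bsub>M\<^esub> x\<close> by (auto simp: a_r_coset_def')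
      have "h \<in> carrier M" using h Qc by auto
      then have "a \<odot>\<^bsub>M\<^esub> y = a \<odot>\<^bsub>M\<^esub> h \<oplus>\<^bsub>M\<^esub> a \<odot>\<^bsub>M\<^esub> x" using h a x by (simp add: smult_r_distr)
      moreover have "a \<odot>\<^bsub>M\<^esub> h \<in> Q" using submoduleD(6)[OF assms a] h by blast
      ultimately have "a \<odot>\<^bsub>M\<^esub> y \<in> Q +>\<^bsub>M\<^esub> (a \<odot>\<^bsub>M\<^esub> x)" by (auto simp: a_r_coset_def')
      then show ?thesis
        using M.add.repr_independence[of "a \<odot>\<^bsub>M\<^esub> y" Q "a \<odot>\<^bsub>M\<^esub> x"] Q.subgroup_axioms a x smult_closed
        by (simp add: a_r_coset_def)
    qed
    moreover have "x \<in> Q +>\<^bsub>M\<^esub> x"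
      using submoduleD(2)[OF assms] x by (force simp: a_r_coset_def')
    ultimately show ?thesis by blast
  qed
  show "(\<lambda>x. Q +>\<^bsub>M\<^esub> x) \<in> module_homs R M (quotient_module M Q)"
    using Q.rcos_sum s
    by (auto simp: module_homs_def quotient_module_def A_RCOSETS_def' simp flip: a_r_coset_def set_add_def)
qed

end

section \<open>Tensor products\<close>

text \<open>The base \<open>R\<close> enters only through closure of its two actions. This lets one
  locale serve for the ground field, an input algebra, a corner of \<open>A\<close> and the span of
  a Young subgroup.\<close>

locale balanced_pair =
  P: abelian_group P + U: abelian_group U
  for R :: "('r, 's) ring_scheme" and P :: "('a, 'p) module" and rP :: "'p \<Rightarrow> 'r \<Rightarrow> 'p"
    and U :: "('r, 'x) module" +
  assumes right_closed: "\<lbrakk>p \<in> carrier P; c \<in> carrier R\<rbrakk> \<Longrightarrow> rP p c \<in> carrier P"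
    and scalar_closed: "\<lbrakk>c \<in> carrier R; x \<in> carrier U\<rbrakk> \<Longrightarrow> c \<odot>\<^bsub>U\<^esub> x \<in> carrier U"
begin

abbreviation "FA \<equiv> free_Abelian_group (carrier P \<times> carrier U)"
abbreviation "rels \<equiv> tensor_rels R P rP U"
abbreviation "TP \<equiv> tensor R P rP U"
abbreviation "pure \<equiv> pure_tensor R P rP U"

definition "rel_gens =
  {frag_of (p \<oplus>\<^bsub>P\<^esub> p', x) - frag_of (p, x) - frag_of (p', x) | p p' x.
        p \<in> carrier P \<and> p' \<in> carrier P \<and> x \<in> carrier U}
     \<union> {frag_of (p, x \<oplus>\<^bsub>U\<^esub> x') - frag_of (p, x) - frag_of (p, x') | p x x'.
        p \<in> carrier P \<and> x \<in> carrier U \<and> x' \<in> carrier U}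
     \<union> {frag_of (rP p c, x) - frag_of (p, c \<odot>\<^bsub>U\<^esub> x) | p c x.
        p \<in> carrier P \<and> c \<in> carrier R \<and> x \<in> carrier U}"

lemma rels_eq: "rels = generate FA rel_gens"
  by (simp add: tensor_rels_def rel_gens_def)

lemma FA_diff:
  "\<lbrakk>z \<in> carrier FA; w \<in> carrier FA\<rbrakk> \<Longrightarrow> z - w \<in> carrier FA"
  using keys_diff[of z w] by auto

lemma FA_add:
  "\<lbrakk>z \<in> carrier FA; w \<in> carrier FA\<rbrakk> \<Longrightarrow> z + w \<in> carrier FA"
  using keys_add[of z w] by auto

lemma FA_frag: "\<lbrakk>p \<in> carrier P; x \<in> carrier U\<rbrakk> \<Longrightarrow> frag_of (p, x) \<in> carrier FA"
  by simp

lemma rel_gens_closed: "rel_gens \<subseteq> carrier FA"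
  unfolding rel_gens_def
  by (auto simp del: carrier_free_Abelian_group_iff
      intro!: FA_diff FA_frag P.a_closed U.a_closed right_closed scalar_closed)

lemma rels_subgroup: "subgroup rels FA"
  unfolding rels_eq by (rule group.generate_is_subgroup[OF _ rel_gens_closed]) simp

lemma rels_normal: "rels \<lhd> FA"
  by (rule comm_group.subgroup_imp_normal[OF abelian_free_Abelian_group rels_subgroup])

lemma rels_FA: "z \<in> rels \<Longrightarrow> z \<in> carrier FA"
  using subgroup.subset[OF rels_subgroup] by (rule subsetD)

lemma rels_add: "\<lbrakk>z \<in> rels; w \<in> rels\<rbrakk> \<Longrightarrow> z + w \<in> rels"
  using subgroup.m_closed[OF rels_subgroup] by simp

lemma rels_uminus:
  assumes "z \<in> rels"
  shows "- z \<in> rels"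
  using subgroup.m_inv_closed[OF rels_subgroup assms] rels_FA[OF assms] by simp

lemma rels_zero: "0 \<in> rels"
  using subgroup.one_closed[OF rels_subgroup] by simp

lemma carrier_TP: "carrier TP = (\<lambda>z. rels #>\<^bsub>FA\<^esub> z) ` carrier FA"
  by (simp add: tensor_def Let_def carrier_FactGroup)

lemma pure_eq: "pure p x = rels #>\<^bsub>FA\<^esub> frag_of (p, x)"
  by (simp add: pure_tensor_def)

lemma pure_closed: "\<lbrakk>p \<in> carrier P; x \<in> carrier U\<rbrakk> \<Longrightarrow> pure p x \<in> carrier TP"
  unfolding carrier_TP pure_eq by (intro imageI) simp

lemma TP_add_cosets:
  assumes "z \<in> carrier FA" "w \<in> carrier FA"
  shows "(rels #>\<^bsub>FA\<^esub> z) \<oplus>\<^bsub>TP\<^esub> (rels #>\<^bsub>FA\<^esub> w) = rels #>\<^bsub>FA\<^esub> (z + w)"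
  using normal.rcos_sum[OF rels_normal assms] by (simp add: tensor_def Let_def)

lemma coset_eqI:
  assumes "z \<in> carrier FA" "w \<in> carrier FA" "z - w \<in> rels"
  shows "rels #>\<^bsub>FA\<^esub> z = rels #>\<^bsub>FA\<^esub> w"
proof -
  have "z \<in> rels #>\<^bsub>FA\<^esub> w"
    using assms(3) by (auto simp: r_coset_def intro!: bexI[of _ "z - w"])
  then show ?thesis
    using group.repr_independence[OF group_free_Abelian_group _ assms(2) rels_subgroup] by metis
qed

lemma coset_eqD:
  assumes "z \<in> carrier FA" "w \<in> rels #>\<^bsub>FA\<^esub> z"
  shows "w \<in> carrier FA" "w - z \<in> rels"
proof -
  obtain h where h: "h \<in> rels" "w = h + z"
    using assms(2) by (auto simp: r_coset_def)
  then show "w - z \<in> rels" by simp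
  show "w \<in> carrier FA"
    unfolding h(2) by (rule FA_add[OF rels_FA[OF h(1)] assms(1)])
qed

lemma abelian_group_TP: "abelian_group TP"
proof (rule abelian_groupI_comm_group, rule comm_group_cong)
  show "comm_group (FA Mod rels)"
    by (rule comm_group.abelian_FactGroup[OF abelian_free_Abelian_group rels_subgroup])
qed (simp_all add: tensor_def Let_def)

sublocale TP: abelian_group TP
  by (rule abelian_group_TP)

lemma TP_zero: "\<zero>\<^bsub>TP\<^esub> = rels #>\<^bsub>FA\<^esub> 0"
proof -
  have "rels #>\<^bsub>FA\<^esub> 0 = rels"
    using group.coset_mult_one[OF group_free_Abelian_group subgroup.subset[OF rels_subgroup]] by simp
  then show ?thesis by (simp add: tensor_def Let_def)
qed

lemma TP_minus_cosets:
  assumes "z \<in> carrier FA" "w \<in> carrier FA"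
  shows "(rels #>\<^bsub>FA\<^esub> z) \<ominus>\<^bsub>TP\<^esub> (rels #>\<^bsub>FA\<^esub> w) = rels #>\<^bsub>FA\<^esub> (z - w)"
proof -
  let ?c = "\<lambda>z. rels #>\<^bsub>FA\<^esub> z"
  have c: "?c z \<in> carrier TP" "?c w \<in> carrier TP" "?c (z - w) \<in> carrier TP"
    using assms FA_diff[OF assms] unfolding carrier_TP by (auto simp del: carrier_free_Abelian_group_iff)
  have "?c z = ?c (z - w) \<oplus>\<^bsub>TP\<^esub> ?c w"
    using TP_add_cosets[OF FA_diff[OF assms] assms(2)] by simp
  then have "?c z \<ominus>\<^bsub>TP\<^esub> ?c w = (?c (z - w) \<oplus>\<^bsub>TP\<^esub> ?c w) \<ominus>\<^bsub>TP\<^esub> ?c w" by simp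
  also have "\<dots> = ?c (z - w)"
    using c by (simp add: a_minus_def TP.a_assoc TP.r_neg)
  finally show ?thesis .
qed

lemma gen_in_rels: "z \<in> rel_gens \<Longrightarrow> z \<in> rels"
  unfolding rels_eq by (rule generate.incl)

lemma pure_add_left:
  assumes "p \<in> carrier P" "p' \<in> carrier P" "x \<in> carrier U"
  shows "pure (p \<oplus>\<^bsub>P\<^esub> p') x = pure p x \<oplus>\<^bsub>TP\<^esub> pure p' x"
proof -
  have "frag_of (p \<oplus>\<^bsub>P\<^esub> p', x) - frag_of (p, x) - frag_of (p', x) \<in> rels"
    by (rule gen_in_rels) (use assms in \<open>auto simp: rel_gens_def\<close>)
  then show ?thesis
    unfolding pure_eq using assms
    by (subst TP_add_cosets[OF FA_frag FA_frag], simp_all del: carrier_free_Abelian_group_iff)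
      (rule coset_eqI, auto simp: diff_diff_eq simp del: carrier_free_Abelian_group_iff intro!: FA_frag FA_add)
qed

lemma pure_add_right:
  assumes "p \<in> carrier P" "x \<in> carrier U" "x' \<in> carrier U"
  shows "pure p (x \<oplus>\<^bsub>U\<^esub> x') = pure p x \<oplus>\<^bsub>TP\<^esub> pure p x'"
proof -
  have "frag_of (p, x \<oplus>\<^bsub>U\<^esub> x') - frag_of (p, x) - frag_of (p, x') \<in> rels"
    by (rule gen_in_rels) (use assms in \<open>auto simp: rel_gens_def\<close>)
  then show ?thesis
    unfolding pure_eq using assms
    by (subst TP_add_cosets[OF FA_frag FA_frag], simp_all del: carrier_free_Abelian_group_iff)
      (rule coset_eqI, auto simp: diff_diff_eq simp del: carrier_free_Abelian_group_iff intro!: FA_frag FA_add)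
qed

lemma pure_balanced:
  assumes "p \<in> carrier P" "c \<in> carrier R" "x \<in> carrier U"
  shows "pure (rP p c) x = pure p (c \<odot>\<^bsub>U\<^esub> x)"
proof -
  have "frag_of (rP p c, x) - frag_of (p, c \<odot>\<^bsub>U\<^esub> x) \<in> rels"
    by (rule gen_in_rels) (use assms in \<open>auto simp: rel_gens_def\<close>)
  then show ?thesis
    unfolding pure_eq using assms by (intro coset_eqI) (auto intro: right_closed scalar_closed)
qed

lemma add_hom_pure_left: "x \<in> carrier U \<Longrightarrow> add_hom P TP (\<lambda>p. pure p x)"
  by (simp add: add_hom_def pure_closed pure_add_left)

lemma add_hom_pure_right: "p \<in> carrier P \<Longrightarrow> add_hom U TP (pure p)"
  by (simp add: add_hom_def pure_closed pure_add_right)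

text \<open>The induction principle of the free abelian group, read on cosets. Closure under
  differences covers sums, negatives and integral multiples at once.\<close>

lemma tensor_induct [consumes 1, case_names zero pure diff]:
  assumes t: "t \<in> carrier TP"
    and zero: "Q \<zero>\<^bsub>TP\<^esub>"
    and pure: "\<And>p x. \<lbrakk>p \<in> carrier P; x \<in> carrier U\<rbrakk> \<Longrightarrow> Q (pure p x)"
    and diff: "\<And>t s. \<lbrakk>t \<in> carrier TP; s \<in> carrier TP; Q t; Q s\<rbrakk> \<Longrightarrow> Q (t \<ominus>\<^bsub>TP\<^esub> s)"
  shows "Q t"
proof -
  obtain z where z: "Poly_Mapping.keys z \<subseteq> carrier P \<times> carrier U" and tz: "t = rels #>\<^bsub>FA\<^esub> z"
    using t unfolding carrier_TP by auto
  have "Q (rels #>\<^bsub>FA\<^esub> z)"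
  proof (rule free_Abelian_group_induct[where P = "\<lambda>z. Q (rels #>\<^bsub>FA\<^esub> z)", OF z])
    show "Q (rels #>\<^bsub>FA\<^esub> 0)" using zero TP_zero by simp
    show "Q (rels #>\<^bsub>FA\<^esub> (x - y))"
      if "Poly_Mapping.keys x \<subseteq> carrier P \<times> carrier U" "Poly_Mapping.keys y \<subseteq> carrier P \<times> carrier U"
        "Q (rels #>\<^bsub>FA\<^esub> x)" "Q (rels #>\<^bsub>FA\<^esub> y)" for x y
    proof -
      have c: "x \<in> carrier FA" "y \<in> carrier FA" using that by simp_all
      then have "rels #>\<^bsub>FA\<^esub> x \<in> carrier TP" "rels #>\<^bsub>FA\<^esub> y \<in> carrier TP"
        unfolding carrier_TP by blast+
      then show ?thesis using diff that TP_minus_cosets[OF c] by metis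
    qed
    show "Q (rels #>\<^bsub>FA\<^esub> frag_of a)" if "a \<in> carrier P \<times> carrier U" for a
      using that pure pure_eq by (cases a) auto
  qed
  then show ?thesis by (simp add: tz)
qed

text \<open>The values on pairs extend to the free abelian group. The extension kills the generating
  relations, hence the subgroup they generate, and so factors through the quotient.\<close>

lemma tensor_universal:
  assumes G: "abelian_group G"
    and closed: "\<And>p x. \<lbrakk>p \<in> carrier P; x \<in> carrier U\<rbrakk> \<Longrightarrow> \<beta> p x \<in> carrier G"
    and left: "\<And>p p' x. \<lbrakk>p \<in> carrier P; p' \<in> carrier P; x \<in> carrier U\<rbrakk> \<Longrightarrow>
      \<beta> (p \<oplus>\<^bsub>P\<^esub> p') x = \<beta> p x \<oplus>\<^bsub>G\<^esub> \<beta> p' x"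
    and right: "\<And>p x x'. \<lbrakk>p \<in> carrier P; x \<in> carrier U; x' \<in> carrier U\<rbrakk> \<Longrightarrow>
      \<beta> p (x \<oplus>\<^bsub>U\<^esub> x') = \<beta> p x \<oplus>\<^bsub>G\<^esub> \<beta> p x'"
    and bal: "\<And>p c x. \<lbrakk>p \<in> carrier P; c \<in> carrier R; x \<in> carrier U\<rbrakk> \<Longrightarrow>
      \<beta> (rP p c) x = \<beta> p (c \<odot>\<^bsub>U\<^esub> x)"
  obtains h where "add_hom TP G h"
    "\<And>p x. \<lbrakk>p \<in> carrier P; x \<in> carrier U\<rbrakk> \<Longrightarrow> h (pure p x) = \<beta> p x"
proof -
  interpret G: abelian_group G by fact
  obtain k where k: "k \<in> hom FA (add_monoid G)"
    and kf: "\<And>x. x \<in> carrier P \<times> carrier U \<Longrightarrow> k (frag_of x) = (\<lambda>(p, x). \<beta> p x) x"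
    by (rule comm_group.free_Abelian_group_universal[OF G.a_comm_group,
          of "\<lambda>(p, x). \<beta> p x" "carrier P \<times> carrier U"]) (use closed in auto)
  interpret k: group_hom FA "add_monoid G" k
    by (intro group_hom.intro group_hom_axioms.intro k G.a_group) simp
  have kd: "k (z - w) = k z \<ominus>\<^bsub>G\<^esub> k w" if "z \<in> carrier FA" "w \<in> carrier FA" for z w
  proof -
    have w: "inv\<^bsub>FA\<^esub> w = - w" and c: "- w \<in> carrier FA" using that(2) by simp_all
    have "k (z \<otimes>\<^bsub>FA\<^esub> - w) = k z \<otimes>\<^bsub>add_monoid G\<^esub> k (- w)"
      by (rule k.hom_mult[OF that(1) c])
    moreover have "k (- w) = inv\<^bsub>add_monoid G\<^esub> k w"
      using k.hom_inv[OF that(2)] w by simp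
    ultimately show ?thesis by (simp add: a_minus_def a_inv_def)
  qed
  have cancel: "(a \<oplus>\<^bsub>G\<^esub> b) \<ominus>\<^bsub>G\<^esub> a \<ominus>\<^bsub>G\<^esub> b = \<zero>\<^bsub>G\<^esub>" if "a \<in> carrier G" "b \<in> carrier G" for a b
    using that by (simp add: a_minus_def G.a_assoc G.a_lcomm[of b] G.r_neg G.r_neg1 G.r_neg2)
  \<comment> \<open>The three families of relations die for three reasons: additivity of
    \<open>\<beta>\<close> in the first slot, in the second slot, and its balance over
    \<open>R\<close>.\<close>
  have "rel_gens \<subseteq> kernel FA (add_monoid G) k"
  proof
    fix h assume h: "h \<in> rel_gens"
    then have "h \<in> carrier FA" using rel_gens_closed by blast
    moreover have "k h = \<zero>\<^bsub>G\<^esub>"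
      using h unfolding rel_gens_def
    proof (elim UnE CollectE exE conjE, goal_cases)
      case (1 p p' x)
      then show ?case
        using cancel[OF closed[of p x] closed[of p' x]] FA_frag[of p x] FA_frag[of p' x] FA_frag[of "p \<oplus>\<^bsub>P\<^esub> p'" x]
          FA_diff[of "frag_of (p \<oplus>\<^bsub>P\<^esub> p', x)" "frag_of (p, x)"]
        by (simp add: kd kf left del: carrier_free_Abelian_group_iff)
    next
      case (2 p x x')
      then show ?case
        using cancel[OF closed[of p x] closed[of p x']] FA_frag[of p x] FA_frag[of p x'] FA_frag[of p "x \<oplus>\<^bsub>U\<^esub> x'"]
          FA_diff[of "frag_of (p, x \<oplus>\<^bsub>U\<^esub> x')" "frag_of (p, x)"]
        by (simp add: kd kf right del: carrier_free_Abelian_group_iff)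
    next
      case (3 p c x)
      then have "p \<in> carrier P" "rP p c \<in> carrier P" "c \<odot>\<^bsub>U\<^esub> x \<in> carrier U"
        by (auto intro: right_closed scalar_closed)
      then show ?case
        using 3 closed[of p "c \<odot>\<^bsub>U\<^esub> x"] FA_frag[of "rP p c" x] FA_frag[of p "c \<odot>\<^bsub>U\<^esub> x"]
        by (simp add: kd kf bal a_minus_def G.r_neg del: carrier_free_Abelian_group_iff)
    qed
    ultimately show "h \<in> kernel FA (add_monoid G) k" by (simp add: kernel_def)
  qed
  then have "rels \<subseteq> kernel FA (add_monoid G) k"
    unfolding rels_eq by (intro group.generate_subgroup_incl k.subgroup_kernel) simp
  then have ker: "k z = \<zero>\<^bsub>G\<^esub>" if "z \<in> rels" for z
    using that by (auto simp: kernel_def)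
  obtain h where h: "h \<in> hom (FA Mod rels) (add_monoid G)"
    and hk: "\<And>x. x \<in> carrier FA \<Longrightarrow> h (rels #>\<^bsub>FA\<^esub> x) = k x"
  proof (rule FactGroup_universal[OF k rels_normal])
    show "k x = k y" if "x \<in> carrier FA" "y \<in> carrier FA" "rels #>\<^bsub>FA\<^esub> x = rels #>\<^bsub>FA\<^esub> y" for x y
    proof -
      have "x \<in> rels #>\<^bsub>FA\<^esub> y"
        using group.rcos_self[OF group_free_Abelian_group that(1) rels_subgroup] that(3) by simp
      then have "k x \<ominus>\<^bsub>G\<^esub> k y = \<zero>\<^bsub>G\<^esub>" using ker[OF coset_eqD(2)[OF that(2)]] kd[OF that(1,2)] by simp
      then show ?thesis using G.eq_of_diff k.hom_closed that by simp
    qed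
  qed blast
  show ?thesis
  proof (rule that)
    show "add_hom TP G h"
      using h by (auto simp: add_hom_def hom_def tensor_def Let_def)
    show "h (pure p x) = \<beta> p x" if "p \<in> carrier P" "x \<in> carrier U" for p x
      using that hk[of "frag_of (p, x)"] kf[of "(p, x)"] by (simp add: pure_eq)
  qed
qed

section \<open>The left module structure on a tensor product\<close>

context
  fixes A :: "('a, 't) ring_scheme"
  assumes P: "left_module A P"
    and bimodule: "\<And>a p c. \<lbrakk>a \<in> carrier A; p \<in> carrier P; c \<in> carrier R\<rbrakk> \<Longrightarrow>
      a \<odot>\<^bsub>P\<^esub> (rP p c) = rP (a \<odot>\<^bsub>P\<^esub> p) c"
begin

interpretation M: left_module A P by (rule P)

abbreviation (input) "act a \<equiv> frag_extend (\<lambda>(p, x). frag_of (a \<odot>\<^bsub>P\<^esub> p, x))"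

lemma act_FA:
  assumes "a \<in> carrier A" "z \<in> carrier FA"
  shows "act a z \<in> carrier FA"
proof -
  have "Poly_Mapping.keys (case i of (p, x) \<Rightarrow> frag_of (a \<odot>\<^bsub>P\<^esub> p, x)) \<subseteq> carrier P \<times> carrier U"
    if "i \<in> Poly_Mapping.keys z" for i
    using that assms M.smult_closed[OF assms(1)] by (cases i) auto
  then have "Poly_Mapping.keys (act a z) \<subseteq> carrier P \<times> carrier U"
    by (intro subset_trans[OF keys_frag_extend] UN_least)
  then show ?thesis by simp
qed

text \<open>Acting on the first factor takes each relation to one of the same family. For the
  balance relations this is where the commuting of the two actions on \<open>P\<close>
  enters.\<close>

lemma act_rel_gens:
  assumes a: "a \<in> carrier A" and h: "h \<in> rel_gens"
  shows "act a h \<in> rel_gens"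
  using h[unfolded rel_gens_def]
proof (elim UnE CollectE exE conjE)
  fix p p' x assume "h = frag_of (p \<oplus>\<^bsub>P\<^esub> p', x) - frag_of (p, x) - frag_of (p', x)"
    and p: "p \<in> carrier P" "p' \<in> carrier P" "x \<in> carrier U"
  then have "act a h = frag_of (a \<odot>\<^bsub>P\<^esub> p \<oplus>\<^bsub>P\<^esub> a \<odot>\<^bsub>P\<^esub> p', x) - frag_of (a \<odot>\<^bsub>P\<^esub> p, x) - frag_of (a \<odot>\<^bsub>P\<^esub> p', x)"
    using a by (simp only: frag_extend_diff frag_extend_of M.smult_r_distr prod.case)
  then show ?thesis using p M.smult_closed[OF a] unfolding rel_gens_def by blast
next
  fix p x x' assume "h = frag_of (p, x \<oplus>\<^bsub>U\<^esub> x') - frag_of (p, x) - frag_of (p, x')"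
    and p: "p \<in> carrier P" "x \<in> carrier U" "x' \<in> carrier U"
  then have "act a h = frag_of (a \<odot>\<^bsub>P\<^esub> p, x \<oplus>\<^bsub>U\<^esub> x') - frag_of (a \<odot>\<^bsub>P\<^esub> p, x) - frag_of (a \<odot>\<^bsub>P\<^esub> p, x')"
    by (simp only: frag_extend_diff frag_extend_of prod.case)
  then show ?thesis using p M.smult_closed[OF a] unfolding rel_gens_def by blast
next
  fix p c x assume "h = frag_of (rP p c, x) - frag_of (p, c \<odot>\<^bsub>U\<^esub> x)"
    and p: "p \<in> carrier P" "c \<in> carrier R" "x \<in> carrier U"
  then have "act a h = frag_of (rP (a \<odot>\<^bsub>P\<^esub> p) c, x) - frag_of (a \<odot>\<^bsub>P\<^esub> p, c \<odot>\<^bsub>U\<^esub> x)"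
    using a by (simp only: frag_extend_diff frag_extend_of bimodule prod.case)
  then show ?thesis using p M.smult_closed[OF a] unfolding rel_gens_def by blast
qed

lemma act_rels:
  assumes a: "a \<in> carrier A" and z: "z \<in> rels"
  shows "act a z \<in> rels"
  using z unfolding rels_eq
proof (induction rule: generate.induct)
  case one
  then show ?case using rels_zero by (simp add: rels_eq)
next
  case (incl h)
  then show ?case by (intro generate.incl act_rel_gens a)
next
  case (inv h)
  then have "h \<in> rels" by (rule gen_in_rels)
  then show ?case
    using rels_FA rels_uminus[OF gen_in_rels[OF act_rel_gens[OF a inv]]]
    by (simp add: frag_extend_minus rels_eq)
next
  case (eng h1 h2)
  then show ?case using rels_add by (simp add: frag_extend_add rels_eq)
qed

text \<open>The action is again a union over representatives. Since \<open>act a\<close> preserves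
  the relations, all representatives give the same coset.\<close>

lemma smult_coset:
  assumes a: "a \<in> carrier A" and z: "z \<in> carrier FA"
  shows "a \<odot>\<^bsub>TP\<^esub> (rels #>\<^bsub>FA\<^esub> z) = rels #>\<^bsub>FA\<^esub> act a z"
proof -
  have eq: "rels #>\<^bsub>FA\<^esub> act a w = rels #>\<^bsub>FA\<^esub> act a z" if "w \<in> rels #>\<^bsub>FA\<^esub> z" for w
    using act_rels[OF a coset_eqD(2)[OF z that]]
    by (intro coset_eqI act_FA a z coset_eqD(1)[OF z that]) (simp add: frag_extend_diff)
  have "z \<in> rels #>\<^bsub>FA\<^esub> z"
    by (rule group.rcos_self[OF group_free_Abelian_group z rels_subgroup])
  then have ne: "rels #>\<^bsub>FA\<^esub> z \<noteq> {}" by (metis empty_iff)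
  have "a \<odot>\<^bsub>TP\<^esub> (rels #>\<^bsub>FA\<^esub> z) = (\<Union>w\<in>rels #>\<^bsub>FA\<^esub> z. rels #>\<^bsub>FA\<^esub> act a w)"
    by (simp add: tensor_def Let_def)
  also have "\<dots> = (\<Union>w\<in>rels #>\<^bsub>FA\<^esub> z. rels #>\<^bsub>FA\<^esub> act a z)"
    by (rule SUP_cong[OF refl eq])
  also have "\<dots> = rels #>\<^bsub>FA\<^esub> act a z"
    by (simp only: UN_constant ne if_False)
  finally show ?thesis .
qed

lemma smult_pure:
  "\<lbrakk>a \<in> carrier A; p \<in> carrier P; x \<in> carrier U\<rbrakk> \<Longrightarrow> a \<odot>\<^bsub>TP\<^esub> pure p x = pure (a \<odot>\<^bsub>P\<^esub> p) x"
  using smult_coset[of a "frag_of (p, x)"] by (simp add: pure_eq)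

lemma add_hom_smult_TP:
  assumes a: "a \<in> carrier A"
  shows "add_hom TP TP (\<lambda>t. a \<odot>\<^bsub>TP\<^esub> t)"
  unfolding add_hom_def carrier_TP
proof (intro conjI funcsetI ballI)
  fix t assume "t \<in> (\<lambda>z. rels #>\<^bsub>FA\<^esub> z) ` carrier FA"
  then show "a \<odot>\<^bsub>TP\<^esub> t \<in> (\<lambda>z. rels #>\<^bsub>FA\<^esub> z) ` carrier FA"
    using smult_coset[OF a] act_FA[OF a] by blast
next
  fix t s assume "t \<in> (\<lambda>z. rels #>\<^bsub>FA\<^esub> z) ` carrier FA" "s \<in> (\<lambda>z. rels #>\<^bsub>FA\<^esub> z) ` carrier FA"
  then obtain z w where z: "z \<in> carrier FA" "t = rels #>\<^bsub>FA\<^esub> z" and w: "w \<in> carrier FA" "s = rels #>\<^bsub>FA\<^esub> w"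
    by blast
  show "a \<odot>\<^bsub>TP\<^esub> (t \<oplus>\<^bsub>TP\<^esub> s) = a \<odot>\<^bsub>TP\<^esub> t \<oplus>\<^bsub>TP\<^esub> a \<odot>\<^bsub>TP\<^esub> s"
    using FA_add[OF z(1) w(1)] act_FA[OF a z(1)] act_FA[OF a w(1)] z w
    by (simp add: TP_add_cosets smult_coset a frag_extend_add del: carrier_free_Abelian_group_iff)
qed

text \<open>Both sides of each law are compatible with differences, so it is enough to compare them
  on pure tensors, where they reduce to the laws in \<open>P\<close>.\<close>

lemma left_module_TP: "left_module A TP"
proof -
  note hom = add_hom_smult_TP
  note hz = add_hom_zero_minus[OF abelian_group_TP abelian_group_TP hom]
  have c: "a \<odot>\<^bsub>TP\<^esub> t \<in> carrier TP" if "a \<in> carrier A" "t \<in> carrier TP" for a t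
    using add_homD(1)[OF hom[OF that(1)] that(2)] .
  show ?thesis
  proof (intro left_module.intro left_module_axioms.intro M.ring_axioms abelian_group_TP)
    fix a b t assume ab: "a \<in> carrier A" "b \<in> carrier A" and t: "t \<in> carrier TP"
    then have abc: "a \<oplus>\<^bsub>A\<^esub> b \<in> carrier A" "a \<otimes>\<^bsub>A\<^esub> b \<in> carrier A" by simp_all
    from t show "(a \<oplus>\<^bsub>A\<^esub> b) \<odot>\<^bsub>TP\<^esub> t = a \<odot>\<^bsub>TP\<^esub> t \<oplus>\<^bsub>TP\<^esub> b \<odot>\<^bsub>TP\<^esub> t"
    proof (induction rule: tensor_induct)
      case zero
      then show ?case by (simp add: hz(1) ab abc del: M.R.a_closed)
    next
      case (pure p x)
      then show ?case by (simp add: smult_pure ab M.smult_l_distr pure_add_left M.smult_closed)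
    next
      case (diff t s)
      then show ?case
        using ab abc c by (simp add: hz(3) del: M.R.a_closed)
          (simp add: a_minus_def TP.minus_add TP.a_assoc TP.a_lcomm[of "b \<odot>\<^bsub>TP\<^esub> t"])
    qed
    from t show "(a \<otimes>\<^bsub>A\<^esub> b) \<odot>\<^bsub>TP\<^esub> t = a \<odot>\<^bsub>TP\<^esub> (b \<odot>\<^bsub>TP\<^esub> t)"
    proof (induction rule: tensor_induct)
      case zero
      then show ?case using hz(1) ab abc by simp
    next
      case (pure p x)
      then show ?case by (simp add: smult_pure ab M.smult_assoc M.smult_closed)
    next
      case (diff t s)
      then show ?case using ab abc c hz(3) by simp
    qed
  next
    fix t assume t: "t \<in> carrier TP"
    then show "\<one>\<^bsub>A\<^esub> \<odot>\<^bsub>TP\<^esub> t = t"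
    proof (induction rule: tensor_induct)
      case zero
      then show ?case by (simp add: hz(1))
    next
      case (pure p x)
      then show ?case by (simp add: smult_pure M.smult_one)
    next
      case (diff t s)
      then show ?case by (simp add: hz(3))
    qed
  qed (simp_all add: c add_homD(2)[OF hom])
qed

end

end

section \<open>Permutations and Young subgroups\<close>

abbreviation adj :: "nat \<Rightarrow> nat \<Rightarrow> nat"
  where "adj i \<equiv> Transposition.transpose i (Suc i)"

abbreviation pinv :: "(nat \<Rightarrow> nat) \<Rightarrow> nat \<Rightarrow> nat"
  where "pinv w \<equiv> inv_into UNIV w"

lemma adj_in_sym: "\<lbrakk>1 \<le> i; i < m\<rbrakk> \<Longrightarrow> adj i \<in> carrier (sym_group m)"
  by (simp add: sym_group_carrier permutes_swap_id)

lemma sym_comp: "\<lbrakk>v \<in> carrier (sym_group m); w \<in> carrier (sym_group m)\<rbrakk> \<Longrightarrow> v \<circ> w \<in> carrier (sym_group m)"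
  by (simp add: sym_group_carrier permutes_compose)

lemma sym_pinv: "w \<in> carrier (sym_group m) \<Longrightarrow> pinv w \<in> carrier (sym_group m)"
  by (simp add: sym_group_carrier permutes_inv)

lemma sym_id: "id \<in> carrier (sym_group m)"
  by (simp add: sym_group_carrier permutes_id)

lemma sym_inj: "w \<in> carrier (sym_group m) \<Longrightarrow> inj w"
  by (simp add: sym_group_carrier permutes_inj)

lemma sym_in: "w \<in> carrier (sym_group m) \<Longrightarrow> w a \<in> {1..m} \<longleftrightarrow> a \<in> {1..m}"
  by (simp only: sym_group_carrier permutes_in_image)

lemma sym_range: "w \<in> carrier (sym_group m) \<Longrightarrow> 1 \<le> a \<Longrightarrow> a \<le> m \<Longrightarrow> 1 \<le> w a \<and> w a \<le> m"
  using sym_in[of w m a] by simp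

lemma sym_pinv_apply:
  assumes "w \<in> carrier (sym_group m)"
  shows "pinv w (w a) = a" "w (pinv w a) = a"
  using assms permutes_inverses by (auto simp: sym_group_carrier)

lemma sym_eq_iff: "w \<in> carrier (sym_group m) \<Longrightarrow> w a = w b \<longleftrightarrow> a = b"
  using sym_inj by (auto dest: injD)

lemma pinv_comp_adj:
  assumes "w \<in> carrier (sym_group m)"
  shows "pinv (adj i \<circ> w) = pinv w \<circ> adj i"
  using assms by (subst o_inv_distrib) (auto simp: sym_group_carrier permutes_bij)

lemma pinv_pinv: "w \<in> carrier (sym_group m) \<Longrightarrow> pinv (pinv w) = w"
  by (simp add: sym_group_carrier permutes_inv_inv)

lemma finite_sym: "finite (carrier (sym_group m))"
  by (simp add: sym_group_def finite_permutations)

lemma adj_adj: "adj i \<circ> adj i = id"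
  by simp

lemma comp_adj_adj: "w \<circ> adj i \<circ> adj i = w" "adj i \<circ> (adj i \<circ> w) = w"
  by (auto simp: fun_eq_iff)

lemma adj_mono: "a < b \<Longrightarrow> (a, b) \<noteq> (i, Suc i) \<Longrightarrow> adj i a < adj i b"
  by (auto simp: Transposition.transpose_def)

section \<open>Inversions, length and descents\<close>

abbreviation inversions :: "nat \<Rightarrow> (nat \<Rightarrow> nat) \<Rightarrow> (nat \<times> nat) set"
  where "inversions m w \<equiv> {(i, j). 1 \<le> i \<and> i < j \<and> j \<le> m \<and> w j < w i}"

lemma finite_inversions: "finite (inversions m w)"
  by (rule finite_subset[of _ "{1..m} \<times> {1..m}"]) auto

text \<open>Swapping two neighbouring positions with increasing values relabels the old inversions
  and creates exactly one new one, at the swapped pair itself.\<close>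

lemma length_adj_right_up:
  assumes w: "w \<in> carrier (sym_group m)" and i: "1 \<le> i" "i < m" and up: "w i < w (Suc i)"
  shows "perm_length m (w \<circ> adj i) = Suc (perm_length m w)"
proof -
  let ?s = "adj i"
  have s: "?s \<in> carrier (sym_group m)" by (rule adj_in_sym[OF i])
  have "inversions m (w \<circ> ?s) = insert (i, Suc i) (map_prod ?s ?s ` inversions m w)"
  proof (intro equalityI subsetI)
    fix p assume "p \<in> inversions m (w \<circ> ?s)"
    then obtain a b where p: "p = (a, b)" and ab: "1 \<le> a" "a < b" "b \<le> m" "w (?s b) < w (?s a)" by auto
    show "p \<in> insert (i, Suc i) (map_prod ?s ?s ` inversions m w)"
    proof (cases "(a, b) = (i, Suc i)")
      case False
      then have "?s a < ?s b" using adj_mono ab by blast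
      moreover have "1 \<le> ?s a" "?s b \<le> m" using sym_range[OF s] ab by auto
      ultimately have "(?s a, ?s b) \<in> inversions m w" using ab by auto
      then have "map_prod ?s ?s (?s a, ?s b) \<in> map_prod ?s ?s ` inversions m w" by (rule imageI)
      then show ?thesis by (simp add: p)
    qed (simp add: p)
  next
    fix p assume "p \<in> insert (i, Suc i) (map_prod ?s ?s ` inversions m w)"
    then consider "p = (i, Suc i)" | a b where "p = (?s a, ?s b)" "(a, b) \<in> inversions m w" by auto
    then show "p \<in> inversions m (w \<circ> ?s)"
    proof cases
      case 1
      then show ?thesis using up i by simp
    next
      case 2
      then have ab: "1 \<le> a" "a < b" "b \<le> m" "w b < w a" by auto
      then have "(a, b) \<noteq> (i, Suc i)" using up by auto
      then have "?s a < ?s b" using adj_mono ab by blast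
      moreover have "1 \<le> ?s a" "?s b \<le> m" using sym_range[OF s] ab by auto
      ultimately show ?thesis using 2 ab by simp
    qed
  qed
  moreover have "(i, Suc i) \<notin> map_prod ?s ?s ` inversions m w"
  proof
    assume "(i, Suc i) \<in> map_prod ?s ?s ` inversions m w"
    then obtain a b where "a < b" "?s a = i" "?s b = Suc i" by auto
    then have "a = ?s i" "b = ?s (Suc i)" by (metis transpose_involutory)+
    then show False using \<open>a < b\<close> by simp
  qed
  moreover have "inj (map_prod ?s ?s)" by (intro prod.inj_map) (simp_all add: inj_transpose)
  then have "card (map_prod ?s ?s ` inversions m w) = card (inversions m w)"
    by (intro card_image) (rule inj_on_subset[OF _ subset_UNIV])
  ultimately show ?thesis
    unfolding perm_length_def
    by (simp only: card_insert_disjoint finite_imageI finite_inversions simp_thms)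
qed

lemma length_adj_right_down:
  assumes w: "w \<in> carrier (sym_group m)" and i: "1 \<le> i" "i < m" and down: "w (Suc i) < w i"
  shows "perm_length m w = Suc (perm_length m (w \<circ> adj i))"
  using length_adj_right_up[OF sym_comp[OF w adj_in_sym[OF i]] i] down comp_adj_adj(1)[of w i]
  by simp

text \<open>A pair of positions inverted by \<open>pinv w\<close> is a pair of values inverted by
  \<open>w\<close>; passing to the positions of these values reverses the order of the pair.\<close>

lemma length_pinv:
  assumes w: "w \<in> carrier (sym_group m)"
  shows "perm_length m (pinv w) = perm_length m w"
proof -
  have "bij_betw (\<lambda>(a, b). (pinv w b, pinv w a)) (inversions m (pinv w)) (inversions m w)"
    by (rule bij_betw_byWitness[where f' = "\<lambda>(a, b). (w b, w a)"])
      (use sym_range[OF w] sym_range[OF sym_pinv[OF w]] in \<open>auto simp: sym_pinv_apply[OF w]\<close>)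
  then show ?thesis unfolding perm_length_def by (rule bij_betw_same_card)
qed

lemma length_adj_left_up:
  assumes w: "w \<in> carrier (sym_group m)" and i: "1 \<le> i" "i < m" and up: "pinv w i < pinv w (Suc i)"
  shows "perm_length m (adj i \<circ> w) = Suc (perm_length m w)"
  using length_adj_right_up[OF sym_pinv[OF w] i up]
  by (simp add: length_pinv w sym_comp[OF adj_in_sym[OF i] w] flip: pinv_comp_adj[OF w])

lemma length_adj_left_down:
  assumes w: "w \<in> carrier (sym_group m)" and i: "1 \<le> i" "i < m" and down: "pinv w (Suc i) < pinv w i"
  shows "perm_length m w = Suc (perm_length m (adj i \<circ> w))"
  using length_adj_right_down[OF sym_pinv[OF w] i down]
  by (simp add: length_pinv w sym_comp[OF adj_in_sym[OF i] w] flip: pinv_comp_adj[OF w])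

lemma length_adj_left_iff:
  assumes w: "w \<in> carrier (sym_group m)" and i: "1 \<le> i" "i < m"
  shows "perm_length m w < perm_length m (adj i \<circ> w) \<longleftrightarrow> pinv w i < pinv w (Suc i)"
proof -
  have "pinv w i \<noteq> pinv w (Suc i)" using sym_eq_iff[OF sym_pinv[OF w]] by simp
  then show ?thesis
    using length_adj_left_up[OF w i] length_adj_left_down[OF w i] by linarith
qed

text \<open>Without a descent \<open>w\<close> increases on \<open>{1..m}\<close>. Induction from
  the bottom then gives \<open>a \<le> w a\<close>, induction from the top gives
  \<open>w a \<le> a\<close>, and \<open>w\<close> is the identity.\<close>

lemma sym_descent:
  assumes w: "w \<in> carrier (sym_group m)" and ne: "w \<noteq> id"
  obtains i where "1 \<le> i" "i < m" "w (Suc i) < w i"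
proof (rule ccontr)
  assume "\<not> thesis"
  then have up: "w i < w (Suc i)" if "1 \<le> i" "i < m" for i
    using that \<open>\<And>i. \<lbrakk>1 \<le> i; i < m; w (Suc i) < w i\<rbrakk> \<Longrightarrow> thesis\<close> sym_eq_iff[OF w, of i "Suc i"]
    by (metis linorder_neqE_nat n_not_Suc_n)
  have ge: "a \<le> w a" if "1 \<le> a" "a \<le> m" for a
    using that
  proof (induction a rule: nat_induct_at_least)
    case base
    then show ?case using sym_range[OF w, of 1] by simp
  next
    case (Suc a)
    then show ?case using up[of a] by simp
  qed
  have le: "w a \<le> a" if "1 \<le> a" "a \<le> m" for a
    using that(2,1)
  proof (induction a rule: inc_induct)
    case base
    then show ?case using sym_range[OF w, of m] by simp
  next
    case (step a)
    then show ?case using up[of a] by simp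
  qed
  have "w a = a" for a
  proof (cases "a \<in> {1..m}")
    case True
    then show ?thesis using ge le by (simp add: le_antisym)
  next
    case False
    then show ?thesis using w by (auto simp: sym_group_carrier permutes_def)
  qed
  then have "w = id" by auto
  then show False using ne by simp
qed

text \<open>
  A composition of \<open>m\<close> is encoded by a function that is monotone on \<open>{1..m}\<close> and sends every
  letter to the index of its block.
\<close>

definition block_fun :: "nat \<Rightarrow> (nat \<Rightarrow> nat) \<Rightarrow> bool"
  where "block_fun m c \<longleftrightarrow> (\<forall>a b. 1 \<le> a \<longrightarrow> a \<le> b \<longrightarrow> b \<le> m \<longrightarrow> c a \<le> c b)"

text \<open>For a block function this is the Young subgroup of the composition. Comparing labels of
  letters avoids listing the blocks; \<open>young_subgroup_eq\<close> relates it to the stabiliser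
  of the rows of a tableau.\<close>

definition block_stab :: "nat \<Rightarrow> (nat \<Rightarrow> nat) \<Rightarrow> (nat \<Rightarrow> nat) set"
  where "block_stab m c = {w \<in> carrier (sym_group m). \<forall>a\<in>{1..m}. c (w a) = c a}"

lemma block_stab_sym: "w \<in> block_stab m c \<Longrightarrow> w \<in> carrier (sym_group m)"
  by (simp add: block_stab_def)

lemma block_stab_eq: "w \<in> block_stab m c \<Longrightarrow> 1 \<le> a \<Longrightarrow> a \<le> m \<Longrightarrow> c (w a) = c a"
  by (simp add: block_stab_def)

lemma finite_block_stab: "finite (block_stab m c)"
  by (rule finite_subset[OF _ finite_sym[of m]]) (auto simp: block_stab_def)

lemma block_stab_id: "id \<in> block_stab m c"
  by (simp add: block_stab_def sym_id)

lemma block_stab_comp: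
  "\<lbrakk>v \<in> block_stab m c; w \<in> block_stab m c\<rbrakk> \<Longrightarrow> v \<circ> w \<in> block_stab m c"
  using sym_range[OF block_stab_sym[of w m c]] by (auto simp: block_stab_def sym_comp)

lemma block_stab_pinv:
  assumes "w \<in> block_stab m c"
  shows "pinv w \<in> block_stab m c"
proof -
  note w = block_stab_sym[OF assms]
  have "c (pinv w a) = c a" if "1 \<le> a" "a \<le> m" for a
    using block_stab_eq[OF assms, of "pinv w a"] sym_range[OF sym_pinv[OF w] that] sym_pinv_apply[OF w] by simp
  then show ?thesis using sym_pinv[OF w] by (simp add: block_stab_def)
qed

lemma adj_block_stab:
  assumes "1 \<le> i" "i < m" "c i = c (Suc i)"
  shows "adj i \<in> block_stab m c"
  using assms adj_in_sym[OF assms(1,2)] by (auto simp: block_stab_def Transposition.transpose_def)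

text \<open>Applying the monotone function \<open>c\<close> to \<open>w (Suc i) < w i\<close> and
  using the invariance of labels gives \<open>c (Suc i) \<le> c i\<close>. A descent of an element
  of the Young subgroup therefore never crosses a block boundary.\<close>

lemma block_stab_descent_right:
  assumes c: "block_fun m c" and w: "w \<in> block_stab m c" and ne: "w \<noteq> id"
  obtains i where "1 \<le> i" "i < m" "c i = c (Suc i)" "w (Suc i) < w i"
proof -
  note ws = block_stab_sym[OF w]
  obtain i where i: "1 \<le> i" "i < m" "w (Suc i) < w i" using sym_descent[OF ws ne] by blast
  have "c (w (Suc i)) \<le> c (w i)"
    using c i sym_range[OF ws, of i] sym_range[OF ws, of "Suc i"] by (simp add: block_fun_def)
  then have "c (Suc i) \<le> c i" using i block_stab_eq[OF w] by simp
  then have "c i = c (Suc i)" using c i by (simp add: block_fun_def le_antisym)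
  then show ?thesis using that i by blast
qed

text \<open>Peeling off descents writes an element of the Young subgroup as a reduced word in
  adjacent transpositions of the blocks. The ascent in the step is what the multiplication rules for
  basis elements require.\<close>

lemma block_length_induct [consumes 2, case_names id right]:
  assumes c: "block_fun m c" and w: "w \<in> block_stab m c"
    and id: "Q id"
    and step: "\<And>w i. \<lbrakk>w \<in> block_stab m c; 1 \<le> i; i < m; c i = c (Suc i); w i < w (Suc i); Q w\<rbrakk> \<Longrightarrow> Q (w \<circ> adj i)"
  shows "Q w"
  using w
proof (induction "perm_length m w" arbitrary: w rule: less_induct)
  case (less w)
  show ?case
  proof (cases "w = id")
    case False
    then obtain i where i: "1 \<le> i" "i < m" "c i = c (Suc i)" "w (Suc i) < w i"
      using block_stab_descent_right[OF c less.prems] by blast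
    have v: "w \<circ> adj i \<in> block_stab m c"
      by (intro block_stab_comp less.prems adj_block_stab i)
    have "perm_length m (w \<circ> adj i) < perm_length m w"
      using length_adj_right_down[OF block_stab_sym[OF less.prems] i(1,2,4)] by simp
    then have "Q (w \<circ> adj i)" using less.hyps v by blast
    then have "Q (w \<circ> adj i \<circ> adj i)"
      by (intro step[OF v i(1-3)]) (use i in simp_all)
    then show ?thesis by (simp only: comp_adj_adj)
  qed (simp add: id)
qed

lemma block_length_induct_left [consumes 2, case_names id left]:
  assumes c: "block_fun m c" and w: "w \<in> block_stab m c"
    and id: "Q id"
    and step: "\<And>w i. \<lbrakk>w \<in> block_stab m c; 1 \<le> i; i < m; c i = c (Suc i); pinv w i < pinv w (Suc i); Q w\<rbrakk> \<Longrightarrow> Q (adj i \<circ> w)"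
  shows "Q w"
proof -
  have "Q (pinv v)" if "v \<in> block_stab m c" for v
    using c that
  proof (induction rule: block_length_induct)
    case id
    then show ?case using assms(3) by (simp only: inv_id)
  next
    case (right v i)
    note v = block_stab_sym[OF right(1)]
    have "pinv (v \<circ> adj i) = adj i \<circ> pinv v"
      by (metis pinv_comp_adj[OF sym_pinv[OF v], of i] pinv_pinv[OF v]
          pinv_pinv[OF sym_comp[OF adj_in_sym[OF right(2,3)] sym_pinv[OF v]]])
    moreover have "Q (adj i \<circ> pinv v)"
      by (rule step[OF block_stab_pinv[OF right(1)] right(2-4)]) (simp_all only: pinv_pinv[OF v] right)
    ultimately show ?case by (simp only:)
  qed
  from this[OF block_stab_pinv[OF w]] show ?thesis by (simp only: pinv_pinv[OF block_stab_sym[OF w]])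
qed

text \<open>The assumptions \<open>incr\<close> and \<open>incr'\<close> say that \<open>w\<close>
  is shortest in its double coset for the two Young subgroups. If two letters collide, monotonicity
  of labels squeezes the collision onto the neighbours \<open>a\<close> and \<open>Suc a\<close>,
  whose values turn out to be neighbours as well. This produces adjacent transpositions in both
  Young subgroups that are conjugate under \<open>w\<close>.\<close>

lemma minimal_double_coset_adjacent:
  assumes c: "block_fun m c" and d: "block_fun m d" and w: "w \<in> carrier (sym_group m)"
    and incr: "\<And>i. \<lbrakk>1 \<le> i; i < m; d i = d (Suc i)\<rbrakk> \<Longrightarrow> w i < w (Suc i)"
    and incr': "\<And>i. \<lbrakk>1 \<le> i; i < m; c i = c (Suc i)\<rbrakk> \<Longrightarrow> pinv w i < pinv w (Suc i)"
    and ab: "1 \<le> a" "a < b" "b \<le> m" "d a = d b" "c (w a) = c (w b)"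
  obtains i where "1 \<le> i" "i < m" "d i = d (Suc i)" "1 \<le> w i" "w i < m" "c (w i) = c (Suc (w i))"
    "w (Suc i) = Suc (w i)"
proof -
  \<comment> \<open>Labels between two equal labels are equal, so increase at neighbouring letters
    extends to any two letters of a block.\<close>
  have mono: "w x < w y" if "1 \<le> x" "x < y" "y \<le> m" "d x = d y" for x y
  proof -
    have "x < y \<Longrightarrow> 1 \<le> x \<Longrightarrow> y \<le> m \<Longrightarrow> d x = d y \<Longrightarrow> w x < w y" for x y
    proof (induction x rule: strict_inc_induct)
      case (base i)
      then show ?case using incr[of i] by simp
    next
      case (step i)
      have "d i \<le> d (Suc i)" "d (Suc i) \<le> d y" using d step by (auto simp: block_fun_def)
      then have "d i = d (Suc i)" "d (Suc i) = d y" using step by auto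
      then show ?case using step incr[of i] by auto
    qed
    then show ?thesis using that by blast
  qed
  have mono': "pinv w x < pinv w y" if "1 \<le> x" "x < y" "y \<le> m" "c x = c y" for x y
  proof -
    have "x < y \<Longrightarrow> 1 \<le> x \<Longrightarrow> y \<le> m \<Longrightarrow> c x = c y \<Longrightarrow> pinv w x < pinv w y" for x y
    proof (induction x rule: strict_inc_induct)
      case (base i)
      then show ?case using incr'[of i] by simp
    next
      case (step i)
      have "c i \<le> c (Suc i)" "c (Suc i) \<le> c y" using c step by (auto simp: block_fun_def)
      then have "c i = c (Suc i)" "c (Suc i) = c y" using step by auto
      then show ?case using step incr'[of i] by auto
    qed
    then show ?thesis using that by blast
  qed
  have da: "d a \<le> d (Suc a)" "d (Suc a) \<le> d b" using d ab by (auto simp: block_fun_def)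
  have a: "d a = d (Suc a)" "a < m" using da ab by auto
  have r: "1 \<le> w a" "w a \<le> m" "1 \<le> w (Suc a)" "w (Suc a) \<le> m" "1 \<le> w b" "w b \<le> m"
    using sym_range[OF w] ab by auto
  have wa: "w a < w (Suc a)" using incr a ab by simp
  \<comment> \<open>Now \<open>w a < w (Suc a) \<le> w b\<close>, and the outer values have the same
    \<open>c\<close>-label, so every value between them has this label too.\<close>
  have "w (Suc a) \<le> w b" using mono[of "Suc a" b] ab a by (cases "Suc a = b") auto
  then have "c (w a) \<le> c (w (Suc a))" "c (w (Suc a)) \<le> c (w b)"
    using c r wa by (auto simp: block_fun_def)
  then have cwa: "c (w a) = c (w (Suc a))" using ab by simp
  have "c (w a) \<le> c (Suc (w a))" "c (Suc (w a)) \<le> c (w (Suc a))"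
    using c r wa by (auto simp: block_fun_def)
  then have cw: "c (w a) = c (Suc (w a))" "c (Suc (w a)) = c (w (Suc a))" using cwa by auto
  have ws: "w (Suc a) = Suc (w a)"
  proof (rule ccontr)
    \<comment> \<open>A value strictly between \<open>w a\<close> and \<open>w (a + 1)\<close> would have its preimage strictly between \<open>a\<close> and \<open>a + 1\<close>.\<close>
    assume "w (Suc a) \<noteq> Suc (w a)"
    then have l: "Suc (w a) < w (Suc a)" using wa by simp
    have "pinv w (w a) < pinv w (Suc (w a))" by (rule mono') (use r l cw in auto)
    moreover have "pinv w (Suc (w a)) < pinv w (w (Suc a))" by (rule mono') (use r l cw in auto)
    ultimately show False by (simp add: sym_pinv_apply[OF w])
  qed
  show ?thesis
    by (rule that[OF ab(1) a(2,1) r(1) _ cw(1) ws]) (use r wa in linarith)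
qed

section \<open>Hecke algebras\<close>

lemma finite_basis_exists:
  assumes "finite_basis K V I b" "x \<in> carrier V"
  obtains c where "c \<in> I \<rightarrow> carrier K" "x = lin_comb V I b c"
  using assms unfolding finite_basis_def by (metis PiE_mem Pi_I)

text \<open>Uniqueness in \<open>finite_basis\<close> is stated for extensional families, so both
  families are restricted to \<open>I\<close> before they are compared.\<close>

lemma finite_basis_unique:
  fixes V :: "('k, 'v) module"
  assumes V: "Module.module K V" and b: "finite_basis K V I b"
    and c: "c \<in> I \<rightarrow> carrier K" "c' \<in> I \<rightarrow> carrier K"
    and eq: "lin_comb V I b c = lin_comb V I b c'" and i: "i \<in> I"
  shows "c i = c' i"
proof -
  interpret module K V by fact
  have bI: "b \<in> I \<rightarrow> carrier V" using b by (simp add: finite_basis_def)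
  have r: "lin_comb V I b (restrict e I) = lin_comb V I b e" if "e \<in> I \<rightarrow> carrier K" for e
    unfolding lin_comb_def using that bI by (intro M.finsum_cong') (auto simp: Pi_iff)
  have "lin_comb V I b c \<in> carrier V"
    unfolding lin_comb_def using c bI by (intro M.finsum_closed) (auto simp: Pi_iff)
  then have "\<exists>!e. e \<in> I \<rightarrow>\<^sub>E carrier K \<and> lin_comb V I b c = lin_comb V I b e"
    using b unfolding finite_basis_def by blast
  moreover have "restrict c I \<in> I \<rightarrow>\<^sub>E carrier K" "restrict c' I \<in> I \<rightarrow>\<^sub>E carrier K"
    using c by auto
  moreover have "lin_comb V I b c = lin_comb V I b (restrict c I)"
    "lin_comb V I b c = lin_comb V I b (restrict c' I)"
    using r c eq by simp_all
  ultimately have "restrict c I = restrict c' I" by blast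
  then show ?thesis using i by (metis restrict_apply')
qed

text \<open>The coordinate at \<open>i\<close> is read off from chosen coefficients; their
  uniqueness makes it linear. It serves to compare coefficients in Hecke algebras.\<close>

lemma finite_basis_dual:
  fixes V :: "('k, 'v) module"
  assumes V: "Module.module K V" and b: "finite_basis K V I b" and i: "i \<in> I"
  obtains f where "add_hom V K f" "\<And>a x. \<lbrakk>a \<in> carrier K; x \<in> carrier V\<rbrakk> \<Longrightarrow> f (a \<odot>\<^bsub>V\<^esub> x) = a \<otimes>\<^bsub>K\<^esub> f x"
    "\<And>j. j \<in> I \<Longrightarrow> f (b j) = (if j = i then \<one>\<^bsub>K\<^esub> else \<zero>\<^bsub>K\<^esub>)"
proof -
  interpret module K V by fact
  have bI: "\<And>j. j \<in> I \<Longrightarrow> b j \<in> carrier V" and fin: "finite I"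
    using b by (auto simp: finite_basis_def)
  have "\<forall>x\<in>carrier V. \<exists>c. c \<in> I \<rightarrow> carrier K \<and> x = lin_comb V I b c"
    by (metis finite_basis_exists[OF b])
  then obtain cf where cf: "\<And>x. x \<in> carrier V \<Longrightarrow> cf x \<in> I \<rightarrow> carrier K"
    "\<And>x. x \<in> carrier V \<Longrightarrow> lin_comb V I b (cf x) = x"
    by metis
  have u: "cf x i = c i" if "x \<in> carrier V" "c \<in> I \<rightarrow> carrier K" "lin_comb V I b c = x" for x c
    by (rule finite_basis_unique[OF V b cf(1) that(2) _ i]) (use that cf in auto)
  have cfI: "\<And>x j. \<lbrakk>x \<in> carrier V; j \<in> I\<rbrakk> \<Longrightarrow> cf x j \<in> carrier K"
    using cf(1) by (meson PiE)
  have "add_hom V K (\<lambda>x. cf x i)"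
    unfolding add_hom_def
  proof (intro conjI funcsetI ballI)
    fix x y assume xy: "x \<in> carrier V" "y \<in> carrier V"
    have "lin_comb V I b (\<lambda>j. cf x j \<oplus>\<^bsub>K\<^esub> cf y j)
        = (\<Oplus>\<^bsub>V\<^esub>j\<in>I. cf x j \<odot>\<^bsub>V\<^esub> b j \<oplus>\<^bsub>V\<^esub> cf y j \<odot>\<^bsub>V\<^esub> b j)"
      unfolding lin_comb_def using cfI bI xy by (intro M.finsum_cong') (auto simp: smult_l_distr)
    also have "\<dots> = lin_comb V I b (cf x) \<oplus>\<^bsub>V\<^esub> lin_comb V I b (cf y)"
      unfolding lin_comb_def using cfI bI xy by (intro M.finsum_addf) auto
    finally have "lin_comb V I b (\<lambda>j. cf x j \<oplus>\<^bsub>K\<^esub> cf y j) = lin_comb V I b (cf x) \<oplus>\<^bsub>V\<^esub> lin_comb V I b (cf y)" .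
    then show "cf (x \<oplus>\<^bsub>V\<^esub> y) i = cf x i \<oplus>\<^bsub>K\<^esub> cf y i"
      using cf cfI xy by (intro u) auto
  qed (use cfI i in auto)
  moreover have "cf (a \<odot>\<^bsub>V\<^esub> x) i = a \<otimes>\<^bsub>K\<^esub> cf x i" if "a \<in> carrier K" "x \<in> carrier V" for a x
  proof (rule u)
    have "lin_comb V I b (\<lambda>j. a \<otimes>\<^bsub>K\<^esub> cf x j) = a \<odot>\<^bsub>V\<^esub> lin_comb V I b (cf x)"
      unfolding lin_comb_def using cfI bI that fin
      by (subst finsum_smult_ldistr) (auto intro!: M.finsum_cong' simp: smult_assoc1)
    then show "lin_comb V I b (\<lambda>j. a \<otimes>\<^bsub>K\<^esub> cf x j) = a \<odot>\<^bsub>V\<^esub> x" using cf that by simp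
  qed (use that cfI in auto)
  moreover have "cf (b j) i = (if j = i then \<one>\<^bsub>K\<^esub> else \<zero>\<^bsub>K\<^esub>)" if "j \<in> I" for j
  proof (rule u[of _ "\<lambda>k. if j = k then \<one>\<^bsub>K\<^esub> else \<zero>\<^bsub>K\<^esub>"])
    have "lin_comb V I b (\<lambda>k. if j = k then \<one>\<^bsub>K\<^esub> else \<zero>\<^bsub>K\<^esub>) = (\<Oplus>\<^bsub>V\<^esub>k\<in>I. if j = k then b k else \<zero>\<^bsub>V\<^esub>)"
      unfolding lin_comb_def using bI by (intro M.finsum_cong') auto
    also have "\<dots> = b j" using that fin bI by (intro M.add.finprod_singleton) auto
    finally show "lin_comb V I b (\<lambda>k. if j = k then \<one>\<^bsub>K\<^esub> else \<zero>\<^bsub>K\<^esub>) = b j" .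
  qed (use that bI in auto)
  ultimately show ?thesis using that by blast
qed

section \<open>Algebras over a field\<close>

locale k_alg =
  fixes K :: "'k ring" and A :: "('k, 'a) module"
  assumes k_algebra: "k_algebra K A"
begin

sublocale ring A using k_algebra by (simp add: k_algebra_def)
sublocale K: field K using k_algebra by (simp add: k_algebra_def)
sublocale V: Module.module K A using k_algebra by (simp add: k_algebra_def)

lemma scal_left: "\<lbrakk>c \<in> carrier K; x \<in> carrier A; y \<in> carrier A\<rbrakk> \<Longrightarrow>
    (c \<odot>\<^bsub>A\<^esub> x) \<otimes>\<^bsub>A\<^esub> y = c \<odot>\<^bsub>A\<^esub> (x \<otimes>\<^bsub>A\<^esub> y)"
  and scal_right: "\<lbrakk>c \<in> carrier K; x \<in> carrier A; y \<in> carrier A\<rbrakk> \<Longrightarrow>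
    x \<otimes>\<^bsub>A\<^esub> (c \<odot>\<^bsub>A\<^esub> y) = c \<odot>\<^bsub>A\<^esub> (x \<otimes>\<^bsub>A\<^esub> y)"
  using k_algebra unfolding k_algebra_def by metis+

lemma scal_comm: "\<lbrakk>c \<in> carrier K; d \<in> carrier K; x \<in> carrier A\<rbrakk> \<Longrightarrow>
    c \<odot>\<^bsub>A\<^esub> (d \<odot>\<^bsub>A\<^esub> x) = d \<odot>\<^bsub>A\<^esub> (c \<odot>\<^bsub>A\<^esub> x)"
  by (metis K.m_comm V.smult_assoc1)

lemma basis_induct:
  assumes basis: "finite_basis K A I b" and x: "x \<in> carrier A" and zero: "Q \<zero>\<^bsub>A\<^esub>"
    and add: "\<And>x y. \<lbrakk>x \<in> carrier A; y \<in> carrier A; Q x; Q y\<rbrakk> \<Longrightarrow> Q (x \<oplus>\<^bsub>A\<^esub> y)"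
    and scal: "\<And>a i. \<lbrakk>a \<in> carrier K; i \<in> I\<rbrakk> \<Longrightarrow> Q (a \<odot>\<^bsub>A\<^esub> b i)"
  shows "Q x"
proof -
  have fin: "finite I" and bI: "b \<in> I \<rightarrow> carrier A" using basis by (auto simp: finite_basis_def)
  obtain c where c: "c \<in> I \<rightarrow> carrier K" "x = (\<Oplus>\<^bsub>A\<^esub>i\<in>I. c i \<odot>\<^bsub>A\<^esub> b i)"
    using finite_basis_exists[OF basis x] by (metis lin_comb_def)
  have "(\<Oplus>\<^bsub>A\<^esub>i\<in>J. c i \<odot>\<^bsub>A\<^esub> b i) \<in> carrier A \<and> Q (\<Oplus>\<^bsub>A\<^esub>i\<in>J. c i \<odot>\<^bsub>A\<^esub> b i)" if "finite J" "J \<subseteq> I" for J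
    using that
  proof (induction rule: finite_induct)
    case empty
    then show ?case using zero by simp
  next
    case (insert i J)
    have "c j \<odot>\<^bsub>A\<^esub> b j \<in> carrier A" if "j \<in> insert i J" for j
      using that insert.prems c(1) bI by (intro V.smult_closed) auto
    then show ?case using insert add[of "c i \<odot>\<^bsub>A\<^esub> b i"] scal[of "c i" i] c(1)
      by (auto simp: Pi_iff)
  qed
  then show ?thesis using c(2) fin by blast
qed

end

lemma perm_length_id: "perm_length m id = 0"
proof -
  have "inversions m id = {}" by auto
  then show ?thesis by (simp only: perm_length_def card.empty)
qed

section \<open>Multiplication of the standard basis elements\<close>

locale hecke =
  fixes K :: "'k ring" and q :: 'k and m :: nat and B :: "('k, 'b) module"
    and T :: "(nat \<Rightarrow> nat) \<Rightarrow> 'b"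
  assumes hecke: "hecke_algebra_basis K q m B T" and q_unit: "q \<in> Units K"
begin

sublocale k_alg K B
  using hecke by unfold_locales (simp add: hecke_algebra_basis_def)

abbreviation "S \<equiv> carrier (sym_group m)"

lemma basis: "finite_basis K B S T"
  using hecke by (simp add: hecke_algebra_basis_def)

lemma T_closed [simp]: "w \<in> S \<Longrightarrow> T w \<in> carrier B"
  using basis by (auto simp: finite_basis_def)

lemma T_id: "T id = \<one>\<^bsub>B\<^esub>"
  using hecke by (simp add: hecke_algebra_basis_def)

lemma q_closed [simp]: "q \<in> carrier K"
  using q_unit by (rule K.Units_closed)

text \<open>The defining relation compares lengths. By \<open>length_adj_left_iff\<close> the
  comparison is decided by the positions of the values \<open>i\<close> and \<open>Suc i\<close>,
  which is the form used from here on.\<close>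

lemma T_left_up:
  assumes "w \<in> S" "1 \<le> i" "i < m" "pinv w i < pinv w (Suc i)"
  shows "T (adj i) \<otimes>\<^bsub>B\<^esub> T w = T (adj i \<circ> w)"
  using hecke assms length_adj_left_iff[OF assms(1-3)]
  by (auto simp: hecke_algebra_basis_def Let_def)

lemma T_sq:
  assumes "1 \<le> i" "i < m"
  shows "T (adj i) \<otimes>\<^bsub>B\<^esub> T (adj i) = q \<odot>\<^bsub>B\<^esub> \<one>\<^bsub>B\<^esub> \<oplus>\<^bsub>B\<^esub> (q \<ominus>\<^bsub>K\<^esub> \<one>\<^bsub>K\<^esub>) \<odot>\<^bsub>B\<^esub> T (adj i)"
proof -
  have s: "adj i \<in> S" by (rule adj_in_sym[OF assms])
  have "\<not> pinv (adj i) i < pinv (adj i) (Suc i)" by simp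
  then have "\<not> perm_length m (adj i) < perm_length m (adj i \<circ> adj i)"
    using length_adj_left_iff[OF s assms] by blast
  then show ?thesis
    using hecke assms s unfolding hecke_algebra_basis_def Let_def
    by (metis (no_types, lifting) T_id adj_adj atLeastLessThan_iff)
qed

text \<open>The defining relations describe left multiplication only. Writing \<open>w\<close> as a
  reduced product of \<open>adj j\<close> and a shorter \<open>v\<close>, associativity moves the
  claim from \<open>w\<close> to \<open>v\<close>, provided lengths go up in both products; this is
  a length count.\<close>

lemma T_right_up:
  assumes "w \<in> S" "1 \<le> i" "i < m" "w i < w (Suc i)"
  shows "T w \<otimes>\<^bsub>B\<^esub> T (adj i) = T (w \<circ> adj i)"
  using assms(1,4)
proof (induction "perm_length m w" arbitrary: w rule: less_induct)
  case (less w)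
  have s: "adj i \<in> S" by (rule adj_in_sym[OF assms(2,3)])
  show ?case
  proof (cases "w = id")
    case True
    then show ?thesis by (simp add: T_id s)
  next
    case False
    have "pinv w \<noteq> id" using False pinv_pinv[OF less.prems(1)] by (metis inv_id)
    then obtain j where j: "1 \<le> j" "j < m" "pinv w (Suc j) < pinv w j"
      using sym_descent[OF sym_pinv[OF less.prems(1)]] by blast
    define v where "v = adj j \<circ> w"
    have sj: "adj j \<in> S" by (rule adj_in_sym[OF j(1,2)])
    have v: "v \<in> S" unfolding v_def by (rule sym_comp[OF sj less.prems(1)])
    have w: "w = adj j \<circ> v" unfolding v_def by (simp only: comp_adj_adj)
    have lw: "perm_length m w = Suc (perm_length m v)"
      unfolding v_def by (rule length_adj_left_down[OF less.prems(1) j])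
    have lws: "perm_length m (w \<circ> adj i) = Suc (Suc (perm_length m v))"
      using length_adj_right_up[OF less.prems(1) assms(2,3) less.prems(2)] lw by simp
    have vs: "v \<circ> adj i \<in> S" by (rule sym_comp[OF v s])
    have wvs: "w \<circ> adj i = adj j \<circ> (v \<circ> adj i)" unfolding w by (simp only: comp_assoc)
    \<comment> \<open>Otherwise \<open>v \<circ> adj i\<close> is shorter than \<open>v\<close>, and
      multiplying it by \<open>adj j\<close> reaches at most the length of \<open>v\<close>, whereas
      \<open>w \<circ> adj i\<close> is longer than \<open>v\<close> by two.\<close>
    have up: "v i < v (Suc i)"
    proof (rule ccontr)
      assume "\<not> v i < v (Suc i)"
      then have "v (Suc i) < v i" using sym_eq_iff[OF v, of i "Suc i"] by simp
      then have lv: "perm_length m v = Suc (perm_length m (v \<circ> adj i))"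
        by (rule length_adj_right_down[OF v assms(2,3)])
      have "perm_length m (adj j \<circ> (v \<circ> adj i)) \<le> Suc (perm_length m (v \<circ> adj i))"
        using length_adj_left_up[OF vs j(1,2)] length_adj_left_iff[OF vs j(1,2)] by (metis le_refl linorder_not_less le_SucI)
      then show False using lv lws wvs by simp
    qed
    have lvs: "perm_length m (v \<circ> adj i) = Suc (perm_length m v)"
      by (rule length_adj_right_up[OF v assms(2,3) up])
    have up': "pinv v j < pinv v (Suc j)"
      using length_adj_left_iff[OF v j(1,2)] lw w by simp
    have up'': "pinv (v \<circ> adj i) j < pinv (v \<circ> adj i) (Suc j)"
      using length_adj_left_iff[OF vs j(1,2)] lws lvs wvs by simp
    have "T w \<otimes>\<^bsub>B\<^esub> T (adj i) = T (adj j) \<otimes>\<^bsub>B\<^esub> (T v \<otimes>\<^bsub>B\<^esub> T (adj i))"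
      using T_left_up[OF v j(1,2) up'] w v s sj by (metis T_closed m_assoc)
    also have "\<dots> = T (adj j) \<otimes>\<^bsub>B\<^esub> T (v \<circ> adj i)"
      using less.hyps[of v] lw v up by simp
    also have "\<dots> = T (w \<circ> adj i)"
      using T_left_up[OF vs j(1,2) up''] wvs by simp
    finally show ?thesis .
  qed
qed

section \<open>Symmetrisers and antisymmetrisers of Young subgroups\<close>

definition xb :: "(nat \<Rightarrow> nat) \<Rightarrow> 'b"
  where "xb c = (\<Oplus>\<^bsub>B\<^esub>w\<in>block_stab m c. T w)"

text \<open>The generators have eigenvalues \<open>q\<close> and -1. The weight is normalised by
  \<open>eps * q = -1\<close>, which makes the weighted sum \<open>yb\<close> an eigenvector for
  -1.\<close>

abbreviation (input) eps :: 'k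
  where "eps \<equiv> inv\<^bsub>K\<^esub> (\<ominus>\<^bsub>K\<^esub> q)"

definition yb :: "(nat \<Rightarrow> nat) \<Rightarrow> 'b"
  where "yb c = (\<Oplus>\<^bsub>B\<^esub>w\<in>block_stab m c. (eps [^]\<^bsub>K\<^esub> perm_length m w) \<odot>\<^bsub>B\<^esub> T w)"

lemma eps: "eps \<in> carrier K" "eps \<otimes>\<^bsub>K\<^esub> q = \<ominus>\<^bsub>K\<^esub> \<one>\<^bsub>K\<^esub>"
proof -
  have "q \<noteq> \<zero>\<^bsub>K\<^esub>" using q_unit K.field_Units by simp
  then have "\<ominus>\<^bsub>K\<^esub> q \<noteq> \<zero>\<^bsub>K\<^esub>" using K.add.inv_eq_1_iff by simp
  then have u: "\<ominus>\<^bsub>K\<^esub> q \<in> Units K" using K.field_Units by simp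
  then show e: "eps \<in> carrier K" by simp
  have "eps \<otimes>\<^bsub>K\<^esub> (\<ominus>\<^bsub>K\<^esub> q) = \<one>\<^bsub>K\<^esub>" using u by simp
  then have "\<ominus>\<^bsub>K\<^esub> (eps \<otimes>\<^bsub>K\<^esub> q) = \<one>\<^bsub>K\<^esub>" using e by (simp add: K.r_minus)
  then show "eps \<otimes>\<^bsub>K\<^esub> q = \<ominus>\<^bsub>K\<^esub> \<one>\<^bsub>K\<^esub>"
    using e by (metis K.m_closed K.minus_minus q_closed)
qed

lemma xb_closed [simp]: "xb c \<in> carrier B"
  unfolding xb_def by (rule finsum_closed) (auto simp: block_stab_sym)

lemma eps_T_closed [simp]: "w \<in> S \<Longrightarrow> (eps [^]\<^bsub>K\<^esub> (k::nat)) \<odot>\<^bsub>B\<^esub> T w \<in> carrier B"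
  using eps by simp

lemma yb_closed [simp]: "yb c \<in> carrier B"
  unfolding yb_def by (rule finsum_closed) (auto simp: block_stab_sym)

text \<open>The Young subgroup splits into pairs consisting of \<open>w\<close> and
  \<open>adj i \<circ> w\<close>. Letting \<open>w\<close> be the shorter member, the basis element
  of the longer one is the product of \<open>T (adj i)\<close> and \<open>T w\<close>.\<close>

lemma xb_factor:
  assumes i: "1 \<le> i" "i < m" "c i = c (Suc i)"
  obtains x where "x \<in> carrier B" "xb c = (\<one>\<^bsub>B\<^esub> \<oplus>\<^bsub>B\<^esub> T (adj i)) \<otimes>\<^bsub>B\<^esub> x"
proof -
  let ?s = "adj i"
  define Up where "Up = {w \<in> block_stab m c. pinv w i < pinv w (Suc i)}"
  have fin: "finite Up" unfolding Up_def using finite_block_stab[of m c] by simp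
  have UpS: "w \<in> S" if "w \<in> Up" for w using that block_stab_sym by (auto simp: Up_def)
  have s: "?s \<in> S" "?s \<in> block_stab m c" using adj_in_sym adj_block_stab i by auto
  have inj: "inj_on (\<lambda>w. ?s \<circ> w) Up" by (rule inj_onI) (metis comp_adj_adj(2))
  have "block_stab m c = Up \<union> (\<lambda>w. ?s \<circ> w) ` Up"
  proof (intro equalityI subsetI)
    fix w assume w: "w \<in> block_stab m c"
    show "w \<in> Up \<union> (\<lambda>w. ?s \<circ> w) ` Up"
    proof (cases "pinv w i < pinv w (Suc i)")
      case False
      then have "pinv w (Suc i) < pinv w i"
        using sym_eq_iff[OF sym_pinv[OF block_stab_sym[OF w]], of i "Suc i"] by simp
      then have "?s \<circ> w \<in> Up"
        unfolding Up_def using block_stab_comp[OF s(2) w] by (simp add: pinv_comp_adj[OF block_stab_sym[OF w]])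
      then show ?thesis by (metis UnI2 comp_adj_adj(2) imageI)
    qed (simp add: Up_def w)
  qed (use block_stab_comp[OF s(2)] in \<open>auto simp: Up_def\<close>)
  moreover have "Up \<inter> (\<lambda>w. ?s \<circ> w) ` Up = {}"
    using pinv_comp_adj UpS by (fastforce simp: Up_def)
  ultimately have "xb c = (\<Oplus>\<^bsub>B\<^esub>w\<in>Up. T w) \<oplus>\<^bsub>B\<^esub> (\<Oplus>\<^bsub>B\<^esub>w\<in>(\<lambda>w. ?s \<circ> w) ` Up. T w)"
    unfolding xb_def using fin UpS sym_comp[OF s(1)]
    by (subst finsum_Un_disjoint[symmetric]) auto
  also have "(\<Oplus>\<^bsub>B\<^esub>w\<in>(\<lambda>w. ?s \<circ> w) ` Up. T w) = (\<Oplus>\<^bsub>B\<^esub>w\<in>Up. T (?s \<circ> w))"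
    using inj UpS sym_comp[OF s(1)] by (subst finsum_reindex) auto
  also have "\<dots> = (\<Oplus>\<^bsub>B\<^esub>w\<in>Up. T ?s \<otimes>\<^bsub>B\<^esub> T w)"
    using UpS s i by (intro finsum_cong') (auto simp: T_left_up Up_def)
  also have "\<dots> = T ?s \<otimes>\<^bsub>B\<^esub> (\<Oplus>\<^bsub>B\<^esub>w\<in>Up. T w)"
    using UpS s fin by (subst finsum_rdistr) auto
  finally have "xb c = (\<one>\<^bsub>B\<^esub> \<oplus>\<^bsub>B\<^esub> T ?s) \<otimes>\<^bsub>B\<^esub> (\<Oplus>\<^bsub>B\<^esub>w\<in>Up. T w)"
    using UpS s by (subst l_distr) auto
  then show ?thesis using that[of "\<Oplus>\<^bsub>B\<^esub>w\<in>Up. T w"] UpS by auto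
qed

text \<open>By the quadratic relation, multiplying \<open>1 + T (adj i)\<close> by
  \<open>T (adj i)\<close> multiplies it by \<open>q\<close>.\<close>

lemma T_xb:
  assumes i: "1 \<le> i" "i < m" "c i = c (Suc i)"
  shows "T (adj i) \<otimes>\<^bsub>B\<^esub> xb c = q \<odot>\<^bsub>B\<^esub> xb c"
proof -
  obtain x where x: "x \<in> carrier B" "xb c = (\<one>\<^bsub>B\<^esub> \<oplus>\<^bsub>B\<^esub> T (adj i)) \<otimes>\<^bsub>B\<^esub> x"
    by (rule xb_factor[OF i])
  define t where "t = T (adj i)"
  have t: "t \<in> carrier B" using adj_in_sym i by (simp add: t_def)
  have "t \<otimes>\<^bsub>B\<^esub> (\<one>\<^bsub>B\<^esub> \<oplus>\<^bsub>B\<^esub> t) = t \<oplus>\<^bsub>B\<^esub> (q \<odot>\<^bsub>B\<^esub> \<one>\<^bsub>B\<^esub> \<oplus>\<^bsub>B\<^esub> (q \<ominus>\<^bsub>K\<^esub> \<one>\<^bsub>K\<^esub>) \<odot>\<^bsub>B\<^esub> t)"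
    using t T_sq[OF i(1,2)] by (simp add: r_distr t_def)
  also have "(q \<ominus>\<^bsub>K\<^esub> \<one>\<^bsub>K\<^esub>) \<odot>\<^bsub>B\<^esub> t = q \<odot>\<^bsub>B\<^esub> t \<ominus>\<^bsub>B\<^esub> t"
    using t by (simp add: a_minus_def V.smult_l_distr V.smult_l_minus)
  also have "t \<oplus>\<^bsub>B\<^esub> (q \<odot>\<^bsub>B\<^esub> \<one>\<^bsub>B\<^esub> \<oplus>\<^bsub>B\<^esub> (q \<odot>\<^bsub>B\<^esub> t \<ominus>\<^bsub>B\<^esub> t)) = q \<odot>\<^bsub>B\<^esub> (\<one>\<^bsub>B\<^esub> \<oplus>\<^bsub>B\<^esub> t)"
    using t by (simp add: a_minus_def V.smult_r_distr a_ac r_neg1 r_neg2)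
  finally have "t \<otimes>\<^bsub>B\<^esub> (\<one>\<^bsub>B\<^esub> \<oplus>\<^bsub>B\<^esub> t) \<otimes>\<^bsub>B\<^esub> x = q \<odot>\<^bsub>B\<^esub> ((\<one>\<^bsub>B\<^esub> \<oplus>\<^bsub>B\<^esub> t) \<otimes>\<^bsub>B\<^esub> x)"
    using t x by (simp add: scal_left)
  then show ?thesis using t x by (simp add: t_def m_assoc)
qed

text \<open>The pairing is now made on the right. The longer member of a pair has length one more,
  and its additional factor \<open>eps\<close> goes to the generator.\<close>

lemma yb_factor:
  assumes i: "1 \<le> i" "i < m" "c i = c (Suc i)"
  obtains y where "y \<in> carrier B" "yb c = y \<otimes>\<^bsub>B\<^esub> (\<one>\<^bsub>B\<^esub> \<oplus>\<^bsub>B\<^esub> eps \<odot>\<^bsub>B\<^esub> T (adj i))"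
proof -
  let ?s = "adj i" and ?f = "\<lambda>w. (eps [^]\<^bsub>K\<^esub> perm_length m w) \<odot>\<^bsub>B\<^esub> T w"
  define Up where "Up = {w \<in> block_stab m c. w i < w (Suc i)}"
  have fin: "finite Up" unfolding Up_def using finite_block_stab[of m c] by simp
  have UpS: "w \<in> S" if "w \<in> Up" for w using that block_stab_sym by (auto simp: Up_def)
  have s: "?s \<in> S" "?s \<in> block_stab m c" using adj_in_sym adj_block_stab i by auto
  have inj: "inj_on (\<lambda>w. w \<circ> ?s) Up" by (rule inj_onI) (metis comp_adj_adj(1))
  have "block_stab m c = Up \<union> (\<lambda>w. w \<circ> ?s) ` Up"
  proof (intro equalityI subsetI)
    fix w assume w: "w \<in> block_stab m c"
    show "w \<in> Up \<union> (\<lambda>w. w \<circ> ?s) ` Up"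
    proof (cases "w i < w (Suc i)")
      case False
      then have "w (Suc i) < w i"
        using sym_eq_iff[OF block_stab_sym[OF w], of i "Suc i"] by simp
      then have "w \<circ> ?s \<in> Up"
        unfolding Up_def using block_stab_comp[OF w s(2)] by simp
      then show ?thesis by (metis UnI2 comp_adj_adj(1) imageI)
    qed (simp add: Up_def w)
  qed (use block_stab_comp[OF _ s(2)] in \<open>auto simp: Up_def\<close>)
  moreover have "Up \<inter> (\<lambda>w. w \<circ> ?s) ` Up = {}"
    by (auto simp: Up_def)
  ultimately have "yb c = (\<Oplus>\<^bsub>B\<^esub>w\<in>Up. ?f w) \<oplus>\<^bsub>B\<^esub> (\<Oplus>\<^bsub>B\<^esub>w\<in>(\<lambda>w. w \<circ> ?s) ` Up. ?f w)"
    unfolding yb_def using fin UpS sym_comp[OF _ s(1)]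
    by (subst finsum_Un_disjoint[symmetric]) auto
  also have "(\<Oplus>\<^bsub>B\<^esub>w\<in>(\<lambda>w. w \<circ> ?s) ` Up. ?f w) = (\<Oplus>\<^bsub>B\<^esub>w\<in>Up. ?f (w \<circ> ?s))"
    using inj UpS sym_comp[OF _ s(1)] by (subst finsum_reindex) auto
  also have "\<dots> = (\<Oplus>\<^bsub>B\<^esub>w\<in>Up. ?f w \<otimes>\<^bsub>B\<^esub> (eps \<odot>\<^bsub>B\<^esub> T ?s))"
  proof (rule finsum_cong')
    fix w assume w: "w \<in> Up"
    then have "perm_length m (w \<circ> ?s) = Suc (perm_length m w)" "T w \<otimes>\<^bsub>B\<^esub> T ?s = T (w \<circ> ?s)"
      using length_adj_right_up[OF UpS[OF w] i(1,2)] T_right_up[OF UpS[OF w] i(1,2)] by (auto simp: Up_def)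
    then show "?f (w \<circ> ?s) = ?f w \<otimes>\<^bsub>B\<^esub> (eps \<odot>\<^bsub>B\<^esub> T ?s)"
      using UpS[OF w] s eps sym_comp[OF UpS[OF w] s(1)]
      by (simp add: scal_left scal_right V.smult_assoc1 scal_comm[of eps "eps [^]\<^bsub>K\<^esub> perm_length m w"])
  qed (use UpS s eps in auto)
  also have "\<dots> = (\<Oplus>\<^bsub>B\<^esub>w\<in>Up. ?f w) \<otimes>\<^bsub>B\<^esub> (eps \<odot>\<^bsub>B\<^esub> T ?s)"
    using UpS s fin eps by (subst finsum_ldistr) auto
  finally have "yb c = (\<Oplus>\<^bsub>B\<^esub>w\<in>Up. ?f w) \<otimes>\<^bsub>B\<^esub> (\<one>\<^bsub>B\<^esub> \<oplus>\<^bsub>B\<^esub> eps \<odot>\<^bsub>B\<^esub> T ?s)"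
    using UpS s eps by (subst r_distr) auto
  then show ?thesis using that[of "\<Oplus>\<^bsub>B\<^esub>w\<in>Up. ?f w"] UpS by auto
qed

text \<open>In \<open>1 + eps T\<close> times \<open>T\<close> the quadratic relation produces the
  coefficients \<open>eps q = -1\<close> and \<open>eps (q - 1) = -1 - eps\<close>. The terms in
  \<open>T\<close> then combine to \<open>-eps T\<close>.\<close>

lemma yb_T:
  assumes i: "1 \<le> i" "i < m" "c i = c (Suc i)"
  shows "yb c \<otimes>\<^bsub>B\<^esub> T (adj i) = \<ominus>\<^bsub>B\<^esub> yb c"
proof -
  obtain y where y: "y \<in> carrier B" "yb c = y \<otimes>\<^bsub>B\<^esub> (\<one>\<^bsub>B\<^esub> \<oplus>\<^bsub>B\<^esub> eps \<odot>\<^bsub>B\<^esub> T (adj i))"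
    by (rule yb_factor[OF i])
  define t where "t = T (adj i)"
  define e where "e = eps"
  have t: "t \<in> carrier B" using adj_in_sym i by (simp add: t_def)
  have e: "e \<in> carrier K" "e \<otimes>\<^bsub>K\<^esub> q = \<ominus>\<^bsub>K\<^esub> \<one>\<^bsub>K\<^esub>" using eps by (auto simp: e_def)
  have "(\<one>\<^bsub>B\<^esub> \<oplus>\<^bsub>B\<^esub> e \<odot>\<^bsub>B\<^esub> t) \<otimes>\<^bsub>B\<^esub> t = t \<oplus>\<^bsub>B\<^esub> e \<odot>\<^bsub>B\<^esub> (q \<odot>\<^bsub>B\<^esub> \<one>\<^bsub>B\<^esub> \<oplus>\<^bsub>B\<^esub> (q \<ominus>\<^bsub>K\<^esub> \<one>\<^bsub>K\<^esub>) \<odot>\<^bsub>B\<^esub> t)"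
    using t e T_sq[OF i(1,2)] by (simp add: l_distr scal_left flip: t_def)
  also have "e \<odot>\<^bsub>B\<^esub> (q \<odot>\<^bsub>B\<^esub> \<one>\<^bsub>B\<^esub> \<oplus>\<^bsub>B\<^esub> (q \<ominus>\<^bsub>K\<^esub> \<one>\<^bsub>K\<^esub>) \<odot>\<^bsub>B\<^esub> t)
      = (e \<otimes>\<^bsub>K\<^esub> q) \<odot>\<^bsub>B\<^esub> \<one>\<^bsub>B\<^esub> \<oplus>\<^bsub>B\<^esub> (e \<otimes>\<^bsub>K\<^esub> (q \<ominus>\<^bsub>K\<^esub> \<one>\<^bsub>K\<^esub>)) \<odot>\<^bsub>B\<^esub> t"
    using t e(1) by (simp add: V.smult_r_distr V.smult_assoc1)
  also have "e \<otimes>\<^bsub>K\<^esub> (q \<ominus>\<^bsub>K\<^esub> \<one>\<^bsub>K\<^esub>) = \<ominus>\<^bsub>K\<^esub> \<one>\<^bsub>K\<^esub> \<ominus>\<^bsub>K\<^esub> e"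
    using e by (simp add: a_minus_def K.r_distr K.r_minus)
  also have "(\<ominus>\<^bsub>K\<^esub> \<one>\<^bsub>K\<^esub> \<ominus>\<^bsub>K\<^esub> e) \<odot>\<^bsub>B\<^esub> t = \<ominus>\<^bsub>B\<^esub> t \<ominus>\<^bsub>B\<^esub> e \<odot>\<^bsub>B\<^esub> t"
    using e t by (simp add: a_minus_def V.smult_l_distr V.smult_l_minus)
  also have "(e \<otimes>\<^bsub>K\<^esub> q) \<odot>\<^bsub>B\<^esub> \<one>\<^bsub>B\<^esub> = \<ominus>\<^bsub>B\<^esub> \<one>\<^bsub>B\<^esub>"
    using e by (simp add: V.smult_l_minus)
  also have "t \<oplus>\<^bsub>B\<^esub> (\<ominus>\<^bsub>B\<^esub> \<one>\<^bsub>B\<^esub> \<oplus>\<^bsub>B\<^esub> (\<ominus>\<^bsub>B\<^esub> t \<ominus>\<^bsub>B\<^esub> e \<odot>\<^bsub>B\<^esub> t)) = \<ominus>\<^bsub>B\<^esub> (\<one>\<^bsub>B\<^esub> \<oplus>\<^bsub>B\<^esub> e \<odot>\<^bsub>B\<^esub> t)"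
    using e t by (simp add: a_minus_def minus_add a_assoc a_lcomm[of t] r_neg1 r_neg2)
  finally have "y \<otimes>\<^bsub>B\<^esub> ((\<one>\<^bsub>B\<^esub> \<oplus>\<^bsub>B\<^esub> e \<odot>\<^bsub>B\<^esub> t) \<otimes>\<^bsub>B\<^esub> t) = \<ominus>\<^bsub>B\<^esub> (y \<otimes>\<^bsub>B\<^esub> (\<one>\<^bsub>B\<^esub> \<oplus>\<^bsub>B\<^esub> e \<odot>\<^bsub>B\<^esub> t))"
    using t y e by (simp add: r_minus)
  then show ?thesis using t y e by (simp add: t_def e_def m_assoc)
qed

lemmas T_span_induct = basis_induct[OF basis, consumes 1, case_names zero add scal]

text \<open>The vector \<open>g\<close> is any eigenvector in any module, so the result applies to
  Young modules whose generator is not itself a symmetriser. Induction on the length of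
  \<open>w\<close> strips off descents inside blocks, at the price of the scalar -1 on the left or
  \<open>q\<close> on the right. What remains is a \<open>w\<close> that is shortest in its double
  coset, and there a collision forces a zero factor.\<close>

lemma vanish:
  fixes M :: "('b, 'x) module"
  assumes M: "left_module B M" and g: "g \<in> carrier M"
    and c: "block_fun m c" and d: "block_fun m d"
    and eig: "\<And>i. \<lbrakk>1 \<le> i; i < m; d i = d (Suc i)\<rbrakk> \<Longrightarrow> T (adj i) \<odot>\<^bsub>M\<^esub> g = (q \<odot>\<^bsub>B\<^esub> \<one>\<^bsub>B\<^esub>) \<odot>\<^bsub>M\<^esub> g"
    and coll: "\<And>w. w \<in> S \<Longrightarrow> \<exists>a b. 1 \<le> a \<and> a < b \<and> b \<le> m \<and> d a = d b \<and> c (w a) = c (w b)"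
    and h: "h \<in> carrier B"
  shows "(yb c \<otimes>\<^bsub>B\<^esub> h) \<odot>\<^bsub>M\<^esub> g = \<zero>\<^bsub>M\<^esub>"
proof -
  interpret M: left_module B M by fact
  note sc = M.smult_closed
  \<comment> \<open>A left module over \<open>B\<close> carries no separate action of
    \<open>K\<close>; scalars act through multiples of the unit of \<open>B\<close>.\<close>
  have scal_g: "(b \<otimes>\<^bsub>B\<^esub> (a \<odot>\<^bsub>B\<^esub> x)) \<odot>\<^bsub>M\<^esub> g = (a \<odot>\<^bsub>B\<^esub> \<one>\<^bsub>B\<^esub>) \<odot>\<^bsub>M\<^esub> ((b \<otimes>\<^bsub>B\<^esub> x) \<odot>\<^bsub>M\<^esub> g)"
    if "a \<in> carrier K" "b \<in> carrier B" "x \<in> carrier B" for a b x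
    using that g by (simp add: scal_right scal_left flip: M.smult_assoc)
  have *: "(yb c \<otimes>\<^bsub>B\<^esub> T w) \<odot>\<^bsub>M\<^esub> g = \<zero>\<^bsub>M\<^esub>" if "w \<in> S" for w
    using that
  proof (induction "perm_length m w" arbitrary: w rule: less_induct)
    case (less w)
    note w = less.prems
    \<comment> \<open>Either \<open>w\<close> can be shortened from the left inside a
      \<open>c\<close>-block, or from the right inside a \<open>d\<close>-block, or it is minimal
      for both.\<close>
    consider (left) i where "1 \<le> i" "i < m" "c i = c (Suc i)" "pinv w (Suc i) < pinv w i"
      | (right) i where "1 \<le> i" "i < m" "d i = d (Suc i)" "w (Suc i) < w i"
      | (min) "\<And>i. \<lbrakk>1 \<le> i; i < m; d i = d (Suc i)\<rbrakk> \<Longrightarrow> w i < w (Suc i)"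
          "\<And>i. \<lbrakk>1 \<le> i; i < m; c i = c (Suc i)\<rbrakk> \<Longrightarrow> pinv w i < pinv w (Suc i)"
      using sym_eq_iff[OF w] sym_eq_iff[OF sym_pinv[OF w]] by (metis linorder_neqE_nat n_not_Suc_n)
    then show ?case
    proof cases
      case (left i)
      define v where "v = adj i \<circ> w"
      have s: "adj i \<in> S" by (rule adj_in_sym[OF left(1,2)])
      have v: "v \<in> S" unfolding v_def by (rule sym_comp[OF s w])
      have "T w = T (adj i) \<otimes>\<^bsub>B\<^esub> T v"
        using T_left_up[OF v left(1,2)] left(4) comp_adj_adj(2)[of i w]
        by (simp add: v_def pinv_comp_adj[OF w])
      then have "yb c \<otimes>\<^bsub>B\<^esub> T w = \<ominus>\<^bsub>B\<^esub> (yb c \<otimes>\<^bsub>B\<^esub> T v)"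
        using yb_T[OF left(1-3)] s v by (simp add: l_minus flip: m_assoc)
      moreover have "(yb c \<otimes>\<^bsub>B\<^esub> T v) \<odot>\<^bsub>M\<^esub> g = \<zero>\<^bsub>M\<^esub>"
        using less.hyps[OF _ v] length_adj_left_down[OF w left(1,2,4)] by (simp add: v_def)
      ultimately show ?thesis using v g by (simp add: M.smult_l_neg)
    next
      case (right i)
      define v where "v = w \<circ> adj i"
      have s: "adj i \<in> S" by (rule adj_in_sym[OF right(1,2)])
      have v: "v \<in> S" unfolding v_def by (rule sym_comp[OF w s])
      have Tw: "T w = T v \<otimes>\<^bsub>B\<^esub> T (adj i)"
        using T_right_up[OF v right(1,2)] right(4) comp_adj_adj(1)[of w i] by (simp add: v_def)
      have "(yb c \<otimes>\<^bsub>B\<^esub> T w) \<odot>\<^bsub>M\<^esub> g = (yb c \<otimes>\<^bsub>B\<^esub> T v) \<odot>\<^bsub>M\<^esub> (T (adj i) \<odot>\<^bsub>M\<^esub> g)"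
        unfolding Tw using s v g by (simp add: m_assoc flip: M.smult_assoc)
      also have "\<dots> = (yb c \<otimes>\<^bsub>B\<^esub> (q \<odot>\<^bsub>B\<^esub> T v)) \<odot>\<^bsub>M\<^esub> g"
        using eig[OF right(1-3)] v g by (simp add: scal_right flip: M.smult_assoc)
      also have "\<dots> = (q \<odot>\<^bsub>B\<^esub> \<one>\<^bsub>B\<^esub>) \<odot>\<^bsub>M\<^esub> ((yb c \<otimes>\<^bsub>B\<^esub> T v) \<odot>\<^bsub>M\<^esub> g)"
        using v by (intro scal_g) simp_all
      also have "(yb c \<otimes>\<^bsub>B\<^esub> T v) \<odot>\<^bsub>M\<^esub> g = \<zero>\<^bsub>M\<^esub>"
        using less.hyps[OF _ v] length_adj_right_down[OF w right(1,2,4)] by (simp add: v_def)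
      finally show ?thesis by (simp add: M.smult_r_zero)
    next
      case min
      obtain a b where ab: "1 \<le> a" "a < b" "b \<le> m" "d a = d b" "c (w a) = c (w b)"
        using coll[OF w] by blast
      obtain i where i: "1 \<le> i" "i < m" "d i = d (Suc i)" "1 \<le> w i" "w i < m" "c (w i) = c (Suc (w i))"
        "w (Suc i) = Suc (w i)"
        by (rule minimal_double_coset_adjacent[OF c d w min ab])
      define t t' where "t = T (adj (w i))" and "t' = T (adj i)"
      have s: "adj i \<in> S" "adj (w i) \<in> S" using adj_in_sym i by auto
      have t: "t \<in> carrier B" "t' \<in> carrier B" using s by (auto simp: t_def t'_def)
      have "pinv w (w i) < pinv w (Suc (w i))" using sym_pinv_apply[OF w] i(7) by (metis lessI)
      then have "t \<otimes>\<^bsub>B\<^esub> T w = T (adj (w i) \<circ> w)"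
        unfolding t_def by (rule T_left_up[OF w i(4,5)])
      \<comment> \<open>Since \<open>w\<close> takes the neighbours \<open>i\<close> and
        \<open>Suc i\<close> to neighbours, conjugation by \<open>w\<close> takes one adjacent
        transposition to the other.\<close>
      also have "adj (w i) \<circ> w = w \<circ> adj i"
        using sym_eq_iff[OF w] i(7)[symmetric] by (auto simp: fun_eq_iff Transposition.transpose_def)
      also have "T (w \<circ> adj i) = T w \<otimes>\<^bsub>B\<^esub> t'"
        unfolding t'_def using i by (intro T_right_up[OF w, symmetric]) auto
      finally have comm: "t \<otimes>\<^bsub>B\<^esub> T w = T w \<otimes>\<^bsub>B\<^esub> t'" .
      define e where "e = eps"
      have e: "e \<in> carrier K" "e \<otimes>\<^bsub>K\<^esub> q = \<ominus>\<^bsub>K\<^esub> \<one>\<^bsub>K\<^esub>" using eps by (auto simp: e_def)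
      obtain y where y: "y \<in> carrier B" "yb c = y \<otimes>\<^bsub>B\<^esub> (\<one>\<^bsub>B\<^esub> \<oplus>\<^bsub>B\<^esub> e \<odot>\<^bsub>B\<^esub> t)"
        unfolding e_def t_def by (rule yb_factor[OF i(4-6)])
      have "yb c \<otimes>\<^bsub>B\<^esub> T w = y \<otimes>\<^bsub>B\<^esub> (T w \<otimes>\<^bsub>B\<^esub> (\<one>\<^bsub>B\<^esub> \<oplus>\<^bsub>B\<^esub> e \<odot>\<^bsub>B\<^esub> t'))"
        using y t e w by (simp add: m_assoc l_distr r_distr scal_left scal_right comm)
      then have "(yb c \<otimes>\<^bsub>B\<^esub> T w) \<odot>\<^bsub>M\<^esub> g = (y \<otimes>\<^bsub>B\<^esub> T w) \<odot>\<^bsub>M\<^esub> ((\<one>\<^bsub>B\<^esub> \<oplus>\<^bsub>B\<^esub> e \<odot>\<^bsub>B\<^esub> t') \<odot>\<^bsub>M\<^esub> g)"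
        using y t e w g by (simp flip: M.smult_assoc m_assoc)
      also have "(\<one>\<^bsub>B\<^esub> \<oplus>\<^bsub>B\<^esub> e \<odot>\<^bsub>B\<^esub> t') \<odot>\<^bsub>M\<^esub> g = g \<oplus>\<^bsub>M\<^esub> (e \<odot>\<^bsub>B\<^esub> \<one>\<^bsub>B\<^esub> \<otimes>\<^bsub>B\<^esub> t') \<odot>\<^bsub>M\<^esub> g"
        using t e g by (simp add: M.smult_l_distr M.smult_one scal_left)
      also have "(e \<odot>\<^bsub>B\<^esub> \<one>\<^bsub>B\<^esub> \<otimes>\<^bsub>B\<^esub> t') \<odot>\<^bsub>M\<^esub> g = (e \<odot>\<^bsub>B\<^esub> \<one>\<^bsub>B\<^esub> \<otimes>\<^bsub>B\<^esub> (q \<odot>\<^bsub>B\<^esub> \<one>\<^bsub>B\<^esub>)) \<odot>\<^bsub>M\<^esub> g"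
        using t e g eig[OF i(1-3)] by (simp only: M.smult_assoc t'_def V.smult_closed one_closed q_closed)
      \<comment> \<open>Here the right factor \<open>1 + e T (adj i)\<close> acts on
        \<open>g\<close> as \<open>1 + e q\<close>, which is zero.\<close>
      also have "e \<odot>\<^bsub>B\<^esub> \<one>\<^bsub>B\<^esub> \<otimes>\<^bsub>B\<^esub> (q \<odot>\<^bsub>B\<^esub> \<one>\<^bsub>B\<^esub>) = \<ominus>\<^bsub>B\<^esub> \<one>\<^bsub>B\<^esub>"
        using e by (simp add: scal_left V.smult_l_minus flip: V.smult_assoc1)
      also have "g \<oplus>\<^bsub>M\<^esub> (\<ominus>\<^bsub>B\<^esub> \<one>\<^bsub>B\<^esub>) \<odot>\<^bsub>M\<^esub> g = \<zero>\<^bsub>M\<^esub>"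
        using g by (simp add: M.smult_l_neg M.smult_one M.r_neg)
      finally show ?thesis using y w by (simp add: M.smult_r_zero)
    qed
  qed
  show ?thesis
    using h
  proof (induction rule: T_span_induct)
    case zero
    then show ?case using g by (simp add: M.smult_l_zero)
  next
    case (add x y)
    then show ?case using g by (simp add: r_distr M.smult_l_distr)
  next
    case (scal a w)
    then show ?case using * scal_g by (simp add: M.smult_r_zero)
  qed
qed

text \<open>The assumption \<open>incr\<close> makes \<open>w\<close> the shortest element of its
  left coset, so lengths add. Along a reduced word of \<open>v\<close> every ascent of
  \<open>v\<close> stays an ascent of \<open>w \<circ> v\<close>, because \<open>v\<close> moves
  letters only within their blocks and \<open>w\<close> increases there.\<close>

lemma T_mult_block_right:
  assumes d: "block_fun m d" and w: "w \<in> S" and v: "v \<in> block_stab m d"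
    and incr: "\<And>a b. \<lbrakk>1 \<le> a; a < b; b \<le> m; d a = d b\<rbrakk> \<Longrightarrow> w a < w b"
  shows "T w \<otimes>\<^bsub>B\<^esub> T v = T (w \<circ> v)"
  using d v
proof (induction rule: block_length_induct)
  case id
  then show ?case using w by (simp only: T_id comp_id id_comp r_one l_one T_closed)
next
  case (right v i)
  note v = block_stab_sym[OF right(1)]
  have s: "adj i \<in> S" by (rule adj_in_sym[OF right(2,3)])
  have r: "1 \<le> v i" "v (Suc i) \<le> m" "d (v i) = d (v (Suc i))"
    using sym_range[OF v] block_stab_eq[OF right(1)] right by auto
  have "(w \<circ> v) i < (w \<circ> v) (Suc i)"
    using incr[OF r(1) right(5) r(2,3)] by simp
  then have "T (w \<circ> v) \<otimes>\<^bsub>B\<^esub> T (adj i) = T (w \<circ> v \<circ> adj i)"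
    by (rule T_right_up[OF sym_comp[OF w v] right(2,3)])
  moreover have "T v \<otimes>\<^bsub>B\<^esub> T (adj i) = T (v \<circ> adj i)"
    by (rule T_right_up[OF v right(2,3,5)])
  ultimately show ?case
    using right.IH w v s by (metis T_closed comp_assoc m_assoc)
qed

lemma T_mult_block_left:
  assumes c: "block_fun m c" and w: "w \<in> S" and u: "u \<in> block_stab m c"
    and incr: "\<And>a b. \<lbrakk>1 \<le> a; a < b; b \<le> m; c a = c b\<rbrakk> \<Longrightarrow> pinv w a < pinv w b"
  shows "T u \<otimes>\<^bsub>B\<^esub> T w = T (u \<circ> w)"
  using c u
proof (induction rule: block_length_induct_left)
  case id
  then show ?case using w by (simp only: T_id comp_id id_comp r_one l_one T_closed)
next
  case (left u i)
  note u = block_stab_sym[OF left(1)]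
  have s: "adj i \<in> S" by (rule adj_in_sym[OF left(2,3)])
  have r: "1 \<le> pinv u i" "pinv u (Suc i) \<le> m" "c (pinv u i) = c (pinv u (Suc i))"
    using sym_range[OF sym_pinv[OF u]] block_stab_eq[OF block_stab_pinv[OF left(1)]] left by auto
  have "pinv (u \<circ> w) = pinv w \<circ> pinv u"
    using u w by (intro o_inv_distrib) (auto simp: sym_group_carrier permutes_bij)
  then have "pinv (u \<circ> w) i < pinv (u \<circ> w) (Suc i)"
    using incr[OF r(1) left(5) r(2,3)] by simp
  then have "T (adj i) \<otimes>\<^bsub>B\<^esub> T (u \<circ> w) = T (adj i \<circ> (u \<circ> w))"
    by (rule T_left_up[OF sym_comp[OF u w] left(2,3)])
  moreover have "T (adj i) \<otimes>\<^bsub>B\<^esub> T u = T (adj i \<circ> u)"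
    by (rule T_left_up[OF u left(2,3,5)])
  ultimately show ?case
    using left.IH w u s by (metis T_closed comp_assoc m_assoc)
qed

text \<open>The coefficient of \<open>T w\<close> is 1.\<close>

lemma nonvanish:
  assumes c: "block_fun m c" and d: "block_fun m d" and w: "w \<in> S"
    and rows: "\<And>a b. \<lbrakk>1 \<le> a; a < b; b \<le> m; d a = d b\<rbrakk> \<Longrightarrow> w a < w b"
    and cols: "\<And>a b. \<lbrakk>1 \<le> a; a < b; b \<le> m; c (w a) = c (w b)\<rbrakk> \<Longrightarrow> d a < d b \<and> w a < w b"
  shows "yb c \<otimes>\<^bsub>B\<^esub> T w \<otimes>\<^bsub>B\<^esub> xb d \<noteq> \<zero>\<^bsub>B\<^esub>"
proof
  assume zero: "yb c \<otimes>\<^bsub>B\<^esub> T w \<otimes>\<^bsub>B\<^esub> xb d = \<zero>\<^bsub>B\<^esub>"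
  let ?C = "block_stab m c" and ?D = "block_stab m d"
  have fC: "finite ?C" "finite ?D" by (simp_all add: finite_block_stab)
  have CS: "u \<in> S" if "u \<in> ?C" for u using that by (rule block_stab_sym)
  have DS: "v \<in> S" if "v \<in> ?D" for v using that by (rule block_stab_sym)
  define e where "e = eps"
  have e: "e \<in> carrier K" using eps by (simp add: e_def)
  \<comment> \<open>Every term of the expanded product is a single basis element. For the left
    factor this uses that \<open>v\<close> permutes letters only inside \<open>d\<close>-blocks,
    while letters meeting in a \<open>c\<close>-block lie in different \<open>d\<close>-blocks in
    the right order.\<close>
  have prod: "T u \<otimes>\<^bsub>B\<^esub> (T w \<otimes>\<^bsub>B\<^esub> T v) = T (u \<circ> w \<circ> v)" if u: "u \<in> ?C" and v: "v \<in> ?D" for u v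
  proof -
    have "T w \<otimes>\<^bsub>B\<^esub> T v = T (w \<circ> v)" by (rule T_mult_block_right[OF d w v rows])
    moreover have "T u \<otimes>\<^bsub>B\<^esub> T (w \<circ> v) = T (u \<circ> (w \<circ> v))"
    proof (rule T_mult_block_left[OF c sym_comp[OF w DS[OF v]] u])
      fix x y assume xy: "1 \<le> x" "x < y" "y \<le> m" "c x = c y"
      define a b where "a = pinv w x" and "b = pinv w y"
      have wab: "w a = x" "w b = y" by (simp_all add: a_def b_def sym_pinv_apply[OF w])
      have ra: "1 \<le> a" "a \<le> m" "1 \<le> b" "b \<le> m"
        using sym_range[OF sym_pinv[OF w]] xy by (auto simp: a_def b_def)
      have "a < b"
        using cols[of b a] ra wab xy by (metis linorder_neqE_nat order_less_asym)
      then have "d a < d b" using cols[of a b] ra wab xy by simp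
      then have l: "d (pinv v a) < d (pinv v b)"
        using block_stab_eq[OF block_stab_pinv[OF v]] ra by simp
      have "pinv v a < pinv v b"
      proof (rule ccontr)
        assume "\<not> pinv v a < pinv v b"
        then have "d (pinv v b) \<le> d (pinv v a)"
          using d sym_range[OF sym_pinv[OF DS[OF v]]] ra by (auto simp: block_fun_def)
        then show False using l by simp
      qed
      moreover have "pinv (w \<circ> v) = pinv v \<circ> pinv w"
        using w DS[OF v] by (intro o_inv_distrib) (auto simp: sym_group_carrier permutes_bij)
      ultimately show "pinv (w \<circ> v) x < pinv (w \<circ> v) y" by (simp add: a_def b_def)
    qed
    ultimately show ?thesis by (simp add: comp_assoc)
  qed
  \<comment> \<open>The element \<open>w\<close> arises from one pair only: a letter and its image
    under \<open>v\<close> share a \<open>d\<close>-block and, after \<open>w\<close>, a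
    \<open>c\<close>-block, so they are equal.\<close>
  have triv: "u = id \<and> v = id" if u: "u \<in> ?C" and v: "v \<in> ?D" and uwv: "u \<circ> w \<circ> v = w" for u v
  proof -
    have va: "v a = a" for a
    proof (cases "1 \<le> a \<and> a \<le> m")
      case True
      have r: "1 \<le> v a" "v a \<le> m" using sym_range[OF DS[OF v]] True by auto
      have "u (w (v a)) = w a" using uwv by (metis comp_apply)
      then have "c (w (v a)) = c (w a)"
        using block_stab_eq[OF u] sym_range[OF w] r by metis
      moreover have "d (v a) = d a" using block_stab_eq[OF v] True by simp
      ultimately show ?thesis
        using cols[of a "v a"] cols[of "v a" a] True r by (metis less_irrefl linorder_neqE_nat)
    next
      case False
      then show ?thesis using DS[OF v] by (auto simp: sym_group_carrier permutes_def)
    qed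
    then have v: "v = id" by auto
    have "u x = x" for x
      using uwv sym_pinv_apply(2)[OF w, of x] unfolding v by (metis comp_apply id_apply)
    then show ?thesis using v by auto
  qed
  \<comment> \<open>This is the coordinate of \<open>T w\<close>. Applied to the expanded product it
    leaves only the pair of identities, whose weight is \<open>eps\<close> to the power 0.\<close>
  obtain f where f: "add_hom B K f" "\<And>a x. \<lbrakk>a \<in> carrier K; x \<in> carrier B\<rbrakk> \<Longrightarrow> f (a \<odot>\<^bsub>B\<^esub> x) = a \<otimes>\<^bsub>K\<^esub> f x"
    "\<And>j. j \<in> S \<Longrightarrow> f (T j) = (if j = w then \<one>\<^bsub>K\<^esub> else \<zero>\<^bsub>K\<^esub>)"
    using finite_basis_dual[OF V.module_axioms basis w] by blast
  note fs = add_hom_finsum[OF abelian_group_axioms K.abelian_group_axioms f(1)]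
  have uwvS: "u \<circ> w \<circ> v \<in> S" if "u \<in> ?C" "v \<in> ?D" for u v
    by (intro sym_comp CS DS w that)
  have one: "(\<Oplus>\<^bsub>K\<^esub>v\<in>?D. if u \<circ> w \<circ> v = w then \<one>\<^bsub>K\<^esub> else \<zero>\<^bsub>K\<^esub>) = (if id = u then \<one>\<^bsub>K\<^esub> else \<zero>\<^bsub>K\<^esub>)"
    if u: "u \<in> ?C" for u
  proof -
    have "(\<Oplus>\<^bsub>K\<^esub>v\<in>?D. if u \<circ> w \<circ> v = w then \<one>\<^bsub>K\<^esub> else \<zero>\<^bsub>K\<^esub>)
        = (\<Oplus>\<^bsub>K\<^esub>v\<in>?D. if id = v then (if id = u then \<one>\<^bsub>K\<^esub> else \<zero>\<^bsub>K\<^esub>) else \<zero>\<^bsub>K\<^esub>)"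
    proof (rule K.finsum_cong')
      fix v assume "v \<in> ?D"
      then have "u \<circ> w \<circ> v = w \<longleftrightarrow> id = u \<and> id = v"
        using triv[OF u] by (metis comp_id id_comp)
      then show "(if u \<circ> w \<circ> v = w then \<one>\<^bsub>K\<^esub> else \<zero>\<^bsub>K\<^esub>) =
          (if id = v then if id = u then \<one>\<^bsub>K\<^esub> else \<zero>\<^bsub>K\<^esub> else \<zero>\<^bsub>K\<^esub>)"
        by metis
    qed auto
    also have "\<dots> = (if id = u then \<one>\<^bsub>K\<^esub> else \<zero>\<^bsub>K\<^esub>)"
      using fC block_stab_id by (intro K.add.finprod_singleton) auto
    finally show ?thesis .
  qed
  have "yb c \<otimes>\<^bsub>B\<^esub> (T w \<otimes>\<^bsub>B\<^esub> xb d) = (\<Oplus>\<^bsub>B\<^esub>u\<in>?C. (e [^]\<^bsub>K\<^esub> perm_length m u) \<odot>\<^bsub>B\<^esub> (\<Oplus>\<^bsub>B\<^esub>v\<in>?D. T (u \<circ> w \<circ> v)))"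
  proof -
    have "yb c \<otimes>\<^bsub>B\<^esub> (T w \<otimes>\<^bsub>B\<^esub> xb d) = (\<Oplus>\<^bsub>B\<^esub>u\<in>?C. ((e [^]\<^bsub>K\<^esub> perm_length m u) \<odot>\<^bsub>B\<^esub> T u) \<otimes>\<^bsub>B\<^esub> (T w \<otimes>\<^bsub>B\<^esub> xb d))"
      unfolding yb_def e_def using fC CS w by (intro finsum_ldistr) auto
    also have "\<dots> = (\<Oplus>\<^bsub>B\<^esub>u\<in>?C. (e [^]\<^bsub>K\<^esub> perm_length m u) \<odot>\<^bsub>B\<^esub> (\<Oplus>\<^bsub>B\<^esub>v\<in>?D. T (u \<circ> w \<circ> v)))"
    proof (rule finsum_cong')
      fix u assume u: "u \<in> ?C"
      have "T w \<otimes>\<^bsub>B\<^esub> xb d = (\<Oplus>\<^bsub>B\<^esub>v\<in>?D. T w \<otimes>\<^bsub>B\<^esub> T v)"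
        unfolding xb_def using fC DS w by (intro finsum_rdistr) auto
      then have "T u \<otimes>\<^bsub>B\<^esub> (T w \<otimes>\<^bsub>B\<^esub> xb d) = (\<Oplus>\<^bsub>B\<^esub>v\<in>?D. T u \<otimes>\<^bsub>B\<^esub> (T w \<otimes>\<^bsub>B\<^esub> T v))"
        using fC DS w CS[OF u] by (simp only:) (intro finsum_rdistr, auto)
      also have "\<dots> = (\<Oplus>\<^bsub>B\<^esub>v\<in>?D. T (u \<circ> w \<circ> v))"
        using prod[OF u] uwvS[OF u] by (intro finsum_cong') auto
      finally show "((e [^]\<^bsub>K\<^esub> perm_length m u) \<odot>\<^bsub>B\<^esub> T u) \<otimes>\<^bsub>B\<^esub> (T w \<otimes>\<^bsub>B\<^esub> xb d)
          = (e [^]\<^bsub>K\<^esub> perm_length m u) \<odot>\<^bsub>B\<^esub> (\<Oplus>\<^bsub>B\<^esub>v\<in>?D. T (u \<circ> w \<circ> v))"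
        using CS[OF u] w e by (simp add: scal_left)
    qed (use uwvS e in \<open>auto intro!: V.smult_closed finsum_closed\<close>)
    finally show ?thesis .
  qed
  then have "f \<zero>\<^bsub>B\<^esub> = f (\<Oplus>\<^bsub>B\<^esub>u\<in>?C. (e [^]\<^bsub>K\<^esub> perm_length m u) \<odot>\<^bsub>B\<^esub> (\<Oplus>\<^bsub>B\<^esub>v\<in>?D. T (u \<circ> w \<circ> v)))"
    using zero w by (simp add: m_assoc)
  also have "\<dots> = (\<Oplus>\<^bsub>K\<^esub>u\<in>?C. f ((e [^]\<^bsub>K\<^esub> perm_length m u) \<odot>\<^bsub>B\<^esub> (\<Oplus>\<^bsub>B\<^esub>v\<in>?D. T (u \<circ> w \<circ> v))))"
    using uwvS e by (intro fs fC) (auto intro!: V.smult_closed finsum_closed)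
  also have "\<dots> = (\<Oplus>\<^bsub>K\<^esub>u\<in>?C. if id = u then \<one>\<^bsub>K\<^esub> else \<zero>\<^bsub>K\<^esub>)"
  proof (rule K.finsum_cong')
    fix u assume u: "u \<in> ?C"
    have "f (\<Oplus>\<^bsub>B\<^esub>v\<in>?D. T (u \<circ> w \<circ> v)) = (\<Oplus>\<^bsub>K\<^esub>v\<in>?D. f (T (u \<circ> w \<circ> v)))"
      using uwvS[OF u] by (intro fs fC) auto
    also have "\<dots> = (\<Oplus>\<^bsub>K\<^esub>v\<in>?D. if u \<circ> w \<circ> v = w then \<one>\<^bsub>K\<^esub> else \<zero>\<^bsub>K\<^esub>)"
      using uwvS[OF u] f(3) by (intro K.finsum_cong') auto
    finally have "f (\<Oplus>\<^bsub>B\<^esub>v\<in>?D. T (u \<circ> w \<circ> v)) = (if id = u then \<one>\<^bsub>K\<^esub> else \<zero>\<^bsub>K\<^esub>)"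
      using one[OF u] by simp
    then have "f ((e [^]\<^bsub>K\<^esub> perm_length m u) \<odot>\<^bsub>B\<^esub> (\<Oplus>\<^bsub>B\<^esub>v\<in>?D. T (u \<circ> w \<circ> v)))
        = (e [^]\<^bsub>K\<^esub> perm_length m u) \<otimes>\<^bsub>K\<^esub> (if id = u then \<one>\<^bsub>K\<^esub> else \<zero>\<^bsub>K\<^esub>)"
      using uwvS[OF u] e by (subst f(2)) (auto intro!: finsum_closed)
    also have "\<dots> = (if id = u then \<one>\<^bsub>K\<^esub> else \<zero>\<^bsub>K\<^esub>)"
      using e by (auto simp: perm_length_id)
    finally show "f ((e [^]\<^bsub>K\<^esub> perm_length m u) \<odot>\<^bsub>B\<^esub> (\<Oplus>\<^bsub>B\<^esub>v\<in>?D. T (u \<circ> w \<circ> v))) = (if id = u then \<one>\<^bsub>K\<^esub> else \<zero>\<^bsub>K\<^esub>)" .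
  qed auto
  also have "\<dots> = \<one>\<^bsub>K\<^esub>" using fC block_stab_id by (intro K.add.finprod_singleton) auto
  finally show False
    using add_hom_zero_minus(1)[OF abelian_group_axioms K.abelian_group_axioms f(1)] by simp
qed

end

section \<open>Partitions\<close>

abbreviation psum :: "nat list \<Rightarrow> nat \<Rightarrow> nat"
  where "psum lam i \<equiv> sum_list (take i lam)"

text \<open>The number of rows ending strictly before the letter \<open>a\<close> is the index, from
  0, of the row that holds \<open>a\<close>. As a count it is monotone on all natural numbers and
  for every list.\<close>

definition blk :: "nat list \<Rightarrow> nat \<Rightarrow> nat"
  where "blk lam a = card {i. i < length lam \<and> psum lam (Suc i) < a}"

lemma psum_Suc: "i < length lam \<Longrightarrow> psum lam (Suc i) = psum lam i + lam ! i"
  by (simp add: take_Suc_conv_app_nth)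

lemma psum_mono: "i \<le> j \<Longrightarrow> psum lam i \<le> psum lam j"
  by (metis le_add1 le_add_diff_inverse sum_list_append take_add)

lemma blk_eq:
  assumes "i < length lam" "psum lam i < a" "a \<le> psum lam (Suc i)"
  shows "blk lam a = i"
proof -
  have iff: "psum lam (Suc j) < a \<longleftrightarrow> j < i" for j
  proof (cases "j < i")
    case True
    then show ?thesis using psum_mono[of "Suc j" i lam] assms(2) by linarith
  next
    case False
    then show ?thesis using psum_mono[of "Suc i" "Suc j" lam] assms(3) by linarith
  qed
  have "{j. j < length lam \<and> psum lam (Suc j) < a} = {..<i}"
    unfolding iff using assms(1) by auto
  then show ?thesis by (simp add: blk_def)
qed

lemma blk_row: "\<lbrakk>i < length lam; j < lam ! i\<rbrakk> \<Longrightarrow> blk lam (row_tableau lam i j) = i"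
  by (rule blk_eq) (simp_all add: psum_Suc row_tableau_def)

lemma row_cover_aux: "\<lbrakk>1 \<le> a; a \<le> psum lam n; n \<le> length lam\<rbrakk> \<Longrightarrow>
    \<exists>i<n. \<exists>j<lam ! i. a = row_tableau lam i j"
proof (induction n)
  case (Suc n)
  show ?case
  proof (cases "a \<le> psum lam n")
    case True
    then show ?thesis using Suc by (meson Suc_leD less_SucI)
  next
    case False
    then have "a - psum lam n - 1 < lam ! n" "a = row_tableau lam n (a - psum lam n - 1)"
      using Suc.prems psum_Suc[of n lam] by (auto simp: row_tableau_def)
    then show ?thesis by blast
  qed
qed simp

lemma row_cover:
  assumes "1 \<le> a" "a \<le> sum_list lam"
  obtains i j where "i < length lam" "j < lam ! i" "a = row_tableau lam i j"
  using row_cover_aux[of a "length lam" lam] assms by auto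

lemma row_range:
  assumes "i < length lam" "j < lam ! i"
  shows "1 \<le> row_tableau lam i j" "row_tableau lam i j \<le> sum_list lam"
proof -
  have "row_tableau lam i j \<le> psum lam (Suc i)"
    using assms by (simp add: psum_Suc row_tableau_def)
  also have "\<dots> \<le> psum lam (length lam)" using assms by (intro psum_mono) simp
  finally show "row_tableau lam i j \<le> sum_list lam" by simp
qed (simp add: row_tableau_def)

lemma row_inj:
  assumes "i < length lam" "j < lam ! i" "i' < length lam" "j' < lam ! i'"
    "row_tableau lam i j = row_tableau lam i' j'"
  shows "i = i'" "j = j'"
proof -
  show "i = i'" using blk_row assms by metis
  then show "j = j'" using assms(5) by (simp add: row_tableau_def)
qed

lemma row_less:
  assumes "i < i'" "i < length lam" "j < lam ! i"
  shows "row_tableau lam i j < row_tableau lam i' j'"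
  using psum_mono[of "Suc i" i' lam] assms by (simp add: psum_Suc row_tableau_def)

lemma block_fun_blk: "block_fun m (blk lam)"
  unfolding block_fun_def blk_def by (auto intro!: card_mono)

text \<open>Preserving row labels means mapping each row into itself; rows are finite and
  \<open>w\<close> is injective, so this inclusion is an equality.\<close>

lemma young_subgroup_eq:
  assumes "sum_list lam = m"
  shows "young_subgroup m lam = block_stab m (blk lam)"
proof (intro equalityI subsetI)
  fix w assume w: "w \<in> young_subgroup m lam"
  have "blk lam (w a) = blk lam a" if "1 \<le> a" "a \<le> m" for a
  proof -
    obtain i j where ij: "i < length lam" "j < lam ! i" "a = row_tableau lam i j"
      using row_cover[of a lam] \<open>1 \<le> a\<close> \<open>a \<le> m\<close> assms by blast
    then have "w a \<in> row_tableau lam i ` {..<lam ! i}"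
      using w unfolding young_subgroup_def by blast
    then show ?thesis using ij blk_row by auto
  qed
  then show "w \<in> block_stab m (blk lam)"
    using w by (simp add: block_stab_def young_subgroup_def)
next
  fix w assume w: "w \<in> block_stab m (blk lam)"
  note ws = block_stab_sym[OF w]
  have "w ` (row_tableau lam i ` {..<lam ! i}) = row_tableau lam i ` {..<lam ! i}"
    if i: "i < length lam" for i
  proof (rule endo_inj_surj)
    show "w ` (row_tableau lam i ` {..<lam ! i}) \<subseteq> row_tableau lam i ` {..<lam ! i}"
    proof safe
      fix j assume j: "j < lam ! i"
      let ?a = "row_tableau lam i j"
      have r: "1 \<le> ?a" "?a \<le> m" using row_range[OF i j] assms by auto
      have b: "blk lam (w ?a) = i" using block_stab_eq[OF w r] blk_row[OF i j] by simp
      obtain i' j' where ij: "i' < length lam" "j' < lam ! i'" "w ?a = row_tableau lam i' j'"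
        using row_cover[of "w ?a" lam] sym_range[OF ws r] assms by blast
      then have "i' = i" using b blk_row by simp
      then show "w ?a \<in> row_tableau lam i ` {..<lam ! i}" using ij by auto
    qed
    show "inj_on w (row_tableau lam i ` {..<lam ! i})"
      using sym_inj[OF ws] by (rule inj_on_subset) simp
  qed simp
  then show "w \<in> young_subgroup m lam" using ws by (simp add: young_subgroup_def)
qed

section \<open>Conjugate partitions and the column filling\<close>

lemma length_conjugate: "length (conjugate lam) = (if lam = [] then 0 else hd lam)"
  by (simp add: conjugate_def)

lemma partition_nth_mono:
  assumes "partition_of lam m" "i \<le> j" "j < length lam"
  shows "lam ! j \<le> lam ! i"
  using assms sorted_wrt_nth_less[of "(\<ge>)" lam i j] by (cases "i = j") (auto simp: partition_of_def)

text \<open>The rows longer than \<open>j\<close> form an initial segment because the parts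
  decrease, so membership in this segment is comparison with its cardinality, the length of column
  \<open>j\<close>.\<close>

lemma conjugate_diagram:
  assumes lam: "partition_of lam m"
  shows "j < length (conjugate lam) \<and> i < conjugate lam ! j \<longleftrightarrow> i < length lam \<and> j < lam ! i"
proof (cases "j < length (conjugate lam)")
  case True
  let ?R = "{i. i < length lam \<and> j < lam ! i}"
  have c: "conjugate lam ! j = card ?R"
    using True by (simp add: conjugate_def)
  have fin: "finite ?R" by simp
  have down: "i' \<in> ?R" if "i \<in> ?R" "i' \<le> i" for i i'
    using that partition_nth_mono[OF lam that(2)] by auto
  have "?R = {..<card ?R}"
  proof -
    have "i < card ?R" if i: "i \<in> ?R" for i
    proof -
      have "{..i} \<subseteq> ?R" using down[OF i] by auto
      then have "card {..i} \<le> card ?R" by (rule card_mono[OF fin])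
      then show ?thesis by simp
    qed
    then have "?R \<subseteq> {..<card ?R}" by auto
    then show ?thesis by (intro card_subset_eq) auto
  qed
  then have "i \<in> ?R \<longleftrightarrow> i \<in> {..<card ?R}" by (rule arg_cong)
  then show ?thesis using True c by simp
next
  case False
  have "\<not> j < lam ! i" if "i < length lam"
    using partition_nth_mono[OF lam, of 0 i] that False
    by (cases lam) (auto simp: length_conjugate)
  then show ?thesis using False by blast
qed

lemma conjugate_diagramD:
  assumes "partition_of lam m" "j < length (conjugate lam)" "i < conjugate lam ! j"
  shows "i < length lam" "j < lam ! i"
  using conjugate_diagram[OF assms(1), of j i] assms by auto

lemma conjugate_diagramI:
  assumes "partition_of lam m" "i < length lam" "j < lam ! i"
  shows "j < length (conjugate lam)" "i < conjugate lam ! j"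
  using conjugate_diagram[OF assms(1), of j i] assms by auto

text \<open>Both sides count the boxes in the first \<open>k\<close> rows of the diagram, once by
  columns and once by rows.\<close>

lemma sum_min_conjugate:
  assumes lam: "partition_of lam m"
  shows "(\<Sum>j<length (conjugate lam). min k (conjugate lam ! j)) = psum lam k"
proof -
  have "(\<Sum>j<length (conjugate lam). min k (conjugate lam ! j))
      = card (SIGMA j:{..<length (conjugate lam)}. {..<min k (conjugate lam ! j)})"
    by simp
  also have "\<dots> = card (SIGMA i:{..<min k (length lam)}. {..<lam ! i})"
  proof (rule bij_betw_same_card[of prod.swap], rule bij_betw_byWitness[where f' = prod.swap])
  qed (auto dest: conjugate_diagramD[OF lam] conjugate_diagramI[OF lam])
  also have "\<dots> = (\<Sum>i<min k (length lam). lam ! i)" by simp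
  also have "\<dots> = psum lam k"
    by (simp add: sum_list_sum_nth atLeast0LessThan min.commute)
  finally show ?thesis .
qed

lemma sum_list_conjugate:
  assumes lam: "partition_of lam m"
  shows "sum_list (conjugate lam) = m"
proof -
  have "conjugate lam ! j \<le> length lam" if "j < length (conjugate lam)" for j
    using conjugate_diagram[OF lam, of j "length lam"] that by auto
  then have "sum_list (conjugate lam) = (\<Sum>j<length (conjugate lam). min (length lam) (conjugate lam ! j))"
    unfolding sum_list_sum_nth atLeast0LessThan by (intro sum.cong) (auto simp: min.absorb2)
  also have "\<dots> = sum_list lam" using sum_min_conjugate[OF lam, of "length lam"] by simp
  finally show ?thesis using lam by (simp add: partition_of_def)
qed

text \<open>The definite description is justified by an explicit permutation. Uniqueness holds
  because every letter of \<open>{1..m}\<close> occupies a box and all other letters are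
  fixed.\<close>

lemma col_perm:
  assumes lam: "partition_of lam m"
  shows "col_perm m lam \<in> carrier (sym_group m)"
    and "\<lbrakk>i < length lam; j < lam ! i\<rbrakk> \<Longrightarrow> col_perm m lam (row_tableau lam i j) = row_tableau (conjugate lam) j i"
proof -
  let ?P = "\<lambda>w. w \<in> carrier (sym_group m) \<and>
    (\<forall>i < length lam. \<forall>j < lam ! i. w (row_tableau lam i j) = row_tableau (conjugate lam) j i)"
  have m: "sum_list lam = m" using lam by (simp add: partition_of_def)
  note m' = sum_list_conjugate[OF lam]
  \<comment> \<open>The box of \<open>a\<close> has row \<open>blk lam a\<close>; its column,
    counted from 0, is \<open>a\<close> minus the lengths of the earlier rows minus 1, since letters
    start at 1.\<close>
  define w where "w a = (if 1 \<le> a \<and> a \<le> m then row_tableau (conjugate lam) (a - psum lam (blk lam a) - 1) (blk lam a) else a)" for a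
  have wr: "w (row_tableau lam i j) = row_tableau (conjugate lam) j i" if "i < length lam" "j < lam ! i" for i j
    using row_range[OF that] blk_row[OF that] m by (simp add: w_def) (simp add: row_tableau_def)
  have "w permutes {1..m}"
  proof (rule bij_imp_permutes)
    have inj: "inj_on w {1..m}"
    proof (rule inj_onI)
      fix a b assume ab: "a \<in> {1..m}" "b \<in> {1..m}" "w a = w b"
      obtain i j where a: "i < length lam" "j < lam ! i" "a = row_tableau lam i j"
        using row_cover[of a lam] ab m by auto
      obtain i' j' where b: "i' < length lam" "j' < lam ! i'" "b = row_tableau lam i' j'"
        using row_cover[of b lam] ab m by auto
      have "row_tableau (conjugate lam) j i = row_tableau (conjugate lam) j' i'"
        using wr a b ab by simp
      then have "j = j'" "i = i'"
        using row_inj[of j "conjugate lam" i j' i'] conjugate_diagram[OF lam] a b by auto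
      then show "a = b" using a b by simp
    qed
    moreover have "w ` {1..m} \<subseteq> {1..m}"
    proof safe
      fix a assume "a \<in> {1..m}"
      then obtain i j where a: "i < length lam" "j < lam ! i" "a = row_tableau lam i j"
        using row_cover[of a lam] m by auto
      then show "w a \<in> {1..m}"
        using wr row_range[of j "conjugate lam" i] conjugate_diagram[OF lam] m' by auto
    qed
    ultimately show "bij_betw w {1..m} {1..m}"
      by (simp add: bij_betw_def endo_inj_surj)
    show "w a = a" if "a \<notin> {1..m}" for a using that by (auto simp: w_def)
  qed
  then have ex: "?P w" using wr by (simp add: sym_group_carrier)
  have "v = w" if "?P v" for v
  proof
    fix a show "v a = w a"
    proof (cases "1 \<le> a \<and> a \<le> m")
      case True
      then obtain i j where "i < length lam" "j < lam ! i" "a = row_tableau lam i j"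
        using row_cover[of a lam] m by auto
      then show ?thesis using that wr by simp
    next
      case False
      then have "a \<notin> {1..m}" by auto
      then show ?thesis using that ex by (simp add: sym_group_carrier permutes_def)
    qed
  qed
  then have "?P (col_perm m lam)" unfolding col_perm_def using ex by (intro theI[of ?P w]) blast+
  then show "col_perm m lam \<in> carrier (sym_group m)"
    and "\<lbrakk>i < length lam; j < lam ! i\<rbrakk> \<Longrightarrow> col_perm m lam (row_tableau lam i j) = row_tableau (conjugate lam) j i"
    by blast+
qed

lemma col_perm_rows:
  assumes lam: "partition_of lam m" and ab: "1 \<le> a" "a < b" "b \<le> m" and blk: "blk lam a = blk lam b"
  shows "col_perm m lam a < col_perm m lam b"
proof -
  have m: "sum_list lam = m" using lam by (simp add: partition_of_def)
  obtain i j where a: "i < length lam" "j < lam ! i" "a = row_tableau lam i j"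
    using row_cover[of a lam] ab m by auto
  obtain i' j' where b: "i' < length lam" "j' < lam ! i'" "b = row_tableau lam i' j'"
    using row_cover[of b lam] ab m by auto
  have i: "i' = i" using blk blk_row a b by simp
  then have "j < j'" using ab a b by (simp add: row_tableau_def)
  then have "row_tableau (conjugate lam) j i < row_tableau (conjugate lam) j' i"
    using conjugate_diagram[OF lam, of j i] a by (intro row_less) auto
  then show ?thesis using col_perm(2)[OF lam] a b i by simp
qed

text \<open>Two letters sent to the same column sit in different rows of that column, and both
  fillings number a column from top to bottom. With \<open>col_perm_rows\<close> this supplies the
  hypotheses of \<open>nonvanish\<close>.\<close>

lemma col_perm_cols:
  assumes lam: "partition_of lam m" and ab: "1 \<le> a" "a < b" "b \<le> m"
    and blk: "blk (conjugate lam) (col_perm m lam a) = blk (conjugate lam) (col_perm m lam b)"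
  shows "blk lam a < blk lam b" "col_perm m lam a < col_perm m lam b"
proof -
  have m: "sum_list lam = m" using lam by (simp add: partition_of_def)
  obtain i j where a: "i < length lam" "j < lam ! i" "a = row_tableau lam i j"
    using row_cover[of a lam] ab m by auto
  obtain i' j' where b: "i' < length lam" "j' < lam ! i'" "b = row_tableau lam i' j'"
    using row_cover[of b lam] ab m by auto
  have w: "col_perm m lam a = row_tableau (conjugate lam) j i" "col_perm m lam b = row_tableau (conjugate lam) j' i'"
    using col_perm(2)[OF lam] a b by auto
  have j: "j = j'"
    using blk w blk_row[OF conjugate_diagramI[OF lam a(1,2)]] blk_row[OF conjugate_diagramI[OF lam b(1,2)]] by simp
  have "\<not> i' < i" using row_less[of i' i lam j' j] a b ab by auto
  moreover have "i \<noteq> i'" using a b ab j by auto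
  ultimately have "i < i'" by simp
  then show "blk lam a < blk lam b" using blk_row a b by simp
  show "col_perm m lam a < col_perm m lam b" using w j \<open>i < i'\<close> by (simp add: row_tableau_def)
qed

text \<open>The letters in the first \<open>k\<close> rows of \<open>kap\<close> are counted by the
  column of \<open>lam\<close> that receives them. A column receives at most one letter from each of
  the \<open>k\<close> rows and cannot hold more letters than its length. The sum of these minima is
  the partial sum of \<open>lam\<close>.\<close>

lemma dominance_of_no_collision:
  assumes lam: "partition_of lam m" and kap: "partition_of kap m" and w: "w \<in> carrier (sym_group m)"
    and nocoll: "\<And>a b. \<lbrakk>1 \<le> a; a < b; b \<le> m; blk kap a = blk kap b\<rbrakk> \<Longrightarrow>
      blk (conjugate lam) (w a) \<noteq> blk (conjugate lam) (w b)"
  shows "psum kap k \<le> psum lam k"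
proof -
  have mk: "sum_list kap = m" using kap by (simp add: partition_of_def)
  note mc = sum_list_conjugate[OF lam]
  let ?X = "{1..psum kap k}" and ?c = "\<lambda>a. blk (conjugate lam) (w a)" and ?J = "{..<length (conjugate lam)}"
  have km: "psum kap k \<le> m"
    using psum_mono[of k "max k (length kap)" kap] mk by simp
  have cJ: "?c a \<in> ?J" if "a \<in> ?X" for a
  proof -
    have "1 \<le> w a" "w a \<le> m" using sym_range[OF w, of a] that km by auto
    then obtain i j where "i < length (conjugate lam)" "j < conjugate lam ! i" "w a = row_tableau (conjugate lam) i j"
      using row_cover[of "w a" "conjugate lam"] mc by auto
    then show ?thesis using blk_row by simp
  qed
  have bound: "card {a \<in> ?X. ?c a = j} \<le> min k (conjugate lam ! j)" if "j \<in> ?J" for j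
  proof (rule min.boundedI)
    have dk: "blk kap a < k" if aX: "a \<in> ?X" for a
    proof -
      have "a \<le> psum kap (min k (length kap))" using aX by (cases "k \<le> length kap") simp_all
      then obtain i j where "i < min k (length kap)" "j < kap ! i" "a = row_tableau kap i j"
        using row_cover_aux[of a "min k (length kap)" kap] aX by auto
      then show ?thesis using blk_row by simp
    qed
    have "inj_on (blk kap) {a \<in> ?X. ?c a = j}"
    proof (rule inj_onI)
      fix a b assume "a \<in> {a \<in> ?X. ?c a = j}" "b \<in> {a \<in> ?X. ?c a = j}" "blk kap a = blk kap b"
      then show "a = b" using nocoll[of a b] nocoll[of b a] km by (cases a b rule: linorder_cases) auto
    qed
    then have "card {a \<in> ?X. ?c a = j} \<le> card {..<k}"
      by (rule card_inj_on_le) (use dk in auto)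
    then show "card {a \<in> ?X. ?c a = j} \<le> k" by simp
    have "card {a \<in> ?X. ?c a = j} \<le> card (row_tableau (conjugate lam) j ` {..<conjugate lam ! j})"
    proof (rule card_inj_on_le)
      show "inj_on w {a \<in> ?X. ?c a = j}" using sym_inj[OF w] by (rule inj_on_subset) simp
      show "w ` {a \<in> ?X. ?c a = j} \<subseteq> row_tableau (conjugate lam) j ` {..<conjugate lam ! j}"
      proof safe
        fix a assume a: "a \<in> ?X"
        have "1 \<le> w a" "w a \<le> m" using sym_range[OF w, of a] a km by auto
        then obtain i j' where "i < length (conjugate lam)" "j' < conjugate lam ! i" "w a = row_tableau (conjugate lam) i j'"
          using row_cover[of "w a" "conjugate lam"] mc by auto
        then show "w a \<in> row_tableau (conjugate lam) (?c a) ` {..<conjugate lam ! (?c a)}"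
          using blk_row by simp
      qed
    qed simp
    also have "\<dots> \<le> card {..<conjugate lam ! j}" by (rule card_image_le) simp
    finally show "card {a \<in> ?X. ?c a = j} \<le> conjugate lam ! j" by simp
  qed
  have "psum kap k = (\<Sum>a\<in>?X. 1)" by simp
  also have "\<dots> = (\<Sum>j\<in>?J. \<Sum>a\<in>{a \<in> ?X. ?c a = j}. 1)"
    by (rule sum.group[symmetric]) (use cJ in auto)
  also have "\<dots> = (\<Sum>j\<in>?J. card {a \<in> ?X. ?c a = j})" by simp
  also have "\<dots> \<le> (\<Sum>j\<in>?J. min k (conjugate lam ! j))" by (rule sum_mono) (rule bound)
  also have "\<dots> = psum lam k" by (rule sum_min_conjugate[OF lam])
  finally show ?thesis .
qed

lemma partition_psum_Suc_less:
  assumes "partition_of lam m" "i < length lam"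
  shows "psum lam i < psum lam (Suc i)"
proof -
  have "lam ! i \<noteq> 0" using assms nth_mem[of i lam] by (metis partition_of_def)
  then show ?thesis using assms by (simp add: psum_Suc)
qed

text \<open>Parts are nonzero, so partial sums increase strictly up to the length of a list and are
  constant afterwards. Hence equal partial sums detect the length.\<close>

lemma partition_length_le:
  assumes "partition_of lam m" "partition_of kap m" "\<And>k. psum lam k = psum kap k"
  shows "length kap \<le> length lam"
proof (rule ccontr)
  assume "\<not> length kap \<le> length lam"
  then have "psum kap (length lam) < psum kap (Suc (length lam))"
    by (intro partition_psum_Suc_less[OF assms(2)]) simp
  also have "\<dots> = psum lam (Suc (length lam))" by (simp only: assms(3))
  also have "\<dots> = psum lam (length lam)" by simp
  also have "\<dots> = psum kap (length lam)" by (simp only: assms(3))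
  finally show False by simp
qed

lemma partition_eqI:
  assumes "partition_of lam m" "partition_of kap m" "\<And>k. psum lam k = psum kap k"
  shows "lam = kap"
proof (rule nth_equalityI)
  show len: "length lam = length kap"
    using partition_length_le[OF assms] partition_length_le[OF assms(2,1)] assms(3) by simp
  fix i assume i: "i < length lam"
  then show "lam ! i = kap ! i"
    using psum_Suc[of i lam] psum_Suc[of i kap] assms(3)[of i] assms(3)[of "Suc i"] len by simp
qed

text \<open>For \<open>m \<le> 1\<close> there are no adjacent transpositions, so the basis
  \<open>T\<close> does not determine the parameter. These degrees are settled by having a single
  partition.\<close>

lemma partition_small_unique:
  assumes "partition_of lam m" "partition_of kap m" "m \<le> 1"
  shows "lam = kap"
proof -
  have "lam = (if m = 0 then [] else [1])" if "partition_of lam m" for lam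
  proof (cases lam)
    case Nil
    then show ?thesis using that by (simp add: partition_of_def)
  next
    case (Cons x xs)
    then have x: "x \<noteq> 0" "0 \<notin> set xs" "x + sum_list xs = m"
      using that by (auto simp: partition_of_def)
    then have "x = 1" "sum_list xs = 0" "m = 1" using assms(3) by linarith+
    then have "xs = []" using x(2) by (cases xs) auto
    then show ?thesis using Cons \<open>x = 1\<close> \<open>m = 1\<close> by simp
  qed
  then show ?thesis using assms by metis
qed

section \<open>Young modules\<close>

lemma module_homs_inverse:
  assumes M: "left_module R M" and f: "f \<in> module_homs R M N" and bij: "bij_betw f (carrier M) (carrier N)"
  shows "inv_into (carrier M) f \<in> module_homs R N M"
proof -
  interpret M: left_module R M by fact
  let ?g = "inv_into (carrier M) f"
  have g: "?g y \<in> carrier M" "f (?g y) = y" if "y \<in> carrier N" for y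
    using bij that by (auto simp: bij_betw_def inv_into_into f_inv_into_f)
  have gf: "?g (f x) = x" if "x \<in> carrier M" for x
    using bij that by (simp add: bij_betw_inv_into_left)
  show ?thesis
    unfolding module_homs_def
  proof (intro CollectI conjI ballI funcsetI)
    fix x y assume xy: "x \<in> carrier N" "y \<in> carrier N"
    have "f (?g x \<oplus>\<^bsub>M\<^esub> ?g y) = x \<oplus>\<^bsub>N\<^esub> y" using module_homsD(2)[OF f] g xy by simp
    then show "?g (x \<oplus>\<^bsub>N\<^esub> y) = ?g x \<oplus>\<^bsub>M\<^esub> ?g y"
      using gf[of "?g x \<oplus>\<^bsub>M\<^esub> ?g y"] g xy by simp
  next
    fix a x assume ax: "a \<in> carrier R" "x \<in> carrier N"
    have "f (a \<odot>\<^bsub>M\<^esub> ?g x) = a \<odot>\<^bsub>N\<^esub> x" using module_homsD(3)[OF f] g ax by simp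
    then show "?g (a \<odot>\<^bsub>N\<^esub> x) = a \<odot>\<^bsub>M\<^esub> ?g x"
      using gf[of "a \<odot>\<^bsub>M\<^esub> ?g x"] g ax M.smult_closed by simp
  qed (rule g)
qed

lemma module_isomorphic_sym:
  assumes "left_module R M" "module_isomorphic R M N"
  shows "module_isomorphic R N M"
  using assms(2) module_homs_inverse[OF assms(1)] bij_betw_inv_into
  unfolding module_isomorphic_def by blast

lemma (in ring) left_module_regular: "left_module R (regular_module R)"
proof -
  have "abelian_group (regular_module R)"
    by (rule abelian_groupI_comm_group, rule comm_group_cong[OF a_comm_group]) (simp_all add: regular_module_def)
  then show ?thesis
    by (intro left_module.intro left_module_axioms.intro ring_axioms)
      (simp_all add: regular_module_def l_distr r_distr m_assoc)
qed

lemma left_ideal_module_simps [simp]: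
  "carrier (left_ideal_module A e) = {a \<otimes>\<^bsub>A\<^esub> e | a. a \<in> carrier A}"
  "\<zero>\<^bsub>left_ideal_module A e\<^esub> = \<zero>\<^bsub>A\<^esub>"
  "ring.add (left_ideal_module A e) = ring.add A"
  "smult (left_ideal_module A e) = monoid.mult A"
  by (simp_all add: left_ideal_module_def regular_module_def)

lemma (in ring) left_module_left_ideal:
  assumes e: "e \<in> carrier R"
  shows "left_module R (left_ideal_module R e)"
proof -
  interpret reg: left_module R "regular_module R" by (rule left_module_regular)
  have z: "\<ominus>\<^bsub>regular_module R\<^esub> x = \<ominus> x" if "x \<in> carrier R" for x
    using reg.M.minus_equality[of "\<ominus> x" x] that by (simp add: regular_module_def l_neg)
  have "submodule {a \<otimes> e | a. a \<in> carrier R} R (regular_module R)"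
  proof (rule reg.submoduleI', goal_cases)
    case 1
    then show ?case using e by (auto simp: regular_module_def)
  next
    case 2
    then show ?case using e by (auto simp: regular_module_def intro!: exI[of _ \<zero>])
  next
    case (3 x)
    then obtain a where a: "a \<in> carrier R" "x = a \<otimes> e" by blast
    then have "\<ominus>\<^bsub>regular_module R\<^esub> x = \<ominus> a \<otimes> e" using e z by (simp add: l_minus)
    then show ?case using a by blast
  next
    case (4 x y)
    then obtain a b where ab: "a \<in> carrier R" "x = a \<otimes> e" "b \<in> carrier R" "y = b \<otimes> e" by blast
    then have "x \<oplus>\<^bsub>regular_module R\<^esub> y = (a \<oplus> b) \<otimes> e" using e by (simp add: regular_module_def l_distr)
    then show ?case using ab by blast
  next
    case (5 b x)
    then obtain a where a: "a \<in> carrier R" "x = a \<otimes> e" by blast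
    then have "b \<odot>\<^bsub>regular_module R\<^esub> x = (b \<otimes> a) \<otimes> e" using e 5(1) by (simp add: regular_module_def m_assoc)
    then show ?case using a 5(1) by blast
  qed
  then show ?thesis
    unfolding left_ideal_module_def by (rule reg.submodule_left_module)
qed

text \<open>
  Permutation modules in either version have such a generator, and so does every summand that
  contains the Specht submodule.
\<close>

definition young_generator ::
  "'k ring \<Rightarrow> 'k \<Rightarrow> nat \<Rightarrow> ('k, 'b) module \<Rightarrow> ((nat \<Rightarrow> nat) \<Rightarrow> 'b) \<Rightarrow> nat list \<Rightarrow>
    ('b, 'x) module \<Rightarrow> 'x \<Rightarrow> bool"
  where "young_generator K q m B T lam U u \<longleftrightarrow> left_module B U \<and> u \<in> carrier U \<and>
    (\<forall>x\<in>carrier U. \<exists>b\<in>carrier B. x = b \<odot>\<^bsub>U\<^esub> u) \<and>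
    (\<forall>i. 1 \<le> i \<and> i < m \<and> blk lam i = blk lam (Suc i) \<longrightarrow>
      T (adj i) \<odot>\<^bsub>U\<^esub> u = (q \<odot>\<^bsub>B\<^esub> \<one>\<^bsub>B\<^esub>) \<odot>\<^bsub>U\<^esub> u) \<and>
    (y_elt K q m B T (conjugate lam) \<otimes>\<^bsub>B\<^esub> T (col_perm m lam)) \<odot>\<^bsub>U\<^esub> u \<noteq> \<zero>\<^bsub>U\<^esub>"

section \<open>Generators of Young modules over Hecke algebras\<close>

context hecke
begin

lemma x_elt_eq: "partition_of lam m \<Longrightarrow> x_elt m B T lam = xb (blk lam)"
  by (simp add: x_elt_def xb_def young_subgroup_eq partition_of_def)

lemma y_elt_eq: "partition_of lam m \<Longrightarrow> y_elt K q m B T (conjugate lam) = yb (blk (conjugate lam))"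
  by (simp add: y_elt_def yb_def young_subgroup_eq sum_list_conjugate)

lemma specht_elt_closed:
  assumes "partition_of lam m"
  shows "y_elt K q m B T (conjugate lam) \<otimes>\<^bsub>B\<^esub> T (col_perm m lam) \<in> carrier B"
  using col_perm(1)[OF assms] by (simp add: y_elt_eq[OF assms])

text \<open>The column permutation takes rows to columns in increasing order and meets every pair of
  a row and a column at most once, which is the situation of \<open>nonvanish\<close>. It follows
  that the Specht generator in the left ideal of the symmetriser is nonzero.\<close>

lemma specht_elt_nonzero:
  assumes lam: "partition_of lam m"
  shows "y_elt K q m B T (conjugate lam) \<otimes>\<^bsub>B\<^esub> T (col_perm m lam) \<otimes>\<^bsub>B\<^esub> x_elt m B T lam \<noteq> \<zero>\<^bsub>B\<^esub>"
  unfolding y_elt_eq[OF lam] x_elt_eq[OF lam]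
  by (rule nonvanish[OF block_fun_blk block_fun_blk col_perm(1)[OF lam]])
    (use col_perm_rows[OF lam] col_perm_cols[OF lam] in blast)+

text \<open>
  James's argument: a nonzero map on the Specht submodule exhibits a permutation that sends the
  rows of \<open>kap\<close> transversally to the columns of \<open>lam\<close>.
\<close>

lemma young_generator_dominance:
  assumes lam: "partition_of lam m" and kap: "partition_of kap m"
    and u: "young_generator K q m B T lam U u" and u': "young_generator K q m B T kap U' u'"
    and iso: "module_isomorphic B U U'"
  shows "psum kap k \<le> psum lam k"
proof -
  interpret U: left_module B U using u by (simp add: young_generator_def)
  interpret U': left_module B U' using u' by (simp add: young_generator_def)
  let ?y = "y_elt K q m B T (conjugate lam)" and ?t = "T (col_perm m lam)"
  let ?z = "(?y \<otimes>\<^bsub>B\<^esub> ?t) \<odot>\<^bsub>U\<^esub> u"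
  have yt: "?y \<in> carrier B" "?t \<in> carrier B" "?y \<otimes>\<^bsub>B\<^esub> ?t \<in> carrier B"
    using col_perm(1)[OF lam] by (simp_all add: y_elt_eq[OF lam])
  obtain f where f: "f \<in> module_homs B U U'" "bij_betw f (carrier U) (carrier U')"
    using iso by (auto simp: module_isomorphic_def)
  have uU: "u \<in> carrier U" "u' \<in> carrier U'" using u u' by (auto simp: young_generator_def)
  have z: "?z \<in> carrier U" "?z \<noteq> \<zero>\<^bsub>U\<^esub>"
    using yt uU u by (auto simp: young_generator_def intro: U.smult_closed)
  obtain b where b: "b \<in> carrier B" "f u = b \<odot>\<^bsub>U'\<^esub> u'"
    using u' module_homsD(1)[OF f(1) uU(1)] by (auto simp: young_generator_def)
  \<comment> \<open>As \<open>u'\<close> generates \<open>U'\<close>, the image of \<open>u\<close>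
    is a multiple of it. The image of the Specht element thus has the antisymmetriser of
    \<open>lam\<close> on the left and the eigenvector for \<open>kap\<close> on the right.\<close>
  have fz: "f ?z = (?y \<otimes>\<^bsub>B\<^esub> (?t \<otimes>\<^bsub>B\<^esub> b)) \<odot>\<^bsub>U'\<^esub> u'"
    using module_homsD(3)[OF f(1) yt(3) uU(1)] b yt uU by (simp add: m_assoc flip: U'.smult_assoc)
  have "f ?z \<noteq> \<zero>\<^bsub>U'\<^esub>"
  proof
    assume "f ?z = \<zero>\<^bsub>U'\<^esub>"
    moreover have "f \<zero>\<^bsub>U\<^esub> = \<zero>\<^bsub>U'\<^esub>"
      by (rule add_hom_zero_minus(1)[OF U.M.abelian_group_axioms U'.M.abelian_group_axioms add_hom_module_homs[OF f(1)]])
    ultimately show False using f(2) z by (metis U.M.zero_closed bij_betw_inv_into_left)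
  qed
  then have "(yb (blk (conjugate lam)) \<otimes>\<^bsub>B\<^esub> (?t \<otimes>\<^bsub>B\<^esub> b)) \<odot>\<^bsub>U'\<^esub> u' \<noteq> \<zero>\<^bsub>U'\<^esub>"
    using fz y_elt_eq[OF lam] by metis
  then have "\<not> (\<forall>w\<in>S. \<exists>a b. 1 \<le> a \<and> a < b \<and> b \<le> m \<and> blk kap a = blk kap b \<and>
      blk (conjugate lam) (w a) = blk (conjugate lam) (w b))"
    using vanish[OF U'.left_module uU(2) block_fun_blk block_fun_blk, of kap "conjugate lam" "?t \<otimes>\<^bsub>B\<^esub> b"]
      u' b yt unfolding young_generator_def by blast
  then obtain w where "w \<in> S" "\<And>a b. \<lbrakk>1 \<le> a; a < b; b \<le> m; blk kap a = blk kap b\<rbrakk> \<Longrightarrow>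
      blk (conjugate lam) (w a) \<noteq> blk (conjugate lam) (w b)"
    by blast
  then show ?thesis by (rule dominance_of_no_collision[OF lam kap])
qed

lemma young_generator_eq:
  assumes "partition_of lam m" "partition_of kap m"
    and u: "young_generator K q m B T lam U u" and "young_generator K q m B T kap U' u'"
    and iso: "module_isomorphic B U U'"
  shows "lam = kap"
proof -
  have "left_module B U" using u by (simp add: young_generator_def)
  then have "module_isomorphic B U' U" using iso by (rule module_isomorphic_sym)
  then show ?thesis
    by (intro partition_eqI[OF assms(1,2)] antisym
        young_generator_dominance[OF assms(2,1,4) u] young_generator_dominance[OF assms(1,2) u assms(4) iso])
qed

lemma young_generator_hecke_perm_module:
  assumes lam: "partition_of lam m"
  shows "young_generator K q m B T lam (hecke_perm_module m B T lam) (x_elt m B T lam)"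
  unfolding young_generator_def hecke_perm_module_def
proof (intro conjI)
  have x: "x_elt m B T lam \<in> carrier B" by (simp add: x_elt_eq[OF lam])
  then show "left_module B (left_ideal_module B (x_elt m B T lam))"
    by (rule left_module_left_ideal)
  show "x_elt m B T lam \<in> carrier (left_ideal_module B (x_elt m B T lam))"
    using x by (force intro!: exI[of _ "\<one>\<^bsub>B\<^esub>"])
  show "\<forall>i. 1 \<le> i \<and> i < m \<and> blk lam i = blk lam (Suc i) \<longrightarrow>
      T (adj i) \<odot>\<^bsub>left_ideal_module B (x_elt m B T lam)\<^esub> x_elt m B T lam =
      (q \<odot>\<^bsub>B\<^esub> \<one>\<^bsub>B\<^esub>) \<odot>\<^bsub>left_ideal_module B (x_elt m B T lam)\<^esub> x_elt m B T lam"
    using x by (simp add: T_xb x_elt_eq[OF lam] scal_left)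
  show "(y_elt K q m B T (conjugate lam) \<otimes>\<^bsub>B\<^esub> T (col_perm m lam)) \<odot>\<^bsub>left_ideal_module B (x_elt m B T lam)\<^esub>
      x_elt m B T lam \<noteq> \<zero>\<^bsub>left_ideal_module B (x_elt m B T lam)\<^esub>"
    using specht_elt_nonzero[OF lam] by simp
qed auto

text \<open>The new generator is the image of \<open>g\<close> under the projection onto the summand
  followed by the isomorphism to \<open>U\<close>. The Specht element survives because it lies in
  the summand, where the projection is the identity.\<close>

lemma young_generator_summand:
  assumes lam: "partition_of lam m" and g: "young_generator K q m B T lam M g"
    and U: "isomorphic_to_summand_containing B M (specht_in K q m B T lam M g) U"
  obtains u where "young_generator K q m B T lam U u"
proof -
  interpret M: left_module B M using g by (simp add: young_generator_def)
  interpret U: left_module B U using U by (simp add: isomorphic_to_summand_containing_def)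
  let ?yt = "y_elt K q m B T (conjugate lam) \<otimes>\<^bsub>B\<^esub> T (col_perm m lam)"
  have yt: "?yt \<in> carrier B" by (rule specht_elt_closed[OF lam])
  have gM: "g \<in> carrier M" using g by (simp add: young_generator_def)
  obtain N N' f where N: "complementary B M N N'" "specht_in K q m B T lam M g \<subseteq> N"
    and f: "f \<in> module_homs B U (M\<lparr>carrier := N\<rparr>)" "bij_betw f (carrier U) (carrier (M\<lparr>carrier := N\<rparr>))"
    using U unfolding isomorphic_to_summand_containing_def direct_summand_def module_isomorphic_def by blast
  have NM: "N \<subseteq> carrier M" using N(1) M.submoduleD(1) by (simp add: complementary_def)
  obtain p where p: "p \<in> module_homs B M (M\<lparr>carrier := N\<rparr>)" "\<And>x. x \<in> N \<Longrightarrow> p x = x"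
    using M.complementary_projection[OF N(1)] by blast
  define h where "h = inv_into (carrier U) f"
  have h: "h \<in> module_homs B (M\<lparr>carrier := N\<rparr>) U"
    unfolding h_def by (rule module_homs_inverse[OF U.left_module f])
  define \<theta> where "\<theta> x = h (p x)" for x
  have \<theta>: "\<theta> x \<in> carrier U" if "x \<in> carrier M" for x
    unfolding \<theta>_def using module_homsD(1)[OF h] module_homsD(1)[OF p(1)] that by blast
  have \<theta>s: "\<theta> (b \<odot>\<^bsub>M\<^esub> x) = b \<odot>\<^bsub>U\<^esub> \<theta> x" if "b \<in> carrier B" "x \<in> carrier M" for b x
    unfolding \<theta>_def using module_homsD(3)[OF p(1) that] module_homsD(3)[OF h that(1) module_homsD(1)[OF p(1) that(2)]] by simp
  have "young_generator K q m B T lam U (\<theta> g)"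
    unfolding young_generator_def
  proof (intro conjI ballI allI impI)
    fix x assume x: "x \<in> carrier U"
    then have fx: "f x \<in> N" using module_homsD(1)[OF f(1)] by fastforce
    then have "f x \<in> carrier M" using NM by blast
    then obtain b where b: "b \<in> carrier B" "f x = b \<odot>\<^bsub>M\<^esub> g"
      using g by (auto simp: young_generator_def)
    have "x = h (f x)" unfolding h_def using f(2) x by (simp add: bij_betw_inv_into_left)
    also have "\<dots> = \<theta> (f x)" unfolding \<theta>_def using p(2)[OF fx] by simp
    also have "\<dots> = b \<odot>\<^bsub>U\<^esub> \<theta> g" unfolding b(2) by (rule \<theta>s[OF b(1) gM])
    finally show "\<exists>b\<in>carrier B. x = b \<odot>\<^bsub>U\<^esub> \<theta> g" using b by blast
  next
    fix i assume i: "1 \<le> i \<and> i < m \<and> blk lam i = blk lam (Suc i)"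
    then have "T (adj i) \<odot>\<^bsub>M\<^esub> g = (q \<odot>\<^bsub>B\<^esub> \<one>\<^bsub>B\<^esub>) \<odot>\<^bsub>M\<^esub> g"
      using g by (simp add: young_generator_def)
    then show "T (adj i) \<odot>\<^bsub>U\<^esub> \<theta> g = (q \<odot>\<^bsub>B\<^esub> \<one>\<^bsub>B\<^esub>) \<odot>\<^bsub>U\<^esub> \<theta> g"
      using \<theta>s[of "T (adj i)" g] \<theta>s[of "q \<odot>\<^bsub>B\<^esub> \<one>\<^bsub>B\<^esub>" g] gM adj_in_sym i by simp
  next
    \<comment> \<open>Taking the coefficient \<open>b\<close> to be the unit shows that the Specht
      submodule contains its own generator.\<close>
    have "\<one>\<^bsub>B\<^esub> \<otimes>\<^bsub>B\<^esub> y_elt K q m B T (conjugate lam) = y_elt K q m B T (conjugate lam)"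
      by (simp add: y_elt_eq[OF lam])
    moreover have "(\<one>\<^bsub>B\<^esub> \<otimes>\<^bsub>B\<^esub> y_elt K q m B T (conjugate lam) \<otimes>\<^bsub>B\<^esub> T (col_perm m lam)) \<odot>\<^bsub>M\<^esub> g
        \<in> specht_in K q m B T lam M g"
      unfolding specht_in_def using one_closed by blast
    ultimately have z: "?yt \<odot>\<^bsub>M\<^esub> g \<in> N"
      using N(2) by auto
    have z0: "?yt \<odot>\<^bsub>M\<^esub> g \<noteq> \<zero>\<^bsub>M\<^esub>" using g by (simp add: young_generator_def)
    have "\<theta> (?yt \<odot>\<^bsub>M\<^esub> g) = h (?yt \<odot>\<^bsub>M\<^esub> g)" unfolding \<theta>_def using p(2)[OF z] by simp
    moreover have "h (?yt \<odot>\<^bsub>M\<^esub> g) \<noteq> \<zero>\<^bsub>U\<^esub>"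
    proof
      assume h0: "h (?yt \<odot>\<^bsub>M\<^esub> g) = \<zero>\<^bsub>U\<^esub>"
      interpret MN: left_module B "M\<lparr>carrier := N\<rparr>"
        using N(1) M.submodule_left_module by (simp add: complementary_def)
      have "f \<zero>\<^bsub>U\<^esub> = \<zero>\<^bsub>M\<^esub>"
        using add_hom_zero_minus(1)[OF U.M.abelian_group_axioms MN.M.abelian_group_axioms add_hom_module_homs[OF f(1)]] by simp
      moreover have "f (h (?yt \<odot>\<^bsub>M\<^esub> g)) = ?yt \<odot>\<^bsub>M\<^esub> g"
        unfolding h_def using f(2) z by (simp add: bij_betw_inv_into_right)
      ultimately show False using h0 z0 by simp
    qed
    ultimately show "?yt \<odot>\<^bsub>U\<^esub> \<theta> g \<noteq> \<zero>\<^bsub>U\<^esub>" using \<theta>s[OF yt gM] by simp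
  qed (use \<theta> gM U.left_module in simp_all)
  then show ?thesis by (rule that)
qed

end

text \<open>For \<open>q = 1\<close> the summand with coefficient \<open>q - 1\<close> disappears,
  and both branches of the Hecke relation become the multiplicativity of \<open>T\<close>.\<close>

lemma hecke_of_group_algebra:
  assumes gb: "group_algebra_basis K m B T"
  shows "hecke K \<one>\<^bsub>K\<^esub> m B T"
proof -
  interpret k_alg K B using gb by unfold_locales (simp add: group_algebra_basis_def)
  let ?S = "carrier (sym_group m)"
  have basis: "finite_basis K B ?S T" and Tm: "\<And>v w. \<lbrakk>v \<in> ?S; w \<in> ?S\<rbrakk> \<Longrightarrow> T (v \<circ> w) = T v \<otimes>\<^bsub>B\<^esub> T w"
    using gb by (auto simp: group_algebra_basis_def hom_def sym_group_mult)
  have T: "\<And>w. w \<in> ?S \<Longrightarrow> T w \<in> carrier B" using basis by (auto simp: finite_basis_def)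
  \<comment> \<open>A homomorphism in the sense of \<open>hom\<close> need not be known to preserve
    units. Here \<open>T id\<close> is a left identity on the basis, hence on all of
    \<open>B\<close>, and so it is the unit.\<close>
  define t where "t = T id"
  have t: "t \<in> carrier B" "\<And>w. w \<in> ?S \<Longrightarrow> t \<otimes>\<^bsub>B\<^esub> T w = T w"
    unfolding t_def using T[OF sym_id] Tm[OF sym_id] by (simp_all only: id_comp)
  have "t \<otimes>\<^bsub>B\<^esub> x = x" if "x \<in> carrier B" for x
    by (rule basis_induct[OF basis that]) (simp_all add: t T r_distr scal_right)
  from this[of "\<one>\<^bsub>B\<^esub>"] have id: "T id = \<one>\<^bsub>B\<^esub>" using t(1) by (simp only: t_def one_closed r_one)
  have "hecke_algebra_basis K \<one>\<^bsub>K\<^esub> m B T"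
    unfolding hecke_algebra_basis_def Let_def
  proof (intro conjI ballI)
    fix w i assume w: "w \<in> ?S" and i: "i \<in> {1..<m}"
    then have s: "adj i \<in> ?S" by (intro adj_in_sym) auto
    then have "T (adj i \<circ> w) \<in> carrier B" using T sym_comp w by blast
    then show "T (adj i) \<otimes>\<^bsub>B\<^esub> T w =
        (if perm_length m w < perm_length m (adj i \<circ> w) then T (adj i \<circ> w)
         else \<one>\<^bsub>K\<^esub> \<odot>\<^bsub>B\<^esub> T (adj i \<circ> w) \<oplus>\<^bsub>B\<^esub> (\<one>\<^bsub>K\<^esub> \<ominus>\<^bsub>K\<^esub> \<one>\<^bsub>K\<^esub>) \<odot>\<^bsub>B\<^esub> T w)"
      using Tm[OF s w] T[OF w] by (simp add: a_minus_def K.r_neg)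
  qed (use k_algebra basis id in simp_all)
  then show ?thesis by (simp add: hecke_def)
qed

text \<open>The square of \<open>T (adj 1)\<close> is \<open>T id\<close> in a group algebra and is
  given by the quadratic relation in a Hecke algebra; the coefficients of \<open>T id\<close> are 1
  and \<open>q\<close>. The bound on \<open>m\<close> ensures that a generator exists.\<close>

lemma group_and_hecke_parameter:
  assumes gb: "group_algebra_basis K m B T" and h: "hecke K q m B T" and m: "2 \<le> m"
  shows "q = \<one>\<^bsub>K\<^esub>"
proof -
  interpret hecke K q m B T by fact
  have s: "adj 1 \<in> S" using m by (intro adj_in_sym) auto
  have ne: "adj 1 \<noteq> id" by (metis id_apply n_not_Suc_n transpose_apply_first)
  obtain f where f: "add_hom B K f" "\<And>a x. \<lbrakk>a \<in> carrier K; x \<in> carrier B\<rbrakk> \<Longrightarrow> f (a \<odot>\<^bsub>B\<^esub> x) = a \<otimes>\<^bsub>K\<^esub> f x"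
    "\<And>j. j \<in> S \<Longrightarrow> f (T j) = (if j = id then \<one>\<^bsub>K\<^esub> else \<zero>\<^bsub>K\<^esub>)"
    using finite_basis_dual[OF V.module_axioms basis sym_id] by blast
  have "\<And>v w. \<lbrakk>v \<in> S; w \<in> S\<rbrakk> \<Longrightarrow> T v \<otimes>\<^bsub>B\<^esub> T w = T (v \<circ> w)"
    using gb by (auto simp: group_algebra_basis_def hom_def sym_group_mult)
  then have "T (adj 1) \<otimes>\<^bsub>B\<^esub> T (adj 1) = T (adj 1 \<circ> adj 1)" using s by blast
  then have "T id = q \<odot>\<^bsub>B\<^esub> T id \<oplus>\<^bsub>B\<^esub> (q \<ominus>\<^bsub>K\<^esub> \<one>\<^bsub>K\<^esub>) \<odot>\<^bsub>B\<^esub> T (adj 1)"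
    using T_sq[of 1] m unfolding adj_adj T_id by simp
  then have "f (T id) = q \<otimes>\<^bsub>K\<^esub> f (T id) \<oplus>\<^bsub>K\<^esub> (q \<ominus>\<^bsub>K\<^esub> \<one>\<^bsub>K\<^esub>) \<otimes>\<^bsub>K\<^esub> f (T (adj 1))"
    using add_homD(2)[OF f(1), of "q \<odot>\<^bsub>B\<^esub> T id" "(q \<ominus>\<^bsub>K\<^esub> \<one>\<^bsub>K\<^esub>) \<odot>\<^bsub>B\<^esub> T (adj 1)"]
      T_closed[OF s] T_closed[OF sym_id] f(2) by simp
  then show ?thesis using f(3)[OF sym_id] f(3)[OF s] ne by simp
qed

section \<open>Permutation modules of group algebras\<close>

locale group_algebra =
  fixes K :: "'k ring" and m :: nat and B :: "('k, 'b) module" and T :: "(nat \<Rightarrow> nat) \<Rightarrow> 'b"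
    and lam :: "nat list"
  assumes group_basis: "group_algebra_basis K m B T" and lam: "partition_of lam m"
begin

sublocale hecke K "\<one>\<^bsub>K\<^esub>" m B T
  by (rule hecke_of_group_algebra[OF group_basis])

abbreviation "Y \<equiv> young_subgroup m lam"
abbreviation "aug \<equiv> augmentation K m B T"
abbreviation "xl \<equiv> x_elt m B T lam"

lemma YS: "w \<in> Y \<Longrightarrow> w \<in> S"
  by (simp add: young_subgroup_def)

lemma finite_Y: "finite Y"
  by (rule finite_subset[OF _ finite_sym[of m]]) (auto simp: YS)

lemma xl_closed: "xl \<in> carrier B"
  by (simp add: x_elt_eq[OF lam])

text \<open>Coefficients in a basis are unique, so the definite description of the augmentation has
  exactly one candidate.\<close>

lemma aug_eq:
  assumes c: "c \<in> S \<rightarrow> carrier K"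
  shows "aug (lin_comb B S T c) = (\<Oplus>\<^bsub>K\<^esub>w\<in>S. c w)"
  unfolding augmentation_def
proof (rule the_equality)
  show "\<exists>d\<in>S \<rightarrow> carrier K. lin_comb B S T c = lin_comb B S T d \<and> (\<Oplus>\<^bsub>K\<^esub>w\<in>S. c w) = (\<Oplus>\<^bsub>K\<^esub>w\<in>S. d w)"
    using c by blast
next
  fix e assume "\<exists>d\<in>S \<rightarrow> carrier K. lin_comb B S T c = lin_comb B S T d \<and> e = (\<Oplus>\<^bsub>K\<^esub>w\<in>S. d w)"
  then obtain d where d: "d \<in> S \<rightarrow> carrier K" "lin_comb B S T c = lin_comb B S T d" "e = (\<Oplus>\<^bsub>K\<^esub>w\<in>S. d w)"
    by blast
  have "d w = c w" if "w \<in> S" for w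
    by (rule finite_basis_unique[OF V.module_axioms basis d(1) c d(2)[symmetric] that])
  then show "e = (\<Oplus>\<^bsub>K\<^esub>w\<in>S. c w)" unfolding d(3) using c by (intro K.finsum_cong') auto
qed

lemma aug_young:
  assumes c: "c \<in> Y \<rightarrow> carrier K"
  shows "aug (lin_comb B Y T c) = (\<Oplus>\<^bsub>K\<^esub>w\<in>Y. c w)"
proof -
  let ?c = "\<lambda>w. if w \<in> Y then c w else \<zero>\<^bsub>K\<^esub>"
  have cK: "?c \<in> S \<rightarrow> carrier K" "\<And>w. w \<in> Y \<Longrightarrow> c w \<in> carrier K" using c by auto
  have "lin_comb B Y T c = lin_comb B S T ?c"
    unfolding lin_comb_def using finite_sym[of m] YS cK
    by (intro add.finprod_mono_neutral_cong_left) auto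
  moreover have "(\<Oplus>\<^bsub>K\<^esub>w\<in>Y. c w) = (\<Oplus>\<^bsub>K\<^esub>w\<in>S. ?c w)"
    using finite_sym[of m] YS cK by (intro K.add.finprod_mono_neutral_cong_left) auto
  ultimately show ?thesis using aug_eq[OF cK(1)] by simp
qed

lemma monomial_young:
  assumes a: "a \<in> carrier K" and w: "w \<in> Y"
  shows "a \<odot>\<^bsub>B\<^esub> T w = lin_comb B Y T (\<lambda>v. if w = v then a else \<zero>\<^bsub>K\<^esub>)"
proof -
  have "lin_comb B Y T (\<lambda>v. if w = v then a else \<zero>\<^bsub>K\<^esub>) = (\<Oplus>\<^bsub>B\<^esub>v\<in>Y. if w = v then a \<odot>\<^bsub>B\<^esub> T v else \<zero>\<^bsub>B\<^esub>)"
    unfolding lin_comb_def using a YS by (intro finsum_cong') auto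
  also have "\<dots> = a \<odot>\<^bsub>B\<^esub> T w"
    using a w YS finite_Y by (intro add.finprod_singleton) auto
  finally show ?thesis by simp
qed

lemma aug_monomial:
  assumes a: "a \<in> carrier K" and w: "w \<in> Y"
  shows "aug (a \<odot>\<^bsub>B\<^esub> T w) = a" "a \<odot>\<^bsub>B\<^esub> T w \<in> lin_span K B Y T"
proof -
  have "aug (a \<odot>\<^bsub>B\<^esub> T w) = (\<Oplus>\<^bsub>K\<^esub>v\<in>Y. if w = v then a else \<zero>\<^bsub>K\<^esub>)"
    unfolding monomial_young[OF a w] using a by (intro aug_young) auto
  also have "\<dots> = a" using a w finite_Y by (intro K.add.finprod_singleton) auto
  finally show "aug (a \<odot>\<^bsub>B\<^esub> T w) = a" .
  show "a \<odot>\<^bsub>B\<^esub> T w \<in> lin_span K B Y T"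
    unfolding monomial_young[OF a w] lin_span_def
    by (rule CollectI, intro exI conjI, rule refl) (use a in auto)
qed

lemma T_xl: "w \<in> Y \<Longrightarrow> T w \<otimes>\<^bsub>B\<^esub> xl = xl"
proof -
  assume "w \<in> Y"
  then have "w \<in> block_stab m (blk lam)" using lam by (simp add: young_subgroup_eq partition_of_def)
  from block_fun_blk this show ?thesis
  proof (induction rule: block_length_induct_left)
    case id
    then show ?case using xl_closed by (simp only: T_id l_one)
  next
    case (left w i)
    have s: "adj i \<in> S" using adj_in_sym left by blast
    have "T (adj i \<circ> w) = T (adj i) \<otimes>\<^bsub>B\<^esub> T w"
      using T_left_up[OF block_stab_sym[OF left(1)] left(2,3,5)] by simp
    then have "T (adj i \<circ> w) \<otimes>\<^bsub>B\<^esub> xl = T (adj i) \<otimes>\<^bsub>B\<^esub> xl"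
      using left s xl_closed block_stab_sym[OF left(1)] by (simp add: m_assoc)
    moreover have "T (adj i) \<otimes>\<^bsub>B\<^esub> xl = xl"
      using T_xb[OF left(2-4)] x_elt_eq[OF lam] xl_closed by simp
    ultimately show ?case by (simp only:)
  qed
qed

text \<open>The basis elements of the Young subgroup fix the symmetriser, so its span acts there
  through the augmentation. This will be the balance condition for mapping the induced module to the
  left ideal generated by \<open>xl\<close>.\<close>

lemma span_young:
  assumes d: "d \<in> lin_span K B Y T"
  shows "d \<in> carrier B" "aug d \<in> carrier K" "d \<otimes>\<^bsub>B\<^esub> xl = aug d \<odot>\<^bsub>B\<^esub> xl"
proof -
  obtain c where c: "c \<in> Y \<rightarrow> carrier K" "d = lin_comb B Y T c"
    using d by (auto simp: lin_span_def)
  have cK: "\<And>w. w \<in> Y \<Longrightarrow> c w \<in> carrier K" using c by auto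
  have TY: "\<And>w. w \<in> Y \<Longrightarrow> T w \<in> carrier B" using YS by simp
  show "d \<in> carrier B" unfolding c(2) lin_comb_def using cK TY by (intro finsum_closed) auto
  have a: "aug d = (\<Oplus>\<^bsub>K\<^esub>w\<in>Y. c w)" unfolding c(2) by (rule aug_young[OF c(1)])
  show "aug d \<in> carrier K" unfolding a using c(1) by (rule K.finsum_closed)
  have "d \<otimes>\<^bsub>B\<^esub> xl = (\<Oplus>\<^bsub>B\<^esub>w\<in>Y. (c w \<odot>\<^bsub>B\<^esub> T w) \<otimes>\<^bsub>B\<^esub> xl)"
    unfolding c(2) lin_comb_def using cK TY xl_closed finite_Y by (intro finsum_ldistr) auto
  also have "\<dots> = (\<Oplus>\<^bsub>B\<^esub>w\<in>Y. c w \<odot>\<^bsub>B\<^esub> xl)"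
    using cK TY xl_closed T_xl by (intro finsum_cong') (auto simp: scal_left)
  also have "\<dots> = (\<Oplus>\<^bsub>K\<^esub>w\<in>Y. c w) \<odot>\<^bsub>B\<^esub> xl"
    using xl_closed c(1)
    by (intro add_hom_finsum[OF K.abelian_group_axioms abelian_group_axioms _ finite_Y, symmetric])
      (auto simp: add_hom_def V.smult_l_distr)
  finally show "d \<otimes>\<^bsub>B\<^esub> xl = aug d \<odot>\<^bsub>B\<^esub> xl" unfolding a .
qed

abbreviation "triv \<equiv> trivial_module K m B T"

lemma triv_simps:
  "carrier triv = carrier K" "ring.add triv = ring.add K" "\<zero>\<^bsub>triv\<^esub> = \<zero>\<^bsub>K\<^esub>"
  "b \<odot>\<^bsub>triv\<^esub> c = aug b \<otimes>\<^bsub>K\<^esub> c"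
  by (simp_all add: trivial_module_def restrict_scalars_def regular_module_def)

lemma regular_simps:
  "carrier (regular_module B) = carrier B" "ring.add (regular_module B) = ring.add B"
  "\<zero>\<^bsub>regular_module B\<^esub> = \<zero>\<^bsub>B\<^esub>" "b \<odot>\<^bsub>regular_module B\<^esub> c = b \<otimes>\<^bsub>B\<^esub> c"
  by (simp_all add: regular_module_def)

sublocale reg: left_module B "regular_module B"
  by (rule left_module_regular)

sublocale bal: balanced_pair "young_subalgebra K m B T lam" "regular_module B" "monoid.mult B" triv
proof (intro balanced_pair.intro balanced_pair_axioms.intro reg.M.abelian_group_axioms)
  show "abelian_group triv"
    by (rule abelian_groupI_comm_group, rule comm_group_cong[OF K.a_comm_group]) (simp_all add: triv_simps)
qed (auto simp: young_subalgebra_def regular_simps triv_simps span_young)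

lemma left_module_perm: "left_module B (group_perm_module K m B T lam)"
  unfolding group_perm_module_def
  by (rule bal.left_module_TP[OF reg.left_module])
    (simp add: regular_simps young_subalgebra_def span_young m_assoc)

lemma smult_perm:
  "\<lbrakk>b \<in> carrier B; p \<in> carrier B; c \<in> carrier K\<rbrakk> \<Longrightarrow>
    b \<odot>\<^bsub>group_perm_module K m B T lam\<^esub> bal.pure p c = bal.pure (b \<otimes>\<^bsub>B\<^esub> p) c"
  unfolding group_perm_module_def
  by (subst bal.smult_pure[OF reg.left_module])
    (simp_all add: regular_simps triv_simps young_subalgebra_def span_young m_assoc)

lemma pure_monomial:
  assumes "a \<in> carrier K" "w \<in> Y" "p \<in> carrier B"
  shows "bal.pure (p \<otimes>\<^bsub>B\<^esub> (a \<odot>\<^bsub>B\<^esub> T w)) \<one>\<^bsub>K\<^esub> = bal.pure p a"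
  using bal.pure_balanced[of p "a \<odot>\<^bsub>B\<^esub> T w" "\<one>\<^bsub>K\<^esub>"] assms aug_monomial[OF assms(1,2)]
  by (simp add: regular_simps triv_simps young_subalgebra_def)

lemma id_Y: "id \<in> Y"
  using block_stab_id[of m "blk lam"] lam by (simp only: young_subgroup_eq partition_of_def)

text \<open>That the Specht element does not kill the generator is tested in \<open>B\<close>: the
  tensor of \<open>p\<close> and \<open>c\<close> is sent to \<open>c p xl\<close>, and the image of
  the Specht element is the product covered by \<open>specht_elt_nonzero\<close>.\<close>

lemma young_generator_group_perm_module:
  "young_generator K \<one>\<^bsub>K\<^esub> m B T lam (group_perm_module K m B T lam) (group_perm_gen K m B T lam)"
proof -
  interpret M: left_module B "group_perm_module K m B T lam" by (rule left_module_perm)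
  let ?M = "group_perm_module K m B T lam" and ?g = "bal.pure \<one>\<^bsub>B\<^esub> \<one>\<^bsub>K\<^esub>"
  have g: "group_perm_gen K m B T lam = ?g" by (simp add: group_perm_gen_def)
  have M: "?M = bal.TP" by (simp add: group_perm_module_def)
  have gM: "?g \<in> carrier ?M" unfolding M by (rule bal.pure_closed) (simp_all add: regular_simps triv_simps)
  have bg: "b \<odot>\<^bsub>?M\<^esub> ?g = bal.pure b \<one>\<^bsub>K\<^esub>" if "b \<in> carrier B" for b
    using smult_perm[OF that one_closed K.one_closed] that by simp
  \<comment> \<open>A scalar in the second slot is the action of \<open>c T id\<close> on 1 and can
    be moved to the first slot, so every pure tensor is a multiple of the tensor of the two
    units.\<close>
  have gen: "\<exists>b\<in>carrier B. t = b \<odot>\<^bsub>?M\<^esub> ?g" if "t \<in> carrier ?M" for t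
    using that unfolding M
  proof (induction rule: bal.tensor_induct)
    case zero
    then show ?case using M.smult_l_zero[OF gM] zero_closed unfolding M by metis
  next
    case (pure p c)
    then have pc: "p \<in> carrier B" "c \<in> carrier K" by (simp_all add: regular_simps triv_simps)
    then have "p \<otimes>\<^bsub>B\<^esub> (c \<odot>\<^bsub>B\<^esub> T id) \<in> carrier B" using T_closed[OF sym_id] by simp
    then show ?case using bg pure_monomial[OF pc(2) id_Y pc(1)] unfolding M by metis
  next
    case (diff t s)
    then show ?case using M.smult_l_diff[OF gM] minus_closed unfolding M by metis
  qed
  obtain h where h: "add_hom bal.TP B h"
    "\<And>p c. \<lbrakk>p \<in> carrier B; c \<in> carrier K\<rbrakk> \<Longrightarrow> h (bal.pure p c) = (c \<odot>\<^bsub>B\<^esub> p) \<otimes>\<^bsub>B\<^esub> xl"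
  proof -
    have "\<exists>h. add_hom bal.TP B h \<and> (\<forall>p\<in>carrier (regular_module B). \<forall>c\<in>carrier triv. h (bal.pure p c) = (c \<odot>\<^bsub>B\<^esub> p) \<otimes>\<^bsub>B\<^esub> xl)"
    proof (rule bal.tensor_universal[of B "\<lambda>p c. (c \<odot>\<^bsub>B\<^esub> p) \<otimes>\<^bsub>B\<^esub> xl"])
      fix p c assume "p \<in> carrier (regular_module B)" "c \<in> carrier triv"
      then show "(c \<odot>\<^bsub>B\<^esub> p) \<otimes>\<^bsub>B\<^esub> xl \<in> carrier B" using xl_closed by (simp add: regular_simps triv_simps)
    next
      fix p d c assume pdc: "p \<in> carrier (regular_module B)" "d \<in> carrier (young_subalgebra K m B T lam)" "c \<in> carrier triv"
      then have pc: "p \<in> carrier B" "c \<in> carrier K" and d: "d \<in> lin_span K B Y T"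
        by (simp_all add: regular_simps triv_simps young_subalgebra_def)
      have "(c \<odot>\<^bsub>B\<^esub> (p \<otimes>\<^bsub>B\<^esub> d)) \<otimes>\<^bsub>B\<^esub> xl = c \<odot>\<^bsub>B\<^esub> (p \<otimes>\<^bsub>B\<^esub> (d \<otimes>\<^bsub>B\<^esub> xl))"
        using pc span_young[OF d] xl_closed by (simp add: scal_left m_assoc del: span_young(3))
      also have "\<dots> = ((aug d \<otimes>\<^bsub>K\<^esub> c) \<odot>\<^bsub>B\<^esub> p) \<otimes>\<^bsub>B\<^esub> xl"
        using pc span_young[OF d] xl_closed by (simp add: scal_left scal_right V.smult_assoc1 scal_comm[of c "aug d"])
      finally show "(c \<odot>\<^bsub>B\<^esub> (p \<otimes>\<^bsub>B\<^esub> d)) \<otimes>\<^bsub>B\<^esub> xl = ((d \<odot>\<^bsub>triv\<^esub> c) \<odot>\<^bsub>B\<^esub> p) \<otimes>\<^bsub>B\<^esub> xl"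
        by (simp add: triv_simps)
    qed (use xl_closed abelian_group_axioms in
        \<open>auto simp: regular_simps triv_simps V.smult_r_distr V.smult_l_distr l_distr\<close>)
    then show ?thesis using that by (auto simp: regular_simps triv_simps)
  qed
  let ?yt = "y_elt K \<one>\<^bsub>K\<^esub> m B T (conjugate lam) \<otimes>\<^bsub>B\<^esub> T (col_perm m lam)"
  have yt: "?yt \<in> carrier B" by (rule specht_elt_closed[OF lam])
  have "h (?yt \<odot>\<^bsub>?M\<^esub> ?g) = ?yt \<otimes>\<^bsub>B\<^esub> xl"
    using bg[OF yt] h(2)[OF yt K.one_closed] yt by simp
  then have "h (?yt \<odot>\<^bsub>?M\<^esub> ?g) \<noteq> \<zero>\<^bsub>B\<^esub>" using specht_elt_nonzero[OF lam] by simp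
  moreover have "h \<zero>\<^bsub>?M\<^esub> = \<zero>\<^bsub>B\<^esub>"
    unfolding M by (rule add_hom_zero_minus(1)[OF bal.abelian_group_TP abelian_group_axioms h(1)])
  ultimately have "?yt \<odot>\<^bsub>?M\<^esub> ?g \<noteq> \<zero>\<^bsub>?M\<^esub>" by metis
  moreover have "T (adj i) \<odot>\<^bsub>?M\<^esub> ?g = (\<one>\<^bsub>K\<^esub> \<odot>\<^bsub>B\<^esub> \<one>\<^bsub>B\<^esub>) \<odot>\<^bsub>?M\<^esub> ?g"
    if i: "1 \<le> i" "i < m" "blk lam i = blk lam (Suc i)" for i
  proof -
    have w: "adj i \<in> Y"
      using adj_block_stab[OF i] lam by (simp only: young_subgroup_eq partition_of_def)
    have "T (adj i) \<odot>\<^bsub>?M\<^esub> ?g = ?g"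
      using pure_monomial[OF K.one_closed w one_closed] bg T_closed[OF YS[OF w]] by simp
    then show ?thesis using gM by (simp add: M.smult_one)
  qed
  ultimately show ?thesis
    unfolding young_generator_def g using gM gen left_module_perm by blast
qed

end

text \<open>The definition leaves open which description of \<open>B\<close> produced each module,
  so generators arise for the parameter \<open>q\<close> or for 1. If the two parameters come from
  different descriptions, \<open>T\<close> is a basis of both kinds, and for
  \<open>m \<ge> 2\<close> this forces \<open>q = 1\<close>.\<close>

lemma young_module_inj:
  assumes q: "q \<in> Units K" and lam: "partition_of lam m" and kap: "partition_of kap m"
    and U: "young_module K q m B T lam U" and U': "young_module K q m B T kap U'"
    and iso: "module_isomorphic B U U'"
  shows "lam = kap"
proof (cases "m \<le> 1")
  case True
  then show ?thesis by (rule partition_small_unique[OF lam kap])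
next
  case False
  have gen: "\<exists>p u. (p = q \<or> group_algebra_basis K m B T \<and> p = \<one>\<^bsub>K\<^esub>) \<and> hecke K p m B T \<and> young_generator K p m B T mu V u"
    if mu: "partition_of mu m" and V: "young_module K q m B T mu V" for mu and V :: "('b, 'y) module"
  proof -
    consider (group) "group_algebra_basis K m B T"
        "isomorphic_to_summand_containing B (group_perm_module K m B T mu)
          (specht_in K \<one>\<^bsub>K\<^esub> m B T mu (group_perm_module K m B T mu) (group_perm_gen K m B T mu)) V"
      | (iwahori) "hecke_algebra_basis K q m B T"
        "isomorphic_to_summand_containing B (hecke_perm_module m B T mu)
          (specht_in K q m B T mu (hecke_perm_module m B T mu) (x_elt m B T mu)) V"
      using V unfolding young_module_def Let_def by blast
    then show ?thesis
    proof cases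
      case group
      interpret group_algebra K m B T mu using group(1) mu by unfold_locales
      obtain u where "young_generator K \<one>\<^bsub>K\<^esub> m B T mu V u"
        by (rule young_generator_summand[OF mu young_generator_group_perm_module group(2)])
      then show ?thesis using group(1) hecke_axioms by blast
    next
      case iwahori
      interpret hecke K q m B T using iwahori(1) q by unfold_locales
      obtain u where "young_generator K q m B T mu V u"
        by (rule young_generator_summand[OF mu young_generator_hecke_perm_module[OF mu] iwahori(2)])
      then show ?thesis using hecke_axioms by blast
    qed
  qed
  obtain p u where p: "p = q \<or> group_algebra_basis K m B T \<and> p = \<one>\<^bsub>K\<^esub>" "hecke K p m B T" "young_generator K p m B T lam U u"
    using gen[OF lam U] by blast
  obtain p' u' where p': "p' = q \<or> group_algebra_basis K m B T \<and> p' = \<one>\<^bsub>K\<^esub>" "hecke K p' m B T" "young_generator K p' m B T kap U' u'"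
    using gen[OF kap U'] by blast
  have "p = p'" using p(1,2) p'(1,2) group_and_hecke_parameter[of K m B T] False by (metis not_less_eq_eq one_add_one plus_1_eq_Suc)
  then have "young_generator K p m B T kap U' u'" using p'(3) by simp
  then show ?thesis by (rule hecke.young_generator_eq[OF p(2) lam kap p(3) _ iso])
qed

section \<open>Layers of a cellularly stratified algebra\<close>

lemma (in abelian_group) neg_zero: "\<ominus> \<zero> = \<zero>"
  by (metis a_inv_closed l_zero r_neg zero_closed)

text \<open>A young module is specified as a copy of an indecomposable summand. A decomposition of
  the copy is carried by \<open>f\<close> to one of the summand.\<close>

lemma indecomposable_iso:
  fixes U :: "('r, 'x) module" and M :: "('r, 'm) module"
  assumes U: "left_module R U" and M: "left_module R M"
    and f: "f \<in> module_homs R U M" "bij_betw f (carrier U) (carrier M)" and ind: "indecomposable R M"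
  shows "indecomposable R U"
proof -
  interpret U: left_module R U by fact
  interpret M: left_module R M by fact
  note fz = add_hom_zero_minus[OF U.M.abelian_group_axioms M.M.abelian_group_axioms add_hom_module_homs[OF f(1)]]
  have inj: "\<lbrakk>x \<in> carrier U; y \<in> carrier U; f x = f y\<rbrakk> \<Longrightarrow> x = y" for x y
    using f(2) by (meson bij_betw_def inj_onD)
  have sub: "submodule (f ` N) R M" if N: "submodule N R U" for N
  proof (rule M.submoduleI')
    note Nc = subsetD[OF U.submoduleD(1)[OF N]]
    show "f ` N \<subseteq> carrier M" using Nc module_homsD(1)[OF f(1)] by blast
    show "\<zero>\<^bsub>M\<^esub> \<in> f ` N" using fz(1) U.submoduleD(2)[OF N] by (metis imageI)
    show "\<ominus>\<^bsub>M\<^esub> x \<in> f ` N" if x: "x \<in> f ` N" for x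
    proof -
      obtain a where a: "a \<in> N" "x = f a" using x by blast
      then have "\<ominus>\<^bsub>M\<^esub> x = f (\<ominus>\<^bsub>U\<^esub> a)" using fz(2)[OF Nc] by simp
      then show ?thesis using U.submoduleD(3)[OF N a(1)] by blast
    qed
    show "x \<oplus>\<^bsub>M\<^esub> y \<in> f ` N" if xy: "x \<in> f ` N" "y \<in> f ` N" for x y
    proof -
      obtain a b where a: "a \<in> N" "x = f a" "b \<in> N" "y = f b" using xy by blast
      then have "x \<oplus>\<^bsub>M\<^esub> y = f (a \<oplus>\<^bsub>U\<^esub> b)" using module_homsD(2)[OF f(1) Nc Nc] by simp
      then show ?thesis using U.submoduleD(4)[OF N a(1,3)] by blast
    qed
    show "a \<odot>\<^bsub>M\<^esub> x \<in> f ` N" if ax: "a \<in> carrier R" "x \<in> f ` N" for a x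
    proof -
      obtain b where b: "b \<in> N" "x = f b" using ax by blast
      then have "a \<odot>\<^bsub>M\<^esub> x = f (a \<odot>\<^bsub>U\<^esub> b)" using module_homsD(3)[OF f(1) ax(1) Nc] by simp
      then show ?thesis using U.submoduleD(6)[OF N ax(1) b(1)] by blast
    qed
  qed
  have zero: "N = {\<zero>\<^bsub>U\<^esub>}" if N: "submodule N R U" and z: "f ` N = {\<zero>\<^bsub>M\<^esub>}" for N
  proof -
    have "x = \<zero>\<^bsub>U\<^esub>" if x: "x \<in> N" for x
    proof (rule inj)
      show "f x = f \<zero>\<^bsub>U\<^esub>" using imageI[OF x, of f] z fz(1) by simp
    qed (use subsetD[OF U.submoduleD(1)[OF N] x] in simp_all)
    then show ?thesis using U.submoduleD(2)[OF N] by blast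
  qed
  show ?thesis
    unfolding indecomposable_def
  proof (intro conjI allI impI)
    show "carrier U \<noteq> {\<zero>\<^bsub>U\<^esub>}"
    proof
      assume "carrier U = {\<zero>\<^bsub>U\<^esub>}"
      then have "carrier M = {\<zero>\<^bsub>M\<^esub>}" using f(2) fz(1) by (auto simp: bij_betw_def)
      then show False using ind by (simp add: indecomposable_def)
    qed
    fix N N' assume c: "complementary R U N N'"
    then have N: "submodule N R U" "submodule N' R U" "N \<inter> N' = {\<zero>\<^bsub>U\<^esub>}"
      by (auto simp: complementary_def)
    note Nc = subsetD[OF U.submoduleD(1)[OF N(1)]] subsetD[OF U.submoduleD(1)[OF N(2)]]
    have "complementary R M (f ` N) (f ` N')"
      unfolding complementary_def
    proof (intro conjI sub N)
      have "\<zero>\<^bsub>M\<^esub> \<in> f ` N" "\<zero>\<^bsub>M\<^esub> \<in> f ` N'"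
        using M.submoduleD(2)[OF sub[OF N(1)]] M.submoduleD(2)[OF sub[OF N(2)]] by auto
      moreover have "y = \<zero>\<^bsub>M\<^esub>" if y: "y \<in> f ` N" "y \<in> f ` N'" for y
      proof -
        obtain a b where ab: "a \<in> N" "y = f a" "b \<in> N'" "y = f b" using y by blast
        then have "a = b" using inj Nc by metis
        then have "a \<in> N \<inter> N'" using ab by simp
        then show ?thesis using N(3) ab(2) fz(1) by simp
      qed
      ultimately show "f ` N \<inter> f ` N' = {\<zero>\<^bsub>M\<^esub>}" by blast
      show "f ` N <+>\<^bsub>M\<^esub> f ` N' = carrier M"
      proof (intro equalityI subsetI)
        fix y assume "y \<in> f ` N <+>\<^bsub>M\<^esub> f ` N'"
        then obtain a b where "a \<in> N" "b \<in> N'" "y = f a \<oplus>\<^bsub>M\<^esub> f b" by (auto simp: set_add_def')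
        then show "y \<in> carrier M" using Nc module_homsD(1)[OF f(1)] by simp
      next
        fix y assume "y \<in> carrier M"
        then obtain x where x: "x \<in> carrier U" "y = f x" using f(2) by (auto simp: bij_betw_def)
        obtain a b where ab: "a \<in> N" "b \<in> N'" "x = a \<oplus>\<^bsub>U\<^esub> b"
          by (rule U.complementary_decomp[OF c x(1)])
        then have "y = f a \<oplus>\<^bsub>M\<^esub> f b" using x(2) module_homsD(2)[OF f(1)] Nc by simp
        then show "y \<in> f ` N <+>\<^bsub>M\<^esub> f ` N'" using ab by (auto simp: set_add_def')
      qed
    qed
    then have "f ` N = {\<zero>\<^bsub>M\<^esub>} \<or> f ` N' = {\<zero>\<^bsub>M\<^esub>}" using ind by (simp add: indecomposable_def)
    then show "N = {\<zero>\<^bsub>U\<^esub>} \<or> N' = {\<zero>\<^bsub>U\<^esub>}" using zero N by blast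
  qed
qed

lemma indecomposable_summand_iso:
  assumes M: "left_module R M" and U: "isomorphic_to_summand_containing R M S U"
  shows "indecomposable R U"
proof -
  obtain N f where N: "direct_summand R M N" "indecomposable R (M\<lparr>carrier := N\<rparr>)" "left_module R U"
    and f: "f \<in> module_homs R U (M\<lparr>carrier := N\<rparr>)" "bij_betw f (carrier U) (carrier (M\<lparr>carrier := N\<rparr>))"
    using U unfolding isomorphic_to_summand_containing_def module_isomorphic_def by blast
  have "left_module R (M\<lparr>carrier := N\<rparr>)"
    using N(1) left_module.submodule_left_module[OF M] by (auto simp: direct_summand_def complementary_def)
  then show ?thesis by (rule indecomposable_iso[OF N(3) _ f N(2)])
qed

lemma young_module_indecomposable:
  assumes q: "q \<in> Units K" and lam: "partition_of lam m" and U: "young_module K q m B T lam U"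
  shows "indecomposable B U" "left_module B U"
proof -
  have "left_module B (group_perm_module K m B T lam)" if "group_algebra_basis K m B T"
  proof -
    interpret group_algebra K m B T lam using that lam by unfold_locales
    show ?thesis by (rule left_module_perm)
  qed
  moreover have "left_module B (hecke_perm_module m B T lam)" if "hecke_algebra_basis K q m B T"
  proof -
    interpret hecke K q m B T using that q by unfold_locales
    show ?thesis using young_generator_hecke_perm_module[OF lam] by (simp add: young_generator_def)
  qed
  ultimately show "indecomposable B U"
    using U[unfolded young_module_def Let_def]
    by (elim disjE conjE) (erule indecomposable_summand_iso[rotated], simp)+
  show "left_module B U"
    using U unfolding young_module_def Let_def isomorphic_to_summand_containing_def by blast
qed

text \<open>This is \<open>J M\<close>, the finite sums of products of an element of
  \<open>J\<close> with an element of \<open>M\<close>. Adding one product at a time gives the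
  induction principle used throughout.\<close>

inductive_set jspan :: "'r set \<Rightarrow> ('r, 'm) module \<Rightarrow> 'm set"
  for J :: "'r set" and M :: "('r, 'm) module"
  where zero: "\<zero>\<^bsub>M\<^esub> \<in> jspan J M"
    | step: "\<lbrakk>j \<in> J; x \<in> carrier M; y \<in> jspan J M\<rbrakk> \<Longrightarrow> j \<odot>\<^bsub>M\<^esub> x \<oplus>\<^bsub>M\<^esub> y \<in> jspan J M"

context left_module
begin

context
  fixes J :: "'r set"
  assumes ideal_J: "ideal J R"
begin

interpretation J: ideal J R by (rule ideal_J)

lemmas J = J.a_subset and J_neg = J.a_inv_closed

lemma jspan_closed: "x \<in> jspan J M \<Longrightarrow> x \<in> carrier M"
  by (induction rule: jspan.induct) (simp_all add: subsetD[OF J] smult_closed)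

lemma jspan_add: "x \<in> jspan J M \<Longrightarrow> y \<in> jspan J M \<Longrightarrow> x \<oplus>\<^bsub>M\<^esub> y \<in> jspan J M"
proof (induction rule: jspan.induct)
  case zero
  then show ?case using jspan_closed by simp
next
  case (step j x z)
  then have "j \<odot>\<^bsub>M\<^esub> x \<oplus>\<^bsub>M\<^esub> z \<oplus>\<^bsub>M\<^esub> y = j \<odot>\<^bsub>M\<^esub> x \<oplus>\<^bsub>M\<^esub> (z \<oplus>\<^bsub>M\<^esub> y)"
    using J jspan_closed smult_closed by (intro M.a_assoc) auto
  then show ?case using step jspan.step by metis
qed

lemma jspan_gen: "\<lbrakk>j \<in> J; x \<in> carrier M\<rbrakk> \<Longrightarrow> j \<odot>\<^bsub>M\<^esub> x \<in> jspan J M"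
  using jspan.step[OF _ _ jspan.zero, of j J x M] J smult_closed by auto

lemma jspan_neg: "x \<in> jspan J M \<Longrightarrow> \<ominus>\<^bsub>M\<^esub> x \<in> jspan J M"
proof (induction rule: jspan.induct)
  case zero
  then show ?case by (simp only: M.neg_zero jspan.zero)
next
  case (step j x z)
  then have jR: "j \<in> carrier R" using J by blast
  have "\<ominus>\<^bsub>M\<^esub> (j \<odot>\<^bsub>M\<^esub> x \<oplus>\<^bsub>M\<^esub> z) = (\<ominus>\<^bsub>R\<^esub> j) \<odot>\<^bsub>M\<^esub> x \<oplus>\<^bsub>M\<^esub> \<ominus>\<^bsub>M\<^esub> z"
    using jR step jspan_closed smult_closed by (simp add: M.minus_add smult_l_neg)
  then show ?case using step jspan.step[OF J_neg] by metis
qed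

lemma jspan_diff: "\<lbrakk>x \<in> jspan J M; y \<in> jspan J M\<rbrakk> \<Longrightarrow> x \<ominus>\<^bsub>M\<^esub> y \<in> jspan J M"
  unfolding a_minus_def by (intro jspan_add jspan_neg)

text \<open>Functoriality of \<open>J M\<close>. Applied to an isomorphism and to its inverse, it
  shows that membership in \<open>J M\<close> is an invariant.\<close>

lemma jspan_hom:
  assumes f: "f \<in> module_homs R M M'" and M': "abelian_group M'" and x: "x \<in> jspan J M"
  shows "f x \<in> jspan J M'"
  using x
proof (induction rule: jspan.induct)
  case zero
  then show ?case
    using add_hom_zero_minus(1)[OF M.abelian_group_axioms M' add_hom_module_homs[OF f]] jspan.zero by metis
next
  case (step j x y)
  then have "f (j \<odot>\<^bsub>M\<^esub> x \<oplus>\<^bsub>M\<^esub> y) = j \<odot>\<^bsub>M'\<^esub> f x \<oplus>\<^bsub>M'\<^esub> f y"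
    using J jspan_closed smult_closed module_homsD[OF f] by (simp add: subset_iff)
  then show ?case using step jspan.step module_homsD(1)[OF f] by metis
qed

end

end

section \<open>Tensor products over the ground field\<close>

lemma tensor_K_balanced:
  assumes "Module.module K V" "abelian_group W" "\<And>c x. \<lbrakk>c \<in> carrier K; x \<in> carrier W\<rbrakk> \<Longrightarrow> c \<odot>\<^bsub>W\<^esub> x \<in> carrier W"
  shows "balanced_pair K V (\<lambda>x c. c \<odot>\<^bsub>V\<^esub> x) W"
proof -
  interpret V: Module.module K V by fact
  interpret W: abelian_group W by fact
  show ?thesis by unfold_locales (use assms(3) in simp_all)
qed

lemma left_module_of_module: "Module.module K V \<Longrightarrow> left_module K V"
proof -
  assume "Module.module K V"
  then interpret Module.module K V .
  show ?thesis
    by (intro left_module.intro left_module_axioms.intro R.ring_axioms M.abelian_group_axioms)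
      (simp_all add: smult_l_distr smult_r_distr smult_assoc1)
qed

lemma module_tensor_K:
  assumes V: "Module.module K V" and W: "Module.module K W"
  shows "Module.module K (tensor_K K V W)"
proof -
  interpret V: Module.module K V by fact
  interpret W: Module.module K W by fact
  interpret t: balanced_pair K V "\<lambda>x c. c \<odot>\<^bsub>V\<^esub> x" W
    by (rule tensor_K_balanced[OF V W.M.abelian_group_axioms]) simp
  have "left_module K (tensor_K K V W)"
    unfolding tensor_K_def
  proof (rule t.left_module_TP[OF left_module_of_module[OF V]])
    show "a \<odot>\<^bsub>V\<^esub> (c \<odot>\<^bsub>V\<^esub> p) = c \<odot>\<^bsub>V\<^esub> (a \<odot>\<^bsub>V\<^esub> p)" if "a \<in> carrier K" "p \<in> carrier V" "c \<in> carrier K" for a p c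
      using that by (simp add: V.R.m_comm flip: V.smult_assoc1)
  qed
  then interpret left_module K "tensor_K K V W" .
  show ?thesis
    by (intro moduleI V.R.cring_axioms M.abelian_group_axioms)
      (simp_all add: smult_closed smult_l_distr smult_r_distr smult_assoc smult_one)
qed

section \<open>One layer, the ideal below it and its idempotent\<close>

locale strat_layer =
  fixes K :: "'k ring" and A :: "('k, 'a) module" and D :: "('k, 'b, 'v, 'a) strat_data" and l :: nat
  assumes strat: "cellularly_stratified K A D" and l: "l \<le> top_layer D"
    and embedding: "algebra_embedding K (inp D l) (corner A (idem K D l)) (emb K D l)"
begin

sublocale k_alg K A
  using strat by unfold_locales (simp add: cellularly_stratified_def)

abbreviation "B \<equiv> inp D l"
abbreviation "V \<equiv> vsp D l"
abbreviation "e \<equiv> idem K D l"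
abbreviation "\<iota> \<equiv> emb K D l"
abbreviation "J \<equiv> below K A D l"
abbreviation "C \<equiv> carrier (corner A e)"
abbreviation "pr \<equiv> proj K A D l"

lemma inflation: obtains iA iB \<phi> where "iterated_inflation K A D iA iB \<phi>"
  using strat by (auto simp: cellularly_stratified_def)

lemma modules: "j \<le> top_layer D \<Longrightarrow> Module.module K (inp D j)" "j \<le> top_layer D \<Longrightarrow> Module.module K (vsp D j)"
proof -
  obtain iA iB \<phi> where "iterated_inflation K A D iA iB \<phi>" by (rule inflation)
  then show "j \<le> top_layer D \<Longrightarrow> Module.module K (inp D j)" "j \<le> top_layer D \<Longrightarrow> Module.module K (vsp D j)"
    by (auto simp: iterated_inflation_def cellular_algebra_def k_algebra_def)
qed

lemma module_layer: "j \<le> top_layer D \<Longrightarrow> Module.module K (layer K D j)"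
  unfolding layer_def by (intro module_tensor_K modules)

sublocale BK: k_alg K B
proof -
  obtain iA iB \<phi> where "iterated_inflation K A D iA iB \<phi>" by (rule inflation)
  then show "k_alg K B"
    using l by unfold_locales (auto simp: iterated_inflation_def cellular_algebra_def)
qed

lemma incl_hom: "j \<le> top_layer D \<Longrightarrow> incl D j \<in> module_homs K (layer K D j) A"
proof -
  obtain iA iB \<phi> where "iterated_inflation K A D iA iB \<phi>" by (rule inflation)
  then show "j \<le> top_layer D \<Longrightarrow> incl D j \<in> module_homs K (layer K D j) A"
    by (simp add: iterated_inflation_def)
qed

lemma incl_closed: "\<lbrakk>j \<le> top_layer D; t \<in> carrier (layer K D j)\<rbrakk> \<Longrightarrow> incl D j t \<in> carrier A"
  using module_homsD(1)[OF incl_hom] .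

lemma layer_zero: "j \<le> top_layer D \<Longrightarrow> \<zero>\<^bsub>layer K D j\<^esub> \<in> carrier (layer K D j)"
  using module_layer by (meson Module.module.axioms(2) abelian_group.axioms(1) abelian_monoid.zero_closed)

lemma incl_zero: "j \<le> top_layer D \<Longrightarrow> incl D j \<zero>\<^bsub>layer K D j\<^esub> = \<zero>\<^bsub>A\<^esub>"
  using add_hom_zero_minus(1)[OF _ abelian_group_axioms add_hom_module_homs[OF incl_hom]] module_layer
    Module.module.axioms(2) by metis

lemma decomp_unique:
  assumes "t \<in> (\<Pi>\<^sub>E j\<in>{..top_layer D}. carrier (layer K D j))" "s \<in> (\<Pi>\<^sub>E j\<in>{..top_layer D}. carrier (layer K D j))"
    and eq: "(\<Oplus>\<^bsub>A\<^esub>j\<in>{..top_layer D}. incl D j (t j)) = (\<Oplus>\<^bsub>A\<^esub>j\<in>{..top_layer D}. incl D j (s j))"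
  shows "t = s"
proof -
  obtain iA iB \<phi> where i: "iterated_inflation K A D iA iB \<phi>" by (rule inflation)
  let ?a = "\<Oplus>\<^bsub>A\<^esub>j\<in>{..top_layer D}. incl D j (t j)"
  have "?a \<in> carrier A" using assms(1) incl_closed by (intro finsum_closed) (auto simp: PiE_iff)
  then have "\<exists>!t. t \<in> (\<Pi>\<^sub>E j\<in>{..top_layer D}. carrier (layer K D j)) \<and> ?a = (\<Oplus>\<^bsub>A\<^esub>j\<in>{..top_layer D}. incl D j (t j))"
    by (rule i[unfolded iterated_inflation_def, THEN conjunct2, THEN conjunct2, THEN conjunct1, THEN bspec])
  then obtain t0 where t0: "\<And>s. \<lbrakk>s \<in> (\<Pi>\<^sub>E j\<in>{..top_layer D}. carrier (layer K D j));
      ?a = (\<Oplus>\<^bsub>A\<^esub>j\<in>{..top_layer D}. incl D j (s j))\<rbrakk> \<Longrightarrow> s = t0"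
    unfolding Ex1_def by (elim exE conjE) blast
  show ?thesis using t0[OF assms(1) refl] t0[OF assms(2) eq] by (rule trans[OF _ sym])
qed

lemma below_0: "below K A D 0 = {\<zero>\<^bsub>A\<^esub>}"
  by (auto simp: below_def)

lemma ideal_below_Suc: "j \<le> top_layer D \<Longrightarrow> ideal (below K A D (Suc j)) A"
proof -
  obtain iA iB \<phi> where "iterated_inflation K A D iA iB \<phi>" by (rule inflation)
  then show "j \<le> top_layer D \<Longrightarrow> ideal (below K A D (Suc j)) A" by (simp add: iterated_inflation_def)
qed

text \<open>The stratification declares the sums of the layers up to \<open>j\<close> to be ideals,
  which is \<open>below\<close> at \<open>Suc j\<close>. For \<open>l = 0\<close> there is no layer
  below, and the ideal is zero.\<close>

sublocale J: ideal J A
proof (cases l)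
  case 0
  then show "ideal J A" using below_0 zeroideal by simp
next
  case (Suc l')
  then show "ideal J A" using ideal_below_Suc[of l'] l by simp
qed

lemma J_diff: "\<lbrakk>x \<in> J; y \<in> J\<rbrakk> \<Longrightarrow> x \<ominus>\<^bsub>A\<^esub> y \<in> J"
  unfolding a_minus_def using J.a_closed J.a_inv_closed by blast

lemma elt_layer:
  assumes "b \<in> carrier B" "x \<in> carrier V" "y \<in> carrier V"
  shows "\<exists>t\<in>carrier (layer K D l). elt K D l b x y = incl D l t"
proof -
  interpret V: Module.module K V by (rule modules(2)[OF l])
  interpret W: Module.module K "tensor_K K B V" by (intro module_tensor_K modules l)
  interpret i: balanced_pair K B "\<lambda>x c. c \<odot>\<^bsub>B\<^esub> x" V
    by (rule tensor_K_balanced[OF modules(1)[OF l] V.M.abelian_group_axioms]) simp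
  interpret o: balanced_pair K "tensor_K K B V" "\<lambda>x c. c \<odot>\<^bsub>tensor_K K B V\<^esub> x" V
    by (rule tensor_K_balanced[OF W.module_axioms V.M.abelian_group_axioms]) simp
  have "pure_K K B V b x \<in> carrier (tensor_K K B V)"
    using i.pure_closed assms by (simp add: pure_K_def tensor_K_def)
  then have "pure_K K (tensor_K K B V) V (pure_K K B V b x) y \<in> carrier (layer K D l)"
    using o.pure_closed assms unfolding layer_def pure_K_def tensor_K_def by blast
  then show ?thesis unfolding elt_def by blast
qed

lemma elt_closed: "\<lbrakk>b \<in> carrier B; x \<in> carrier V; y \<in> carrier V\<rbrakk> \<Longrightarrow> elt K D l b x y \<in> carrier A"
  using elt_layer[of b x y] incl_closed[OF l] by auto

text \<open>A layer is a tensor product whose left factor is again a tensor product, so tensor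
  induction is applied twice.\<close>

lemma layer_induct:
  assumes z: "z \<in> carrier (layer K D l)"
    and zero: "Q \<zero>\<^bsub>A\<^esub>"
    and diff: "\<And>x y. \<lbrakk>x \<in> carrier A; y \<in> carrier A; Q x; Q y\<rbrakk> \<Longrightarrow> Q (x \<ominus>\<^bsub>A\<^esub> y)"
    and elt: "\<And>b x y. \<lbrakk>b \<in> carrier B; x \<in> carrier V; y \<in> carrier V\<rbrakk> \<Longrightarrow> Q (elt K D l b x y)"
  shows "Q (incl D l z)"
proof -
  let ?BV = "tensor_K K B V"
  interpret V: Module.module K V by (rule modules(2)[OF l])
  interpret W: Module.module K ?BV by (intro module_tensor_K modules l)
  interpret L: Module.module K "layer K D l" by (rule module_layer[OF l])
  interpret i: balanced_pair K B "\<lambda>x c. c \<odot>\<^bsub>B\<^esub> x" V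
    by (rule tensor_K_balanced[OF modules(1)[OF l] V.M.abelian_group_axioms]) simp
  interpret o: balanced_pair K ?BV "\<lambda>x c. c \<odot>\<^bsub>?BV\<^esub> x" V
    by (rule tensor_K_balanced[OF W.module_axioms V.M.abelian_group_axioms]) simp
  have BV: "?BV = i.TP" by (simp add: tensor_K_def)
  have L: "layer K D l = o.TP" by (simp add: layer_def tensor_K_def)
  note inc = add_hom_zero_minus[OF L.M.abelian_group_axioms abelian_group_axioms add_hom_module_homs[OF incl_hom[OF l]]]
  have pure: "Q (incl D l (o.pure w y))" if "w \<in> carrier ?BV" and y: "y \<in> carrier V" for w y
  proof -
    note pl = add_hom_zero_minus[OF W.M.abelian_group_axioms o.abelian_group_TP o.add_hom_pure_left[OF y], folded L]
    from \<open>w \<in> carrier ?BV\<close> show ?thesis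
      unfolding BV
    proof (induction rule: i.tensor_induct)
      case zero
      then show ?case using pl(1) inc(1) assms(2) unfolding BV by simp
    next
      case (pure b x)
      then show ?case using elt[OF pure y] unfolding elt_def pure_K_def BV by simp
    next
      case (diff t s)
      then have "o.pure t y \<in> carrier (layer K D l)" "o.pure s y \<in> carrier (layer K D l)"
        unfolding L BV[symmetric] using o.pure_closed y by blast+
      moreover have "incl D l (o.pure (t \<ominus>\<^bsub>i.TP\<^esub> s) y) = incl D l (o.pure t y) \<ominus>\<^bsub>A\<^esub> incl D l (o.pure s y)"
        using pl(3) inc(3) calculation diff(1,2) unfolding BV by simp
      ultimately show ?case
        using assms(3)[OF incl_closed[OF l] incl_closed[OF l]] diff(3,4) unfolding BV by metis
    qed
  qed
  show ?thesis
    using z unfolding L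
  proof (induction rule: o.tensor_induct)
    case zero
    then show ?case using inc(1) assms(2) unfolding L by simp
  next
    case (pure w y)
    then show ?case by (rule \<open>\<And>w y. \<lbrakk>w \<in> carrier ?BV; y \<in> carrier V\<rbrakk> \<Longrightarrow> Q (incl D l (o.pure w y))\<close>)
  next
    case (diff t s)
    then have "incl D l (t \<ominus>\<^bsub>o.TP\<^esub> s) = incl D l t \<ominus>\<^bsub>A\<^esub> incl D l s"
      using inc(3) unfolding L by blast
    then show ?case
      using assms(3)[OF incl_closed[OF l] incl_closed[OF l]] diff unfolding L by metis
  qed
qed

lemma uv: "uvec D l \<in> carrier V" "vvec D l \<in> carrier V"
  using strat l by (auto simp: cellularly_stratified_def)

lemma e_idem: "e \<otimes>\<^bsub>A\<^esub> e = e"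
  using strat l by (auto simp: cellularly_stratified_def)

lemma emb_eq: "\<iota> b = elt K D l b (uvec D l) (vvec D l)" "\<iota> \<one>\<^bsub>B\<^esub> = e"
  by (simp_all add: emb_def idem_def)

lemma emb_closed [simp]: "b \<in> carrier B \<Longrightarrow> \<iota> b \<in> carrier A"
  unfolding emb_eq by (rule elt_closed[OF _ uv])

lemma e_closed [simp]: "e \<in> carrier A"
  using emb_closed[OF BK.one_closed] emb_eq(2) by simp

lemma C_iff: "c \<in> C \<longleftrightarrow> c \<in> carrier A \<and> e \<otimes>\<^bsub>A\<^esub> c = c \<and> c \<otimes>\<^bsub>A\<^esub> e = c"
proof
  assume "c \<in> C"
  then obtain a where a: "a \<in> carrier A" "c = e \<otimes>\<^bsub>A\<^esub> a \<otimes>\<^bsub>A\<^esub> e" by (auto simp: corner_def)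
  then have "e \<otimes>\<^bsub>A\<^esub> c = (e \<otimes>\<^bsub>A\<^esub> e) \<otimes>\<^bsub>A\<^esub> a \<otimes>\<^bsub>A\<^esub> e" "c \<otimes>\<^bsub>A\<^esub> e = e \<otimes>\<^bsub>A\<^esub> a \<otimes>\<^bsub>A\<^esub> (e \<otimes>\<^bsub>A\<^esub> e)"
    by (simp_all add: m_assoc)
  then show "c \<in> carrier A \<and> e \<otimes>\<^bsub>A\<^esub> c = c \<and> c \<otimes>\<^bsub>A\<^esub> e = c" using a e_idem by simp
next
  assume "c \<in> carrier A \<and> e \<otimes>\<^bsub>A\<^esub> c = c \<and> c \<otimes>\<^bsub>A\<^esub> e = c"
  then have "c = e \<otimes>\<^bsub>A\<^esub> c \<otimes>\<^bsub>A\<^esub> e" "c \<in> carrier A" by simp_all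
  then show "c \<in> C" by (auto simp: corner_def)
qed

lemma emb_C: "b \<in> carrier B \<Longrightarrow> \<iota> b \<in> C"
  using embedding by (auto simp: algebra_embedding_def module_homs_def)

lemma emb_mult: "\<lbrakk>b \<in> carrier B; b' \<in> carrier B\<rbrakk> \<Longrightarrow> \<iota> (b \<otimes>\<^bsub>B\<^esub> b') = \<iota> b \<otimes>\<^bsub>A\<^esub> \<iota> b'"
  and emb_add: "\<lbrakk>b \<in> carrier B; b' \<in> carrier B\<rbrakk> \<Longrightarrow> \<iota> (b \<oplus>\<^bsub>B\<^esub> b') = \<iota> b \<oplus>\<^bsub>A\<^esub> \<iota> b'"
  using embedding by (auto simp: algebra_embedding_def ring_hom_def corner_def)

lemma add_hom_emb: "add_hom B A \<iota>"
  by (simp add: add_hom_def emb_add)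

lemmas emb_zero_minus = add_hom_zero_minus[OF BK.abelian_group_axioms abelian_group_axioms add_hom_emb]

lemma emb_inj: "\<lbrakk>b \<in> carrier B; b' \<in> carrier B; \<iota> b = \<iota> b'\<rbrakk> \<Longrightarrow> b = b'"
  using embedding by (auto simp: algebra_embedding_def dest: inj_onD)

lemma emb_layer: "b \<in> carrier B \<Longrightarrow> \<exists>t\<in>carrier (layer K D l). \<iota> b = incl D l t"
  unfolding emb_eq(1) by (rule elt_layer[OF _ uv])

lemma below_Suc_decomp:
  assumes "a \<in> below K A D (Suc l)"
  obtains t j where "t \<in> carrier (layer K D l)" "j \<in> J" "a = incl D l t \<oplus>\<^bsub>A\<^esub> j"
proof -
  obtain t where t: "t \<in> (\<Pi> j\<in>{..<Suc l}. carrier (layer K D j))" "a = (\<Oplus>\<^bsub>A\<^esub>j\<in>{..<Suc l}. incl D j (t j))"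
    using assms by (auto simp: below_def)
  have c: "incl D j (t j) \<in> carrier A" if "j < Suc l" for j
    using that t(1) l by (intro incl_closed) auto
  have "a = incl D l (t l) \<oplus>\<^bsub>A\<^esub> (\<Oplus>\<^bsub>A\<^esub>j\<in>{..<l}. incl D j (t j))"
    unfolding t(2) lessThan_Suc using c by (intro finsum_insert) auto
  moreover have "(\<Oplus>\<^bsub>A\<^esub>j\<in>{..<l}. incl D j (t j)) \<in> J" unfolding below_def
    by (intro CollectI exI[of _ t] conjI refl) (use t(1) in auto)
  ultimately show ?thesis using that t(1) by auto
qed

lemma e_below: "e \<in> below K A D (Suc l)"
proof -
  obtain s where s: "s \<in> carrier (layer K D l)" "e = incl D l s"
    using emb_layer[OF BK.one_closed] emb_eq(2) by metis
  \<comment> \<open>The family is concentrated in layer \<open>l\<close>; the zeros of the lower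
    layers fill the remaining places of a sum over all \<open>j < Suc l\<close>.\<close>
  let ?t = "\<lambda>j. if l = j then s else \<zero>\<^bsub>layer K D j\<^esub>"
  have "(\<Oplus>\<^bsub>A\<^esub>j\<in>{..<Suc l}. incl D j (?t j)) = (\<Oplus>\<^bsub>A\<^esub>j\<in>{..<Suc l}. if l = j then e else \<zero>\<^bsub>A\<^esub>)"
    using s e_closed l incl_zero by (intro finsum_cong') auto
  also have "\<dots> = e" using e_closed by (intro add.finprod_singleton) auto
  finally have "e = (\<Oplus>\<^bsub>A\<^esub>j\<in>{..<Suc l}. incl D j (?t j))" ..
  moreover have "?t \<in> (\<Pi> j\<in>{..<Suc l}. carrier (layer K D j))" using s l layer_zero by auto
  ultimately show ?thesis unfolding below_def by (intro CollectI exI conjI)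
qed

text \<open>Modulo \<open>J\<close>, multiplying \<open>b \<otimes> x \<otimes> y\<close> on both
  sides by the idempotent built from \<open>u\<close> and \<open>v\<close> replaces \<open>b\<close>
  by \<open>\<phi>(v, x) b \<phi>(y, u)\<close> and the vectors by \<open>u\<close> and
  \<open>v\<close>. This is how elements of the corner come to have the form of
  \<open>\<iota>\<close>.\<close>

lemma sandwich_elt:
  assumes "b \<in> carrier B" "x \<in> carrier V" "y \<in> carrier V"
  shows "\<exists>b'\<in>carrier B. e \<otimes>\<^bsub>A\<^esub> elt K D l b x y \<otimes>\<^bsub>A\<^esub> e \<ominus>\<^bsub>A\<^esub> \<iota> b' \<in> J"
proof -
  obtain iA iB \<phi> where i: "iterated_inflation K A D iA iB \<phi>" by (rule inflation)
  note infl = i[unfolded iterated_inflation_def]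
  have bil: "bilinear K V V B (\<phi> l)"
    by (rule infl[THEN conjunct2, THEN conjunct2, THEN conjunct2, THEN conjunct2, THEN conjunct1,
          rule_format, OF l])
  have \<phi>: "\<phi> l x y \<in> carrier B" if "x \<in> carrier V" "y \<in> carrier V" for x y
  proof -
    have "\<phi> l x \<in> module_homs K V B" using bil that by (simp add: bilinear_def)
    then show ?thesis using module_homsD(1) that by metis
  qed
  have mult: "elt K D l b x y \<otimes>\<^bsub>A\<^esub> elt K D l b' x' y' \<ominus>\<^bsub>A\<^esub> elt K D l (b \<otimes>\<^bsub>B\<^esub> \<phi> l y x' \<otimes>\<^bsub>B\<^esub> b') x y' \<in> J"
    if "b \<in> carrier B" "b' \<in> carrier B" "x \<in> carrier V" "y \<in> carrier V" "x' \<in> carrier V" "y' \<in> carrier V"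
    for b b' x y x' y'
    by (rule infl[THEN conjunct2, THEN conjunct2, THEN conjunct2, THEN conjunct2, THEN conjunct2, THEN conjunct1,
          rule_format, OF l that])
  let ?u = "uvec D l" and ?v = "vvec D l"
  define E where "E = elt K D l b x y"
  define b1 where "b1 = \<one>\<^bsub>B\<^esub> \<otimes>\<^bsub>B\<^esub> \<phi> l ?v x \<otimes>\<^bsub>B\<^esub> b"
  define E1 where "E1 = elt K D l b1 ?u y"
  define b2 where "b2 = b1 \<otimes>\<^bsub>B\<^esub> \<phi> l y ?u \<otimes>\<^bsub>B\<^esub> \<one>\<^bsub>B\<^esub>"
  have b12: "b1 \<in> carrier B" "b2 \<in> carrier B" using assms uv \<phi> by (simp_all add: b1_def b2_def)
  have E: "E \<in> carrier A" "E1 \<in> carrier A" unfolding E_def E1_def using assms b12 uv by (auto intro: elt_closed)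
  have 1: "e \<otimes>\<^bsub>A\<^esub> E \<ominus>\<^bsub>A\<^esub> E1 \<in> J"
    unfolding E_def E1_def b1_def idem_def by (rule mult[OF BK.one_closed assms(1) uv assms(2,3)])
  have 2: "E1 \<otimes>\<^bsub>A\<^esub> e \<ominus>\<^bsub>A\<^esub> \<iota> b2 \<in> J"
    unfolding E1_def b2_def idem_def emb_eq(1)
    by (rule mult[OF b12(1) BK.one_closed uv(1) assms(3) uv(1,2)])
  \<comment> \<open>The first congruence, multiplied by \<open>e\<close> on the right, is added to
    the second one; the intermediate term cancels.\<close>
  have "(e \<otimes>\<^bsub>A\<^esub> E \<ominus>\<^bsub>A\<^esub> E1) \<otimes>\<^bsub>A\<^esub> e \<oplus>\<^bsub>A\<^esub> (E1 \<otimes>\<^bsub>A\<^esub> e \<ominus>\<^bsub>A\<^esub> \<iota> b2) = e \<otimes>\<^bsub>A\<^esub> E \<otimes>\<^bsub>A\<^esub> e \<ominus>\<^bsub>A\<^esub> \<iota> b2"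
    using E b12 by (simp add: a_minus_def l_distr l_minus a_assoc r_neg1)
  then have "e \<otimes>\<^bsub>A\<^esub> E \<otimes>\<^bsub>A\<^esub> e \<ominus>\<^bsub>A\<^esub> \<iota> b2 \<in> J"
    using J.a_closed[OF J.I_r_closed[OF 1 e_closed] 2] by simp
  then show ?thesis using b12 unfolding E_def by blast
qed

lemma sandwich_layer:
  assumes "t \<in> carrier (layer K D l)"
  shows "\<exists>b\<in>carrier B. e \<otimes>\<^bsub>A\<^esub> incl D l t \<otimes>\<^bsub>A\<^esub> e \<ominus>\<^bsub>A\<^esub> \<iota> b \<in> J"
  using assms
proof (rule layer_induct)
  show "\<exists>b\<in>carrier B. e \<otimes>\<^bsub>A\<^esub> \<zero>\<^bsub>A\<^esub> \<otimes>\<^bsub>A\<^esub> e \<ominus>\<^bsub>A\<^esub> \<iota> b \<in> J"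
    by (rule bexI[of _ "\<zero>\<^bsub>B\<^esub>"]) (simp_all add: emb_zero_minus(1) a_minus_def)
next
  fix x y assume xy: "x \<in> carrier A" "y \<in> carrier A"
    and "\<exists>b\<in>carrier B. e \<otimes>\<^bsub>A\<^esub> x \<otimes>\<^bsub>A\<^esub> e \<ominus>\<^bsub>A\<^esub> \<iota> b \<in> J" "\<exists>b\<in>carrier B. e \<otimes>\<^bsub>A\<^esub> y \<otimes>\<^bsub>A\<^esub> e \<ominus>\<^bsub>A\<^esub> \<iota> b \<in> J"
  then obtain b b' where b: "b \<in> carrier B" "e \<otimes>\<^bsub>A\<^esub> x \<otimes>\<^bsub>A\<^esub> e \<ominus>\<^bsub>A\<^esub> \<iota> b \<in> J"
    and b': "b' \<in> carrier B" "e \<otimes>\<^bsub>A\<^esub> y \<otimes>\<^bsub>A\<^esub> e \<ominus>\<^bsub>A\<^esub> \<iota> b' \<in> J" by blast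
  have "(e \<otimes>\<^bsub>A\<^esub> x \<otimes>\<^bsub>A\<^esub> e \<ominus>\<^bsub>A\<^esub> \<iota> b) \<ominus>\<^bsub>A\<^esub> (e \<otimes>\<^bsub>A\<^esub> y \<otimes>\<^bsub>A\<^esub> e \<ominus>\<^bsub>A\<^esub> \<iota> b')
      = e \<otimes>\<^bsub>A\<^esub> (x \<ominus>\<^bsub>A\<^esub> y) \<otimes>\<^bsub>A\<^esub> e \<ominus>\<^bsub>A\<^esub> \<iota> (b \<ominus>\<^bsub>B\<^esub> b')"
    using xy b b' by (simp add: emb_zero_minus(3)) (simp add: a_minus_def l_distr r_distr l_minus r_minus minus_add a_ac)
  then show "\<exists>b\<in>carrier B. e \<otimes>\<^bsub>A\<^esub> (x \<ominus>\<^bsub>A\<^esub> y) \<otimes>\<^bsub>A\<^esub> e \<ominus>\<^bsub>A\<^esub> \<iota> b \<in> J"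
    using J_diff[OF b(2) b'(2)] b b' BK.minus_closed by metis
qed (rule sandwich_elt)

text \<open>Since \<open>c = e c\<close> and \<open>e\<close> lies in the ideal of the layers up to
  \<open>l\<close>, \<open>c\<close> is the sum of an element of layer \<open>l\<close> and one of
  \<open>J\<close>. Multiplying by \<open>e\<close> on both sides brings the first into the form of
  \<open>\<iota>\<close> modulo \<open>J\<close>.\<close>

lemma proj_ex:
  assumes "c \<in> C"
  shows "\<exists>b\<in>carrier B. c \<ominus>\<^bsub>A\<^esub> \<iota> b \<in> J"
proof -
  interpret J': ideal "below K A D (Suc l)" A by (rule ideal_below_Suc[OF l])
  have c: "c \<in> carrier A" "e \<otimes>\<^bsub>A\<^esub> c = c" "c \<otimes>\<^bsub>A\<^esub> e = c" using assms by (auto simp: C_iff)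
  have "c \<in> below K A D (Suc l)" using J'.I_r_closed[OF e_below c(1)] c(2) by simp
  then obtain t j where t: "t \<in> carrier (layer K D l)" "j \<in> J" "c = incl D l t \<oplus>\<^bsub>A\<^esub> j"
    by (rule below_Suc_decomp)
  obtain b where b: "b \<in> carrier B" "e \<otimes>\<^bsub>A\<^esub> incl D l t \<otimes>\<^bsub>A\<^esub> e \<ominus>\<^bsub>A\<^esub> \<iota> b \<in> J"
    using sandwich_layer[OF t(1)] by blast
  have tj: "incl D l t \<in> carrier A" "j \<in> carrier A" using incl_closed[OF l t(1)] t(2) J.a_subset by auto
  have "c = e \<otimes>\<^bsub>A\<^esub> (incl D l t \<oplus>\<^bsub>A\<^esub> j) \<otimes>\<^bsub>A\<^esub> e" using c t(3) by metis
  also have "\<dots> = e \<otimes>\<^bsub>A\<^esub> incl D l t \<otimes>\<^bsub>A\<^esub> e \<oplus>\<^bsub>A\<^esub> e \<otimes>\<^bsub>A\<^esub> j \<otimes>\<^bsub>A\<^esub> e"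
    using tj by (simp add: l_distr r_distr)
  finally have eq: "c \<ominus>\<^bsub>A\<^esub> \<iota> b = (e \<otimes>\<^bsub>A\<^esub> incl D l t \<otimes>\<^bsub>A\<^esub> e \<ominus>\<^bsub>A\<^esub> \<iota> b) \<oplus>\<^bsub>A\<^esub> e \<otimes>\<^bsub>A\<^esub> j \<otimes>\<^bsub>A\<^esub> e"
    using tj b by (simp add: a_minus_def a_ac)
  have "e \<otimes>\<^bsub>A\<^esub> j \<otimes>\<^bsub>A\<^esub> e \<in> J" using t(2) J.I_l_closed J.I_r_closed by simp
  then have "c \<ominus>\<^bsub>A\<^esub> \<iota> b \<in> J" unfolding eq by (rule J.a_closed[OF b(2)])
  then show ?thesis using b(1) by blast
qed

text \<open>The element would have a decomposition concentrated in layer \<open>l\<close> and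
  another one in the layers below. Decompositions are unique, so both are zero, and
  \<open>\<iota>\<close> is injective. This gives the uniqueness behind \<open>proj\<close>.\<close>

lemma emb_J:
  assumes d: "d \<in> carrier B" "\<iota> d \<in> J"
  shows "d = \<zero>\<^bsub>B\<^esub>"
proof -
  obtain s where s: "s \<in> carrier (layer K D l)" "\<iota> d = incl D l s" using emb_layer[OF d(1)] by blast
  obtain t where t: "t \<in> (\<Pi> j\<in>{..<l}. carrier (layer K D j))" "\<iota> d = (\<Oplus>\<^bsub>A\<^esub>j\<in>{..<l}. incl D j (t j))"
    using d(2) by (auto simp: below_def)
  let ?L = "{..top_layer D}"
  define t1 where "t1 = (\<lambda>j\<in>?L. if l = j then s else \<zero>\<^bsub>layer K D j\<^esub>)"
  define t2 where "t2 = (\<lambda>j\<in>?L. if j < l then t j else \<zero>\<^bsub>layer K D j\<^esub>)"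
  have P: "t1 \<in> (\<Pi>\<^sub>E j\<in>?L. carrier (layer K D j))" "t2 \<in> (\<Pi>\<^sub>E j\<in>?L. carrier (layer K D j))"
    using s t(1) layer_zero by (auto simp: t1_def t2_def)
  have "(\<Oplus>\<^bsub>A\<^esub>j\<in>?L. incl D j (t1 j)) = (\<Oplus>\<^bsub>A\<^esub>j\<in>?L. if l = j then incl D l s else \<zero>\<^bsub>A\<^esub>)"
    using s incl_closed incl_zero l by (intro finsum_cong') (auto simp: t1_def)
  also have "\<dots> = incl D l s" using l incl_closed[OF l s(1)] by (intro add.finprod_singleton) auto
  finally have 1: "(\<Oplus>\<^bsub>A\<^esub>j\<in>?L. incl D j (t1 j)) = \<iota> d" using s by simp
  have ct: "incl D j (t j) \<in> carrier A" if "j < l" for j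
    using that t(1) l by (intro incl_closed) auto
  have "(\<Oplus>\<^bsub>A\<^esub>j\<in>{..<l}. incl D j (t j)) = (\<Oplus>\<^bsub>A\<^esub>j\<in>?L. incl D j (t2 j))"
    using l ct incl_zero layer_zero
    by (intro add.finprod_mono_neutral_cong_left) (auto simp: t2_def)
  then have "t1 = t2" using decomp_unique[OF P] 1 t(2) by simp
  then have "t1 l = t2 l" by simp
  then have "s = \<zero>\<^bsub>layer K D l\<^esub>" using l by (simp add: t1_def t2_def)
  then have "\<iota> d = \<iota> \<zero>\<^bsub>B\<^esub>" using s(2) incl_zero[OF l] emb_zero_minus(1) by simp
  then show ?thesis using emb_inj d(1) by blast
qed

lemma proj_eqI:
  assumes c: "c \<in> carrier A" and b: "b \<in> carrier B" "c \<ominus>\<^bsub>A\<^esub> \<iota> b \<in> J"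
  shows "pr c = b"
  unfolding proj_def
proof (rule the_equality)
  show "b \<in> carrier B \<and> c \<ominus>\<^bsub>A\<^esub> \<iota> b \<in> J" by (rule conjI[OF b])
  fix b' assume "b' \<in> carrier B \<and> c \<ominus>\<^bsub>A\<^esub> \<iota> b' \<in> J"
  then have b': "b' \<in> carrier B" "c \<ominus>\<^bsub>A\<^esub> \<iota> b' \<in> J" by (rule conjunct1, rule conjunct2)
  have "(c \<ominus>\<^bsub>A\<^esub> \<iota> b) \<ominus>\<^bsub>A\<^esub> (c \<ominus>\<^bsub>A\<^esub> \<iota> b') \<in> J" by (rule J_diff[OF b(2) b'(2)])
  moreover have "(c \<ominus>\<^bsub>A\<^esub> \<iota> b) \<ominus>\<^bsub>A\<^esub> (c \<ominus>\<^bsub>A\<^esub> \<iota> b') = \<iota> (b' \<ominus>\<^bsub>B\<^esub> b)"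
    using c b(1) b'(1)
    by (simp add: emb_zero_minus(3)) (simp add: a_minus_def minus_add a_assoc a_lcomm[of "\<ominus>\<^bsub>A\<^esub> \<iota> b"] a_comm[of "\<ominus>\<^bsub>A\<^esub> \<iota> b"] r_neg2)
  ultimately have "b' \<ominus>\<^bsub>B\<^esub> b = \<zero>\<^bsub>B\<^esub>" using emb_J[of "b' \<ominus>\<^bsub>B\<^esub> b"] b(1) b'(1) by simp
  then show "b' = b" by (rule BK.eq_of_diff[OF _ b'(1) b(1)])
qed

lemma proj_closed: "c \<in> C \<Longrightarrow> pr c \<in> carrier B"
  and proj_J: "c \<in> C \<Longrightarrow> c \<ominus>\<^bsub>A\<^esub> \<iota> (pr c) \<in> J"
proof -
  have "pr c \<in> carrier B \<and> c \<ominus>\<^bsub>A\<^esub> \<iota> (pr c) \<in> J" if c: "c \<in> C"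
  proof -
    obtain b where b: "b \<in> carrier B" "c \<ominus>\<^bsub>A\<^esub> \<iota> b \<in> J" using proj_ex[OF c] by blast
    have "c \<in> carrier A" using c by (simp add: C_iff)
    then have "pr c = b" using b by (rule proj_eqI)
    then show ?thesis using b by simp
  qed
  then show "c \<in> C \<Longrightarrow> pr c \<in> carrier B" "c \<in> C \<Longrightarrow> c \<ominus>\<^bsub>A\<^esub> \<iota> (pr c) \<in> J" by blast+
qed

lemma proj_emb: "b \<in> carrier B \<Longrightarrow> pr (\<iota> b) = b"
  by (rule proj_eqI) (auto simp: a_minus_def r_neg)

lemma e_C: "e \<in> C"
  by (simp add: C_iff e_idem)

lemma proj_e: "pr e = \<one>\<^bsub>B\<^esub>"
  using proj_emb[OF BK.one_closed] emb_eq(2) by simp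

lemma proj_zero: "\<lbrakk>c \<in> C; c \<in> J\<rbrakk> \<Longrightarrow> pr c = \<zero>\<^bsub>B\<^esub>"
  by (rule proj_eqI) (auto simp: C_iff emb_zero_minus(1) a_minus_def)

lemma proj_add:
  assumes "c \<in> C" "d \<in> C"
  shows "pr (c \<oplus>\<^bsub>A\<^esub> d) = pr c \<oplus>\<^bsub>B\<^esub> pr d"
proof (rule proj_eqI)
  have c: "c \<in> carrier A" "d \<in> carrier A" using assms by (auto simp: C_iff)
  then show "c \<oplus>\<^bsub>A\<^esub> d \<in> carrier A" by simp
  have "(c \<ominus>\<^bsub>A\<^esub> \<iota> (pr c)) \<oplus>\<^bsub>A\<^esub> (d \<ominus>\<^bsub>A\<^esub> \<iota> (pr d)) = (c \<oplus>\<^bsub>A\<^esub> d) \<ominus>\<^bsub>A\<^esub> \<iota> (pr c \<oplus>\<^bsub>B\<^esub> pr d)"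
    using c proj_closed[OF assms(1)] proj_closed[OF assms(2)] by (simp add: emb_add a_minus_def minus_add a_ac)
  then show "(c \<oplus>\<^bsub>A\<^esub> d) \<ominus>\<^bsub>A\<^esub> \<iota> (pr c \<oplus>\<^bsub>B\<^esub> pr d) \<in> J"
    using J.a_closed[OF proj_J[OF assms(1)] proj_J[OF assms(2)]] by simp
qed (use proj_closed assms in simp)

text \<open>With \<open>x\<close> and \<open>y\<close> the representatives of \<open>c\<close> and
  \<open>d\<close>, the difference of \<open>c d\<close> and \<open>x y\<close> is
  \<open>(c - x) d + x (d - y)\<close>, which lies in the ideal \<open>J\<close>.\<close>

lemma proj_mult:
  assumes "c \<in> C" "d \<in> C"
  shows "pr (c \<otimes>\<^bsub>A\<^esub> d) = pr c \<otimes>\<^bsub>B\<^esub> pr d"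
proof (rule proj_eqI)
  let ?x = "\<iota> (pr c)" and ?y = "\<iota> (pr d)"
  have c: "c \<in> carrier A" "d \<in> carrier A" "?x \<in> carrier A" "?y \<in> carrier A"
    using assms proj_closed by (auto simp: C_iff)
  then show "c \<otimes>\<^bsub>A\<^esub> d \<in> carrier A" by simp
  have "(c \<ominus>\<^bsub>A\<^esub> ?x) \<otimes>\<^bsub>A\<^esub> d \<oplus>\<^bsub>A\<^esub> ?x \<otimes>\<^bsub>A\<^esub> (d \<ominus>\<^bsub>A\<^esub> ?y) = c \<otimes>\<^bsub>A\<^esub> d \<ominus>\<^bsub>A\<^esub> ?x \<otimes>\<^bsub>A\<^esub> ?y"
    using c by (simp add: a_minus_def l_distr r_distr l_minus r_minus a_assoc r_neg1)
  then have "c \<otimes>\<^bsub>A\<^esub> d \<ominus>\<^bsub>A\<^esub> ?x \<otimes>\<^bsub>A\<^esub> ?y \<in> J"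
    using J.a_closed[OF J.I_r_closed[OF proj_J[OF assms(1)] c(2)] J.I_l_closed[OF proj_J[OF assms(2)] c(3)]] by simp
  then show "c \<otimes>\<^bsub>A\<^esub> d \<ominus>\<^bsub>A\<^esub> \<iota> (pr c \<otimes>\<^bsub>B\<^esub> pr d) \<in> J"
    using proj_closed assms by (simp add: emb_mult)
qed (use proj_closed assms in simp)

end

section \<open>Recovering a Young module from the induced one\<close>

context strat_layer
begin

abbreviation "Ae \<equiv> left_ideal_module A e"

lemma Ae_iff: "p \<in> carrier Ae \<longleftrightarrow> p \<in> carrier A \<and> p \<otimes>\<^bsub>A\<^esub> e = p"
proof
  assume "p \<in> carrier Ae"
  then obtain a where a: "a \<in> carrier A" "p = a \<otimes>\<^bsub>A\<^esub> e" by auto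
  then have "p \<otimes>\<^bsub>A\<^esub> e = a \<otimes>\<^bsub>A\<^esub> (e \<otimes>\<^bsub>A\<^esub> e)" by (simp add: m_assoc)
  then show "p \<in> carrier A \<and> p \<otimes>\<^bsub>A\<^esub> e = p" using a e_idem by simp
next
  assume "p \<in> carrier A \<and> p \<otimes>\<^bsub>A\<^esub> e = p"
  then show "p \<in> carrier Ae" unfolding left_ideal_module_simps by (intro CollectI exI[of _ p]) auto
qed

lemma left_module_Ae: "left_module A Ae"
  by (rule left_module_left_ideal) simp

lemma e_Ae: "e \<in> carrier Ae"
  unfolding Ae_iff using e_idem by simp

lemma Ae_mult: "\<lbrakk>a \<in> carrier A; p \<in> carrier Ae\<rbrakk> \<Longrightarrow> a \<otimes>\<^bsub>A\<^esub> p \<in> carrier Ae"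
  unfolding Ae_iff by (simp add: m_assoc)

lemma Ae_C: "p \<in> carrier Ae \<Longrightarrow> e \<otimes>\<^bsub>A\<^esub> p \<in> C"
  unfolding Ae_iff C_iff using e_idem by (simp add: m_assoc flip: m_assoc[of e e p])

lemma C_Ae: "c \<in> C \<Longrightarrow> c \<in> carrier Ae"
  unfolding Ae_iff C_iff by simp

lemma C_carrier: "c \<in> C \<Longrightarrow> c \<in> carrier A"
  by (simp add: C_iff)

lemma J_carrier: "J \<subseteq> carrier A"
  by (rule J.a_subset)

end

text \<open>A common frame for both inductions: the base is the input algebra with its embedding for
  \<open>Ind_sub\<close>, and the corner acting on \<open>U\<close> through \<open>pr\<close> for
  \<open>ind_quot\<close>. The assumption \<open>proj_balanced\<close> is the balance of the
  evaluation map defined below.\<close>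

locale strat_tensor = strat_layer K A D l + U: left_module "inp D l" U +
  t: balanced_pair R "left_ideal_module A (idem K D l)" rP V
  for K :: "'k ring" and A :: "('k, 'a) module" and D :: "('k, 'b, 'v, 'a) strat_data" and l :: nat
    and U :: "('b, 'x) module" and R :: "('r, 's) ring_scheme" and rP :: "'a \<Rightarrow> 'r \<Rightarrow> 'a"
    and V :: "('r, 'x) module" +
  assumes carrier_V: "carrier V = carrier U" and add_V: "ring.add V = ring.add U"
    and proj_balanced: "\<And>p c x. \<lbrakk>p \<in> carrier Ae; c \<in> carrier R; x \<in> carrier U\<rbrakk> \<Longrightarrow>
      pr (e \<otimes>\<^bsub>A\<^esub> rP p c) \<odot>\<^bsub>U\<^esub> x = pr (e \<otimes>\<^bsub>A\<^esub> p) \<odot>\<^bsub>U\<^esub> (c \<odot>\<^bsub>V\<^esub> x)"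
    and bimodule: "\<And>a p c. \<lbrakk>a \<in> carrier A; p \<in> carrier Ae; c \<in> carrier R\<rbrakk> \<Longrightarrow>
      a \<otimes>\<^bsub>A\<^esub> rP p c = rP (a \<otimes>\<^bsub>A\<^esub> p) c"
begin

sublocale W: left_module A t.TP
  by (rule t.left_module_TP[OF left_module_Ae]) (simp only: left_ideal_module_simps(4) bimodule)

lemma smult_pure: "\<lbrakk>a \<in> carrier A; p \<in> carrier Ae; x \<in> carrier U\<rbrakk> \<Longrightarrow>
    a \<odot>\<^bsub>t.TP\<^esub> t.pure p x = t.pure (a \<otimes>\<^bsub>A\<^esub> p) x"
  using t.smult_pure[OF left_module_Ae, of a p x] bimodule carrier_V
  by (simp only: left_ideal_module_simps(4))

text \<open>For \<open>p\<close> in \<open>A e\<close> the product \<open>e p\<close> lies in the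
  corner, so \<open>pr\<close> turns it into an element of the input algebra that can act on
  \<open>x\<close>. The resulting map realises the passage from the induced module back to
  \<open>U\<close>.\<close>

lemma Phi_exists: "\<exists>\<Phi>. add_hom t.TP U \<Phi> \<and>
    (\<forall>p\<in>carrier Ae. \<forall>x\<in>carrier U. \<Phi> (t.pure p x) = pr (e \<otimes>\<^bsub>A\<^esub> p) \<odot>\<^bsub>U\<^esub> x)"
proof (rule t.tensor_universal[of U "\<lambda>p x. pr (e \<otimes>\<^bsub>A\<^esub> p) \<odot>\<^bsub>U\<^esub> x"], unfold carrier_V add_V)
  show "abelian_group U" by (rule U.M.abelian_group_axioms)
next
  fix p x assume "p \<in> carrier Ae" "x \<in> carrier U"
  then show "pr (e \<otimes>\<^bsub>A\<^esub> p) \<odot>\<^bsub>U\<^esub> x \<in> carrier U" by (intro U.smult_closed proj_closed Ae_C)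
next
  fix p p' x assume p: "p \<in> carrier Ae" "p' \<in> carrier Ae" and x: "x \<in> carrier U"
  have "e \<otimes>\<^bsub>A\<^esub> (p \<oplus>\<^bsub>Ae\<^esub> p') = e \<otimes>\<^bsub>A\<^esub> p \<oplus>\<^bsub>A\<^esub> e \<otimes>\<^bsub>A\<^esub> p'"
    using p unfolding Ae_iff left_ideal_module_simps(3) by (intro r_distr) auto
  then show "pr (e \<otimes>\<^bsub>A\<^esub> (p \<oplus>\<^bsub>Ae\<^esub> p')) \<odot>\<^bsub>U\<^esub> x
      = pr (e \<otimes>\<^bsub>A\<^esub> p) \<odot>\<^bsub>U\<^esub> x \<oplus>\<^bsub>U\<^esub> pr (e \<otimes>\<^bsub>A\<^esub> p') \<odot>\<^bsub>U\<^esub> x"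
    using x by (simp only: proj_add[OF Ae_C[OF p(1)] Ae_C[OF p(2)]] U.smult_l_distr proj_closed Ae_C p)
next
  fix p x x' assume "p \<in> carrier Ae" "x \<in> carrier U" "x' \<in> carrier U"
  then show "pr (e \<otimes>\<^bsub>A\<^esub> p) \<odot>\<^bsub>U\<^esub> (x \<oplus>\<^bsub>U\<^esub> x')
      = pr (e \<otimes>\<^bsub>A\<^esub> p) \<odot>\<^bsub>U\<^esub> x \<oplus>\<^bsub>U\<^esub> pr (e \<otimes>\<^bsub>A\<^esub> p) \<odot>\<^bsub>U\<^esub> x'"
    by (simp only: U.smult_r_distr proj_closed Ae_C)
next
  fix p c x assume "p \<in> carrier Ae" "c \<in> carrier R" "x \<in> carrier U"
  then show "pr (e \<otimes>\<^bsub>A\<^esub> rP p c) \<odot>\<^bsub>U\<^esub> x = pr (e \<otimes>\<^bsub>A\<^esub> p) \<odot>\<^bsub>U\<^esub> (c \<odot>\<^bsub>V\<^esub> x)"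
    by (rule proj_balanced)
next
  fix h assume "add_hom t.TP U h"
    "\<And>p x. \<lbrakk>p \<in> carrier Ae; x \<in> carrier U\<rbrakk> \<Longrightarrow> h (t.pure p x) = pr (e \<otimes>\<^bsub>A\<^esub> p) \<odot>\<^bsub>U\<^esub> x"
  then show ?thesis by blast
qed

definition Phi :: "('a, 'x) tens \<Rightarrow> 'x"
  where "Phi = (SOME \<Phi>. add_hom t.TP U \<Phi> \<and>
    (\<forall>p\<in>carrier Ae. \<forall>x\<in>carrier U. \<Phi> (t.pure p x) = pr (e \<otimes>\<^bsub>A\<^esub> p) \<odot>\<^bsub>U\<^esub> x))"

lemma add_hom_Phi: "add_hom t.TP U Phi"
  and Phi_pure: "\<lbrakk>p \<in> carrier Ae; x \<in> carrier U\<rbrakk> \<Longrightarrow> Phi (t.pure p x) = pr (e \<otimes>\<^bsub>A\<^esub> p) \<odot>\<^bsub>U\<^esub> x"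
  using someI_ex[OF Phi_exists] unfolding Phi_def by blast+

lemmas Phi_closed = add_homD(1)[OF add_hom_Phi]
lemmas Phi_add = add_homD(2)[OF add_hom_Phi]
lemmas Phi_zero = add_hom_zero_minus(1)[OF t.abelian_group_TP U.M.abelian_group_axioms add_hom_Phi]
lemmas Phi_neg = add_hom_zero_minus(2)[OF t.abelian_group_TP U.M.abelian_group_axioms add_hom_Phi]
lemmas Phi_diff = add_hom_zero_minus(3)[OF t.abelian_group_TP U.M.abelian_group_axioms add_hom_Phi]

lemma Phi_C:
  assumes c: "c \<in> C" and w: "w \<in> carrier t.TP"
  shows "Phi (c \<odot>\<^bsub>t.TP\<^esub> w) = pr c \<odot>\<^bsub>U\<^esub> Phi w"
  using w
proof (induction rule: t.tensor_induct)
  case zero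
  then show ?case by (simp only: W.smult_r_zero[OF C_carrier[OF c]] Phi_zero U.smult_r_zero[OF proj_closed[OF c]])
next
  case (pure p x)
  then have x: "x \<in> carrier U" and p: "p \<in> carrier A" "e \<otimes>\<^bsub>A\<^esub> p \<in> C" "c \<otimes>\<^bsub>A\<^esub> p \<in> carrier Ae"
    using carrier_V Ae_C Ae_mult C_carrier[OF c] unfolding Ae_iff by auto
  \<comment> \<open>Both sides equal \<open>c p\<close>, because \<open>e\<close> is a two-sided
    unit for the corner.\<close>
  have "e \<otimes>\<^bsub>A\<^esub> (c \<otimes>\<^bsub>A\<^esub> p) = c \<otimes>\<^bsub>A\<^esub> (e \<otimes>\<^bsub>A\<^esub> p)"
    using c p unfolding C_iff by (metis m_assoc e_closed)
  then have "Phi (c \<odot>\<^bsub>t.TP\<^esub> t.pure p x) = pr (c \<otimes>\<^bsub>A\<^esub> (e \<otimes>\<^bsub>A\<^esub> p)) \<odot>\<^bsub>U\<^esub> x"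
    by (simp only: smult_pure[OF C_carrier[OF c] pure(1) x] Phi_pure[OF p(3) x])
  then show ?case
    by (simp only: proj_mult[OF c p(2)] U.smult_assoc[OF proj_closed[OF c] proj_closed[OF p(2)] x] Phi_pure[OF pure(1) x])
next
  case (diff t s)
  then show ?case
    by (simp only: W.smult_r_diff[OF C_carrier[OF c]] Phi_diff W.smult_closed[OF C_carrier[OF c]]
        U.smult_r_diff[OF proj_closed[OF c]] Phi_closed)
qed

lemma Phi_e: "w \<in> carrier t.TP \<Longrightarrow> Phi (e \<odot>\<^bsub>t.TP\<^esub> w) = Phi w"
  using Phi_C[OF e_C] proj_e U.smult_one Phi_closed by simp

text \<open>On a pure tensor the relevant element \<open>e j p\<close> lies in the corner and in
  \<open>J\<close>, where \<open>pr\<close> is zero.\<close>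

lemma Phi_J:
  assumes j: "j \<in> J" and w: "w \<in> carrier t.TP"
  shows "Phi (j \<odot>\<^bsub>t.TP\<^esub> w) = \<zero>\<^bsub>U\<^esub>"
proof -
  note jA = subsetD[OF J_carrier j]
  from w show ?thesis
  proof (induction rule: t.tensor_induct)
    case zero
    then show ?case by (simp only: W.smult_r_zero[OF jA] Phi_zero)
  next
    case (pure p x)
    then have x: "x \<in> carrier U" and p: "p \<in> carrier A" "j \<otimes>\<^bsub>A\<^esub> p \<in> carrier Ae"
      using carrier_V Ae_mult jA unfolding Ae_iff by auto
    have "e \<otimes>\<^bsub>A\<^esub> (j \<otimes>\<^bsub>A\<^esub> p) \<in> J" using j p by (intro J.I_l_closed J.I_r_closed) auto
    then have "pr (e \<otimes>\<^bsub>A\<^esub> (j \<otimes>\<^bsub>A\<^esub> p)) = \<zero>\<^bsub>B\<^esub>" using Ae_C[OF p(2)] by (intro proj_zero)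
    then show ?case
      by (simp only: smult_pure[OF jA pure(1) x] Phi_pure[OF p(2) x] U.smult_l_zero[OF x])
  next
    case (diff t s)
    then show ?case
      by (simp only: W.smult_r_diff[OF jA] Phi_diff W.smult_closed[OF jA]) (simp add: a_minus_def U.M.r_neg)
  qed
qed

lemma Phi_jspan: "k \<in> jspan J t.TP \<Longrightarrow> Phi k = \<zero>\<^bsub>U\<^esub>"
proof (induction rule: jspan.induct)
  case zero
  then show ?case by (rule Phi_zero)
next
  case (step j x y)
  have "j \<odot>\<^bsub>t.TP\<^esub> x \<in> carrier t.TP" using W.smult_closed step subsetD[OF J_carrier] by blast
  moreover have "y \<in> carrier t.TP" using W.jspan_closed[OF J.ideal_axioms] step by blast
  ultimately show ?case using Phi_J[OF step(1,2)] step(4) by (simp add: Phi_add)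
qed

text \<open>This is a section of \<open>Phi\<close>, which is therefore surjective for both
  inductions.\<close>

lemma Phi_pure_e: "x \<in> carrier U \<Longrightarrow> Phi (t.pure e x) = x"
  using Phi_pure[OF e_Ae] e_idem proj_e U.smult_one by simp

lemma pure_e_closed: "x \<in> carrier U \<Longrightarrow> t.pure e x \<in> carrier t.TP"
  using t.pure_closed[OF e_Ae] carrier_V by simp

end

section \<open>The two inductions and the module recovered from a summand\<close>

context strat_layer
begin

lemma strat_tensor_Ind:
  assumes U: "left_module B U"
  shows "strat_tensor K A D l U B (\<lambda>a b. a \<otimes>\<^bsub>A\<^esub> \<iota> b) U"
proof -
  interpret U: left_module B U by fact
  interpret Ae: left_module A Ae by (rule left_module_Ae)
  have r: "p \<otimes>\<^bsub>A\<^esub> \<iota> b \<in> carrier Ae" if "p \<in> carrier Ae" "b \<in> carrier B" for p b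
    using emb_C[OF that(2)] that by (intro Ae_mult C_Ae) (auto simp: Ae_iff simp del: left_ideal_module_simps(1))
  show ?thesis
  proof (intro strat_tensor.intro strat_tensor_axioms.intro strat_layer_axioms U balanced_pair.intro
      balanced_pair_axioms.intro Ae.M.abelian_group_axioms U.M.abelian_group_axioms r U.smult_closed refl)
    fix p b x assume p: "p \<in> carrier Ae" and b: "b \<in> carrier B" and x: "x \<in> carrier U"
    have "e \<otimes>\<^bsub>A\<^esub> (p \<otimes>\<^bsub>A\<^esub> \<iota> b) = (e \<otimes>\<^bsub>A\<^esub> p) \<otimes>\<^bsub>A\<^esub> \<iota> b"
      using p b unfolding Ae_iff by (intro m_assoc[symmetric]) auto
    then have "pr (e \<otimes>\<^bsub>A\<^esub> (p \<otimes>\<^bsub>A\<^esub> \<iota> b)) = pr (e \<otimes>\<^bsub>A\<^esub> p) \<otimes>\<^bsub>B\<^esub> b"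
      by (simp only: proj_mult[OF Ae_C[OF p] emb_C[OF b]] proj_emb[OF b])
    then show "pr (e \<otimes>\<^bsub>A\<^esub> (p \<otimes>\<^bsub>A\<^esub> \<iota> b)) \<odot>\<^bsub>U\<^esub> x = pr (e \<otimes>\<^bsub>A\<^esub> p) \<odot>\<^bsub>U\<^esub> (b \<odot>\<^bsub>U\<^esub> x)"
      by (simp only: U.smult_assoc[OF proj_closed[OF Ae_C[OF p]] b x])
  next
    fix a p c assume "a \<in> carrier A" "p \<in> carrier Ae" "c \<in> carrier B"
    then show "a \<otimes>\<^bsub>A\<^esub> (p \<otimes>\<^bsub>A\<^esub> \<iota> c) = a \<otimes>\<^bsub>A\<^esub> p \<otimes>\<^bsub>A\<^esub> \<iota> c"
      unfolding Ae_iff by (intro m_assoc[symmetric]) auto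
  qed
qed

lemma strat_tensor_ind:
  assumes U: "left_module B U"
  shows "strat_tensor K A D l U (corner A e) (monoid.mult A) (restrict_scalars pr U)"
proof -
  interpret U: left_module B U by fact
  interpret Ae: left_module A Ae by (rule left_module_Ae)
  have s: "carrier (restrict_scalars pr U) = carrier U" "ring.add (restrict_scalars pr U) = ring.add U"
    "\<zero>\<^bsub>restrict_scalars pr U\<^esub> = \<zero>\<^bsub>U\<^esub>" "\<And>c x. c \<odot>\<^bsub>restrict_scalars pr U\<^esub> x = pr c \<odot>\<^bsub>U\<^esub> x"
    by (simp_all add: restrict_scalars_def)
  have ab: "abelian_group (restrict_scalars pr U)"
    by (rule abelian_groupI_comm_group, rule comm_group_cong[OF U.M.a_comm_group]) (simp_all add: s)
  show ?thesis
  proof (intro strat_tensor.intro strat_tensor_axioms.intro strat_layer_axioms U balanced_pair.intro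
      balanced_pair_axioms.intro Ae.M.abelian_group_axioms ab s)
    fix p c assume "p \<in> carrier Ae" "c \<in> C"
    then show "p \<otimes>\<^bsub>A\<^esub> c \<in> carrier Ae"
      by (intro Ae_mult C_Ae) (auto simp: Ae_iff simp del: left_ideal_module_simps(1))
  next
    fix c x assume "c \<in> C" "x \<in> carrier (restrict_scalars pr U)"
    then show "c \<odot>\<^bsub>restrict_scalars pr U\<^esub> x \<in> carrier (restrict_scalars pr U)"
      unfolding s by (intro U.smult_closed proj_closed)
  next
    fix p c x assume p: "p \<in> carrier Ae" and c: "c \<in> C" and x: "x \<in> carrier U"
    have "e \<otimes>\<^bsub>A\<^esub> (p \<otimes>\<^bsub>A\<^esub> c) = (e \<otimes>\<^bsub>A\<^esub> p) \<otimes>\<^bsub>A\<^esub> c"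
      using p c unfolding Ae_iff C_iff by (intro m_assoc[symmetric]) auto
    then have "pr (e \<otimes>\<^bsub>A\<^esub> (p \<otimes>\<^bsub>A\<^esub> c)) = pr (e \<otimes>\<^bsub>A\<^esub> p) \<otimes>\<^bsub>B\<^esub> pr c"
      by (simp only: proj_mult[OF Ae_C[OF p] c])
    then show "pr (e \<otimes>\<^bsub>A\<^esub> (p \<otimes>\<^bsub>A\<^esub> c)) \<odot>\<^bsub>U\<^esub> x = pr (e \<otimes>\<^bsub>A\<^esub> p) \<odot>\<^bsub>U\<^esub> (c \<odot>\<^bsub>restrict_scalars pr U\<^esub> x)"
      unfolding s by (simp only: U.smult_assoc[OF proj_closed[OF Ae_C[OF p]] proj_closed[OF c] x])
  next
    fix a p c assume "a \<in> carrier A" "p \<in> carrier Ae" "c \<in> C"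
    then show "a \<otimes>\<^bsub>A\<^esub> (p \<otimes>\<^bsub>A\<^esub> c) = a \<otimes>\<^bsub>A\<^esub> p \<otimes>\<^bsub>A\<^esub> c"
      unfolding Ae_iff C_iff by (intro m_assoc[symmetric]) auto
  qed
qed

text \<open>
  The functor \<open>e(-) / e J (-)\<close> recovers \<open>U\<close> from \<open>Y(l, \<lambda>)\<close>; it is described by the following
  property of a map \<open>\<Psi>\<close>, which exhibits \<open>U\<close> as this subquotient of \<open>Y\<close>.
\<close>

definition top_map :: "('b, 'x) module \<Rightarrow> ('a, 'y) module \<Rightarrow> ('y \<Rightarrow> 'x) \<Rightarrow> bool"
  where "top_map U Y \<Psi> \<longleftrightarrow> add_hom Y U \<Psi> \<and> \<Psi> ` carrier Y = carrier U \<and>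
    (\<forall>c\<in>C. \<forall>y\<in>carrier Y. \<Psi> (c \<odot>\<^bsub>Y\<^esub> y) = pr c \<odot>\<^bsub>U\<^esub> \<Psi> y) \<and>
    (\<forall>y\<in>carrier Y. \<Psi> y = \<zero>\<^bsub>U\<^esub> \<longleftrightarrow> e \<odot>\<^bsub>Y\<^esub> y \<in> jspan J Y)"

text \<open>The kernel of a top map is expressed by the module structure of its source, so
  \<open>g\<close> matches the two kernels. Hence \<open>\<Psi>' \<circ> g\<close> takes equal
  values wherever \<open>\<Psi>\<close> does, and it induces a bijection from \<open>U\<close> to
  \<open>U'\<close>.\<close>

lemma top_map_iso:
  assumes U: "left_module B U" and U': "left_module B U'" and Y: "left_module A Y" and Y': "left_module A Y'"
    and \<Psi>: "top_map U Y \<Psi>" and \<Psi>': "top_map U' Y' \<Psi>'" and iso: "module_isomorphic A Y Y'"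
  shows "module_isomorphic B U U'"
proof -
  interpret U: left_module B U by fact
  interpret U': left_module B U' by fact
  interpret Y: left_module A Y by fact
  interpret Y': left_module A Y' by fact
  obtain g where g: "g \<in> module_homs A Y Y'" "bij_betw g (carrier Y) (carrier Y')"
    using iso by (auto simp: module_isomorphic_def)
  let ?g' = "inv_into (carrier Y) g"
  have g': "?g' \<in> module_homs A Y' Y" by (rule module_homs_inverse[OF Y g])
  have P: "add_hom Y U \<Psi>" "add_hom Y' U' \<Psi>'" using \<Psi> \<Psi>' by (auto simp: top_map_def)
  note Pd = add_hom_zero_minus(3)[OF Y.M.abelian_group_axioms U.M.abelian_group_axioms P(1)]
  note Pd' = add_hom_zero_minus(3)[OF Y'.M.abelian_group_axioms U'.M.abelian_group_axioms P(2)]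
  note gd = add_hom_zero_minus(3)[OF Y.M.abelian_group_axioms Y'.M.abelian_group_axioms add_hom_module_homs[OF g(1)]]
  note gc = module_homsD(1)[OF g(1)]
  note Pc = add_homD(1)[OF P(1)] and Pc' = add_homD(1)[OF P(2)]
  have zero: "\<Psi>' (g y) = \<zero>\<^bsub>U'\<^esub> \<longleftrightarrow> \<Psi> y = \<zero>\<^bsub>U\<^esub>" if y: "y \<in> carrier Y" for y
  proof -
    have ey: "e \<odot>\<^bsub>Y\<^esub> y \<in> carrier Y" using y by (simp add: Y.smult_closed)
    have ge: "g (e \<odot>\<^bsub>Y\<^esub> y) = e \<odot>\<^bsub>Y'\<^esub> g y" by (rule module_homsD(3)[OF g(1) e_closed y])
    have "e \<odot>\<^bsub>Y'\<^esub> g y \<in> jspan J Y' \<longleftrightarrow> e \<odot>\<^bsub>Y\<^esub> y \<in> jspan J Y"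
    proof
      assume "e \<odot>\<^bsub>Y'\<^esub> g y \<in> jspan J Y'"
      then have "?g' (g (e \<odot>\<^bsub>Y\<^esub> y)) \<in> jspan J Y"
        unfolding ge by (rule Y'.jspan_hom[OF J.ideal_axioms g' Y.M.abelian_group_axioms])
      then show "e \<odot>\<^bsub>Y\<^esub> y \<in> jspan J Y" using bij_betw_inv_into_left[OF g(2) ey] by simp
    next
      assume "e \<odot>\<^bsub>Y\<^esub> y \<in> jspan J Y"
      then show "e \<odot>\<^bsub>Y'\<^esub> g y \<in> jspan J Y'"
        unfolding ge[symmetric] by (rule Y.jspan_hom[OF J.ideal_axioms g(1) Y'.M.abelian_group_axioms])
    qed
    then show ?thesis using \<Psi> \<Psi>' y gc[OF y] by (simp add: top_map_def)
  qed
  have eq: "\<Psi>' (g y) = \<Psi>' (g z) \<longleftrightarrow> \<Psi> y = \<Psi> z" if y: "y \<in> carrier Y" "z \<in> carrier Y" for y z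
  proof -
    have "\<Psi>' (g y) \<ominus>\<^bsub>U'\<^esub> \<Psi>' (g z) = \<zero>\<^bsub>U'\<^esub> \<longleftrightarrow> \<Psi> y \<ominus>\<^bsub>U\<^esub> \<Psi> z = \<zero>\<^bsub>U\<^esub>"
      using zero[of "y \<ominus>\<^bsub>Y\<^esub> z"] y gc by (simp only: gd Pd Pd' Y.M.minus_closed)
    then show ?thesis
      using U.M.eq_of_diff U'.M.eq_of_diff Pc Pc' gc y by (metis U.M.r_neg U'.M.r_neg a_minus_def)
  qed
  have "\<exists>y. y \<in> carrier Y \<and> \<Psi> y = x" if "x \<in> carrier U" for x
    using \<Psi> that unfolding top_map_def by (metis imageE)
  \<comment> \<open>An arbitrary choice of preimages under \<open>\<Psi>\<close>; the preceding fact
    makes the induced map independent of it.\<close>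
  then obtain s where s: "\<And>x. x \<in> carrier U \<Longrightarrow> s x \<in> carrier Y" "\<And>x. x \<in> carrier U \<Longrightarrow> \<Psi> (s x) = x"
    by metis
  define \<theta> where "\<theta> x = \<Psi>' (g (s x))" for x
  have \<theta>: "\<theta> (\<Psi> y) = \<Psi>' (g y)" if "y \<in> carrier Y" for y
    unfolding \<theta>_def using eq[OF s(1) that] s(2) Pc that by metis
  have "\<theta> \<in> module_homs B U U'"
    unfolding module_homs_def
  proof (intro CollectI conjI ballI funcsetI)
    fix x assume "x \<in> carrier U"
    then show "\<theta> x \<in> carrier U'" unfolding \<theta>_def by (intro Pc' gc s)
  next
    fix x y assume xy: "x \<in> carrier U" "y \<in> carrier U"
    have "\<theta> (\<Psi> (s x \<oplus>\<^bsub>Y\<^esub> s y)) = \<Psi>' (g (s x)) \<oplus>\<^bsub>U'\<^esub> \<Psi>' (g (s y))"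
      using s(1)[OF xy(1)] s(1)[OF xy(2)]
      by (simp only: \<theta> Y.M.a_closed module_homsD(2)[OF g(1)] add_homD(2)[OF P(2)] gc)
    then show "\<theta> (x \<oplus>\<^bsub>U\<^esub> y) = \<theta> x \<oplus>\<^bsub>U'\<^esub> \<theta> y"
      using s xy by (simp only: add_homD(2)[OF P(1)] \<theta>_def)
  next
    fix b x assume bx: "b \<in> carrier B" "x \<in> carrier U"
    \<comment> \<open>Elements of the input algebra act on \<open>Y\<close> through their images in
      the corner, and \<open>pr\<close> undoes the embedding.\<close>
    have "\<Psi> (\<iota> b \<odot>\<^bsub>Y\<^esub> s x) = b \<odot>\<^bsub>U\<^esub> x"
      using \<Psi> emb_C[OF bx(1)] s bx proj_emb[OF bx(1)] by (simp add: top_map_def)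
    moreover have "\<theta> (\<Psi> (\<iota> b \<odot>\<^bsub>Y\<^esub> s x)) = \<Psi>' (\<iota> b \<odot>\<^bsub>Y'\<^esub> g (s x))"
      using \<theta> Y.smult_closed emb_closed[OF bx(1)] s(1)[OF bx(2)] module_homsD(3)[OF g(1)] by simp
    moreover have "\<Psi>' (\<iota> b \<odot>\<^bsub>Y'\<^esub> g (s x)) = b \<odot>\<^bsub>U'\<^esub> \<theta> x"
      using \<Psi>' emb_C[OF bx(1)] gc[OF s(1)[OF bx(2)]] proj_emb[OF bx(1)] by (simp add: top_map_def \<theta>_def)
    ultimately show "\<theta> (b \<odot>\<^bsub>U\<^esub> x) = b \<odot>\<^bsub>U'\<^esub> \<theta> x" by simp
  qed
  moreover have "bij_betw \<theta> (carrier U) (carrier U')"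
    unfolding bij_betw_def
  proof (intro conjI inj_onI equalityI subsetI)
    fix x y assume xy: "x \<in> carrier U" "y \<in> carrier U" "\<theta> x = \<theta> y"
    then have "\<Psi> (s x) = \<Psi> (s y)" using eq s(1) unfolding \<theta>_def by metis
    then show "x = y" using s(2) xy by simp
  next
    fix x assume "x \<in> \<theta> ` carrier U"
    then show "x \<in> carrier U'" unfolding \<theta>_def using Pc' gc s by blast
  next
    fix x assume "x \<in> carrier U'"
    then obtain y' where y': "y' \<in> carrier Y'" "x = \<Psi>' y'" using \<Psi>' unfolding top_map_def by (metis imageE)
    then obtain y where y: "y \<in> carrier Y" "y' = g y" using g(2) unfolding bij_betw_def by (metis imageE)
    then have "x = \<theta> (\<Psi> y)" using \<theta> y' by simp
    then show "x \<in> \<theta> ` carrier U" using Pc[OF y(1)] by blast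
  qed
  ultimately show ?thesis unfolding module_isomorphic_def by blast
qed

text \<open>The map is \<open>Phi\<close> restricted to the summand \<open>N\<close>. Its kernel on
  the whole induced module is computed first and then cut down to \<open>N\<close> by the
  projection. Indecomposability of \<open>U\<close> together with the quotient
  \<open>ind_quot\<close> gives surjectivity on \<open>N\<close>.\<close>

lemma top_map_exists:
  assumes U: "left_module B U" and ind: "indecomposable B U" and Y: "strat_young_module K A D l U Y"
  obtains \<Psi> where "top_map U Y \<Psi>"
proof -
  interpret W: strat_tensor K A D l U B "\<lambda>a b. a \<otimes>\<^bsub>A\<^esub> \<iota> b" U by (rule strat_tensor_Ind[OF U])
  interpret X: strat_tensor K A D l U "corner A e" "monoid.mult A" "restrict_scalars pr U"
    by (rule strat_tensor_ind[OF U])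
  let ?W = "W.t.TP" and ?X = "X.t.TP"
  have W: "Ind_sub K A D l U = ?W" and X: "ind_quot K A D l U = ?X"
    by (simp_all only: Ind_sub_def ind_quot_def)
  interpret Y: left_module A Y using Y by (simp add: strat_young_module_def)
  obtain N N' f where c: "complementary A ?W N N'"
    and f: "f \<in> module_homs A Y (?W\<lparr>carrier := N\<rparr>)" "bij_betw f (carrier Y) (carrier (?W\<lparr>carrier := N\<rparr>))"
    using Y unfolding strat_young_module_def W direct_summand_def module_isomorphic_def by blast
  obtain Q h where Q: "submodule Q A Y"
    and h: "h \<in> module_homs A (quotient_module Y Q) ?X" "bij_betw h (carrier (quotient_module Y Q)) (carrier ?X)"
    using Y unfolding strat_young_module_def X module_isomorphic_def by blast
  have N: "submodule N A ?W" "submodule N' A ?W" using c by (auto simp: complementary_def)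
  note Nc = subsetD[OF W.W.submoduleD(1)[OF N(1)]] and Nc' = subsetD[OF W.W.submoduleD(1)[OF N(2)]]
  interpret N: left_module A "?W\<lparr>carrier := N\<rparr>" by (rule W.W.submodule_left_module[OF N(1)])
  obtain p where p: "p \<in> module_homs A ?W (?W\<lparr>carrier := N\<rparr>)" "\<And>x. x \<in> N \<Longrightarrow> p x = x"
    "\<And>x. x \<in> N' \<Longrightarrow> p x = \<zero>\<^bsub>?W\<^esub>"
    using W.W.complementary_projection[OF c] by blast
  have N_W: "(\<lambda>x. x) \<in> module_homs A (?W\<lparr>carrier := N\<rparr>) ?W"
    using Nc by (auto simp: module_homs_def)
  have pure0: "W.t.pure e \<zero>\<^bsub>U\<^esub> = \<zero>\<^bsub>?W\<^esub>"
    by (rule add_hom_zero_minus(1)[OF W.U.M.abelian_group_axioms W.t.abelian_group_TP W.t.add_hom_pure_right[OF e_Ae]])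
  \<comment> \<open>Modulo \<open>J W\<close>, the element \<open>e w\<close> is determined by
    \<open>Phi w\<close>. On a pure tensor \<open>e a\<close> splits as \<open>\<iota> b + j\<close>
    with \<open>j\<close> in \<open>J\<close>, and \<open>b\<close> moves across the tensor
    sign.\<close>
  have kernel: "\<exists>k\<in>jspan J ?W. e \<odot>\<^bsub>?W\<^esub> w = W.t.pure e (W.Phi w) \<oplus>\<^bsub>?W\<^esub> k" if "w \<in> carrier ?W" for w
    using that
  proof (induction rule: W.t.tensor_induct)
    case zero
    have "e \<odot>\<^bsub>?W\<^esub> \<zero>\<^bsub>?W\<^esub> = W.t.pure e (W.Phi \<zero>\<^bsub>?W\<^esub>) \<oplus>\<^bsub>?W\<^esub> \<zero>\<^bsub>?W\<^esub>"
      by (simp add: W.Phi_zero pure0 W.W.smult_r_zero)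
    then show ?case using jspan.zero by blast
  next
    case (pure a x)
    define b where "b = pr (e \<otimes>\<^bsub>A\<^esub> a)"
    define j where "j = e \<otimes>\<^bsub>A\<^esub> a \<ominus>\<^bsub>A\<^esub> \<iota> b"
    have ea: "e \<otimes>\<^bsub>A\<^esub> a \<in> C" by (rule Ae_C[OF pure(1)])
    have b: "b \<in> carrier B" unfolding b_def by (rule proj_closed[OF ea])
    have jJ: "j \<in> J" unfolding j_def b_def by (rule proj_J[OF ea])
    have j: "j \<in> carrier A" "j \<otimes>\<^bsub>A\<^esub> e = j"
      using C_carrier[OF ea] ea emb_C[OF b] b unfolding C_iff
      by (simp_all add: j_def a_minus_def l_distr l_minus)
    have jAe: "j \<in> carrier Ae" using j unfolding Ae_iff by simp
    have eb: "e \<otimes>\<^bsub>A\<^esub> \<iota> b = \<iota> b" using emb_C[OF b] by (simp add: C_iff)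
    have "\<iota> b \<oplus>\<^bsub>Ae\<^esub> j = e \<otimes>\<^bsub>A\<^esub> a"
      using C_carrier[OF ea] b by (simp add: j_def a_minus_def a_lcomm[of "\<iota> b"] r_neg)
    then have "e \<odot>\<^bsub>?W\<^esub> W.t.pure a x = W.t.pure (\<iota> b \<oplus>\<^bsub>Ae\<^esub> j) x"
      using W.smult_pure[OF e_closed pure] by simp
    also have "\<dots> = W.t.pure (\<iota> b) x \<oplus>\<^bsub>?W\<^esub> W.t.pure j x"
      by (rule W.t.pure_add_left[OF C_Ae[OF emb_C[OF b]] jAe pure(2)])
    also have "W.t.pure (\<iota> b) x = W.t.pure e (b \<odot>\<^bsub>U\<^esub> x)"
      using W.t.pure_balanced[OF e_Ae b pure(2)] eb by simp
    also have "b \<odot>\<^bsub>U\<^esub> x = W.Phi (W.t.pure a x)"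
      unfolding b_def by (rule W.Phi_pure[OF pure, symmetric])
    \<comment> \<open>Because \<open>j = j e\<close>, the tensor of \<open>j\<close> and
      \<open>x\<close> is \<open>j\<close> times the tensor of \<open>e\<close> and
      \<open>x\<close>, so it lies in \<open>J W\<close>.\<close>
    also have "W.t.pure j x = j \<odot>\<^bsub>?W\<^esub> W.t.pure e x"
      using W.smult_pure[OF j(1) e_Ae pure(2)] j(2) by simp
    finally show ?case
      using W.W.jspan_gen[OF J.ideal_axioms jJ W.pure_e_closed[OF pure(2)]] by blast
  next
    case (diff t s)
    obtain k k' where k: "k \<in> jspan J ?W" "e \<odot>\<^bsub>?W\<^esub> t = W.t.pure e (W.Phi t) \<oplus>\<^bsub>?W\<^esub> k"
      and k': "k' \<in> jspan J ?W" "e \<odot>\<^bsub>?W\<^esub> s = W.t.pure e (W.Phi s) \<oplus>\<^bsub>?W\<^esub> k'"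
      using diff by blast
    have cl: "W.t.pure e (W.Phi t) \<in> carrier ?W" "W.t.pure e (W.Phi s) \<in> carrier ?W" "k \<in> carrier ?W" "k' \<in> carrier ?W"
      using W.pure_e_closed W.Phi_closed diff(1,2) W.W.jspan_closed[OF J.ideal_axioms] k(1) k'(1) by auto
    have "e \<odot>\<^bsub>?W\<^esub> (t \<ominus>\<^bsub>?W\<^esub> s) = (W.t.pure e (W.Phi t) \<oplus>\<^bsub>?W\<^esub> k) \<ominus>\<^bsub>?W\<^esub> (W.t.pure e (W.Phi s) \<oplus>\<^bsub>?W\<^esub> k')"
      by (simp only: W.W.smult_r_diff[OF e_closed diff(1,2)] k(2) k'(2))
    also have "\<dots> = (W.t.pure e (W.Phi t) \<ominus>\<^bsub>?W\<^esub> W.t.pure e (W.Phi s)) \<oplus>\<^bsub>?W\<^esub> (k \<ominus>\<^bsub>?W\<^esub> k')"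
      using cl by (simp add: a_minus_def W.t.TP.minus_add W.t.TP.a_assoc W.t.TP.a_lcomm[of k])
    also have "W.t.pure e (W.Phi t) \<ominus>\<^bsub>?W\<^esub> W.t.pure e (W.Phi s) = W.t.pure e (W.Phi (t \<ominus>\<^bsub>?W\<^esub> s))"
      by (simp only: W.Phi_diff[OF diff(1,2)] add_hom_zero_minus(3)[OF W.U.M.abelian_group_axioms
            W.t.abelian_group_TP W.t.add_hom_pure_right[OF e_Ae] W.Phi_closed[OF diff(1)] W.Phi_closed[OF diff(2)]])
    finally show ?case using W.W.jspan_diff[OF J.ideal_axioms k(1) k'(1)] by blast
  qed
  have ker: "e \<odot>\<^bsub>?W\<^esub> w \<in> jspan J ?W" if w: "w \<in> carrier ?W" "W.Phi w = \<zero>\<^bsub>U\<^esub>" for w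
  proof -
    obtain k where k: "k \<in> jspan J ?W" "e \<odot>\<^bsub>?W\<^esub> w = \<zero>\<^bsub>?W\<^esub> \<oplus>\<^bsub>?W\<^esub> k"
      using kernel[OF w(1)] unfolding w(2) pure0 by blast
    then show ?thesis using W.W.jspan_closed[OF J.ideal_axioms k(1)] by simp
  qed
  \<comment> \<open>The element is first treated in the whole induced module, where
    \<open>e (n - n')\<close> lies in \<open>J W\<close>. The projection onto \<open>N\<close>
    removes \<open>n'\<close> and maps \<open>J W\<close> into \<open>J N\<close>.\<close>
  have kerN: "e \<odot>\<^bsub>?W\<^esub> n \<in> jspan J (?W\<lparr>carrier := N\<rparr>)"
    if n: "n \<in> N" and n': "n' \<in> N'" "W.Phi (n \<ominus>\<^bsub>?W\<^esub> n') = \<zero>\<^bsub>U\<^esub>" for n n'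
  proof -
    let ?w = "n \<ominus>\<^bsub>?W\<^esub> n'"
    have w: "?w \<in> carrier ?W" using Nc[OF n] Nc'[OF n'(1)] by simp
    have "n = ?w \<oplus>\<^bsub>?W\<^esub> n'" using Nc[OF n] Nc'[OF n'(1)] by (simp add: a_minus_def W.t.TP.a_assoc W.t.TP.l_neg)
    then have "n = p (?w \<oplus>\<^bsub>?W\<^esub> n')" using p(2)[OF n] by simp
    also have "\<dots> = p ?w \<oplus>\<^bsub>?W\<^esub> p n'" using module_homsD(2)[OF p(1) w Nc'[OF n'(1)]] by simp
    also have "\<dots> = p ?w" using p(3)[OF n'(1)] module_homsD(1)[OF p(1) w] Nc by simp
    finally have pw: "p ?w = n" by simp
    have "p (e \<odot>\<^bsub>?W\<^esub> ?w) \<in> jspan J (?W\<lparr>carrier := N\<rparr>)"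
      by (rule W.W.jspan_hom[OF J.ideal_axioms p(1) N.M.abelian_group_axioms ker[OF w n'(2)]])
    then show ?thesis using module_homsD(3)[OF p(1) e_closed w] pw by simp
  qed
  have PhiN: "W.Phi n = \<zero>\<^bsub>U\<^esub> \<longleftrightarrow> e \<odot>\<^bsub>?W\<^esub> n \<in> jspan J (?W\<lparr>carrier := N\<rparr>)" if n: "n \<in> N" for n
  proof
    assume "W.Phi n = \<zero>\<^bsub>U\<^esub>"
    moreover have "n \<ominus>\<^bsub>?W\<^esub> \<zero>\<^bsub>?W\<^esub> = n" using Nc[OF n] by (simp add: a_minus_def W.t.TP.neg_zero)
    ultimately show "e \<odot>\<^bsub>?W\<^esub> n \<in> jspan J (?W\<lparr>carrier := N\<rparr>)"
      using kerN[OF n W.W.submoduleD(2)[OF N(2)]] by simp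
  next
    assume "e \<odot>\<^bsub>?W\<^esub> n \<in> jspan J (?W\<lparr>carrier := N\<rparr>)"
    then have "e \<odot>\<^bsub>?W\<^esub> n \<in> jspan J ?W"
      by (rule N.jspan_hom[OF J.ideal_axioms N_W W.t.abelian_group_TP])
    then show "W.Phi n = \<zero>\<^bsub>U\<^esub>" using W.Phi_jspan W.Phi_e[OF Nc[OF n]] by simp
  qed
  have sub: "submodule (W.Phi ` M) B U" if M: "submodule M A ?W" for M
  proof (rule W.U.submoduleI')
    note Mc = subsetD[OF W.W.submoduleD(1)[OF M]]
    show "W.Phi ` M \<subseteq> carrier U" using Mc W.Phi_closed by blast
    show "\<zero>\<^bsub>U\<^esub> \<in> W.Phi ` M"
      using imageI[OF W.W.submoduleD(2)[OF M], of W.Phi] W.Phi_zero by simp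
    show "\<ominus>\<^bsub>U\<^esub> x \<in> W.Phi ` M" if x: "x \<in> W.Phi ` M" for x
    proof -
      obtain a where a: "a \<in> M" "x = W.Phi a" using x by blast
      then have "\<ominus>\<^bsub>U\<^esub> x = W.Phi (\<ominus>\<^bsub>?W\<^esub> a)" using W.Phi_neg[OF Mc] by simp
      then show ?thesis using W.W.submoduleD(3)[OF M a(1)] by blast
    qed
    show "x \<oplus>\<^bsub>U\<^esub> y \<in> W.Phi ` M" if xy: "x \<in> W.Phi ` M" "y \<in> W.Phi ` M" for x y
    proof -
      obtain a b where a: "a \<in> M" "x = W.Phi a" "b \<in> M" "y = W.Phi b" using xy by blast
      then have "x \<oplus>\<^bsub>U\<^esub> y = W.Phi (a \<oplus>\<^bsub>?W\<^esub> b)" using W.Phi_add[OF Mc Mc] by simp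
      then show ?thesis using W.W.submoduleD(4)[OF M a(1,3)] by blast
    qed
    show "b \<odot>\<^bsub>U\<^esub> x \<in> W.Phi ` M" if bx: "b \<in> carrier B" "x \<in> W.Phi ` M" for b x
    proof -
      obtain a where a: "a \<in> M" "x = W.Phi a" using bx by blast
      have "W.Phi (\<iota> b \<odot>\<^bsub>?W\<^esub> a) = b \<odot>\<^bsub>U\<^esub> x"
        using W.Phi_C[OF emb_C[OF bx(1)] Mc[OF a(1)]] proj_emb[OF bx(1)] a(2) by simp
      moreover have "W.Phi (\<iota> b \<odot>\<^bsub>?W\<^esub> a) \<in> W.Phi ` M"
        by (rule imageI) (rule W.W.submoduleD(6)[OF M emb_closed[OF bx(1)] a(1)])
      ultimately show ?thesis by simp
    qed
  qed
  \<comment> \<open>A common value of \<open>Phi\<close> at \<open>n\<close> and \<open>n'\<close>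
    forces \<open>e n\<close> into \<open>J N\<close>, so that the value is zero. The sum is
    everything because the tensor of \<open>e\<close> and \<open>x\<close> splits along
    \<open>N\<close> and \<open>N'\<close>.\<close>
  have compl: "complementary B U (W.Phi ` N) (W.Phi ` N')"
    unfolding complementary_def
  proof (intro conjI sub N)
    have "y = \<zero>\<^bsub>U\<^esub>" if y: "y \<in> W.Phi ` N" "y \<in> W.Phi ` N'" for y
    proof -
      obtain n n' where n: "n \<in> N" "y = W.Phi n" and n': "n' \<in> N'" "y = W.Phi n'" using y by blast
      have "W.Phi (n \<ominus>\<^bsub>?W\<^esub> n') = y \<ominus>\<^bsub>U\<^esub> y"
        using W.Phi_diff[OF Nc[OF n(1)] Nc'[OF n'(1)]] n(2)[symmetric] n'(2)[symmetric] by simp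
      also have "\<dots> = \<zero>\<^bsub>U\<^esub>" using W.Phi_closed[OF Nc[OF n(1)]] n(2) by (simp add: a_minus_def W.U.M.r_neg)
      finally have "e \<odot>\<^bsub>?W\<^esub> n \<in> jspan J (?W\<lparr>carrier := N\<rparr>)" by (rule kerN[OF n(1) n'(1)])
      then show ?thesis using PhiN[OF n(1)] n(2) by simp
    qed
    then show "W.Phi ` N \<inter> W.Phi ` N' = {\<zero>\<^bsub>U\<^esub>}"
      using W.U.submoduleD(2)[OF sub[OF N(1)]] W.U.submoduleD(2)[OF sub[OF N(2)]] by blast
    show "W.Phi ` N <+>\<^bsub>U\<^esub> W.Phi ` N' = carrier U"
    proof (intro equalityI subsetI)
      fix x assume "x \<in> W.Phi ` N <+>\<^bsub>U\<^esub> W.Phi ` N'"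
      then obtain n n' where "n \<in> N" "n' \<in> N'" "x = W.Phi n \<oplus>\<^bsub>U\<^esub> W.Phi n'" by (auto simp: set_add_def')
      then show "x \<in> carrier U" using W.Phi_closed[OF Nc] W.Phi_closed[OF Nc'] by simp
    next
      fix x assume x: "x \<in> carrier U"
      obtain n n' where n: "n \<in> N" "n' \<in> N'" "W.t.pure e x = n \<oplus>\<^bsub>?W\<^esub> n'"
        by (rule W.W.complementary_decomp[OF c W.pure_e_closed[OF x]])
      have "x = W.Phi n \<oplus>\<^bsub>U\<^esub> W.Phi n'"
        using W.Phi_pure_e[OF x] n(3) W.Phi_add[OF Nc[OF n(1)] Nc'[OF n(2)]] by simp
      then show "x \<in> W.Phi ` N <+>\<^bsub>U\<^esub> W.Phi ` N'" using n(1,2) by (auto simp: set_add_def')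
    qed
  qed
  then have cases: "W.Phi ` N = {\<zero>\<^bsub>U\<^esub>} \<or> W.Phi ` N' = {\<zero>\<^bsub>U\<^esub>}"
    using ind by (simp add: indecomposable_def)
  define \<Psi> where "\<Psi> y = W.Phi (f y)" for y
  have fN: "f y \<in> N" if "y \<in> carrier Y" for y using module_homsD(1)[OF f(1) that] by simp
  have fe: "f (a \<odot>\<^bsub>Y\<^esub> y) = a \<odot>\<^bsub>?W\<^esub> f y" if "a \<in> carrier A" "y \<in> carrier Y" for a y
    using module_homsD(3)[OF f(1) that] by simp
  have zero: "\<Psi> y = \<zero>\<^bsub>U\<^esub> \<longleftrightarrow> e \<odot>\<^bsub>Y\<^esub> y \<in> jspan J Y" if y: "y \<in> carrier Y" for y
  proof -
    have ey: "e \<odot>\<^bsub>Y\<^esub> y \<in> carrier Y" using y by (simp add: Y.smult_closed)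
    have "e \<odot>\<^bsub>?W\<^esub> f y \<in> jspan J (?W\<lparr>carrier := N\<rparr>) \<longleftrightarrow> e \<odot>\<^bsub>Y\<^esub> y \<in> jspan J Y"
    proof
      assume "e \<odot>\<^bsub>?W\<^esub> f y \<in> jspan J (?W\<lparr>carrier := N\<rparr>)"
      then have "inv_into (carrier Y) f (f (e \<odot>\<^bsub>Y\<^esub> y)) \<in> jspan J Y"
        unfolding fe[OF e_closed y]
        by (rule N.jspan_hom[OF J.ideal_axioms module_homs_inverse[OF Y.left_module f] Y.M.abelian_group_axioms])
      then show "e \<odot>\<^bsub>Y\<^esub> y \<in> jspan J Y" using bij_betw_inv_into_left[OF f(2) ey] by simp
    next
      assume "e \<odot>\<^bsub>Y\<^esub> y \<in> jspan J Y"
      then show "e \<odot>\<^bsub>?W\<^esub> f y \<in> jspan J (?W\<lparr>carrier := N\<rparr>)"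
        unfolding fe[OF e_closed y, symmetric]
        by (rule Y.jspan_hom[OF J.ideal_axioms f(1) N.M.abelian_group_axioms])
    qed
    then show ?thesis unfolding \<Psi>_def using PhiN[OF fN[OF y]] by simp
  qed
  \<comment> \<open>If \<open>Phi\<close> vanished on \<open>N\<close>, then \<open>e y\<close>
    would lie in \<open>J Y\<close> for all \<open>y\<close>. This passes to the quotient
    \<open>ind_quot\<close>, whose own evaluation would be zero although it sends the tensor of
    \<open>e\<close> and \<open>x\<close> to \<open>x\<close>.\<close>
  have "W.Phi ` N \<noteq> {\<zero>\<^bsub>U\<^esub>}"
  proof
    assume N0: "W.Phi ` N = {\<zero>\<^bsub>U\<^esub>}"
    have "x = \<zero>\<^bsub>U\<^esub>" if x: "x \<in> carrier U" for x
    proof -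
      have "X.t.pure e x \<in> h ` carrier (quotient_module Y Q)"
        unfolding bij_betw_imp_surj_on[OF h(2)] by (rule X.pure_e_closed[OF x])
      then obtain C' where C': "X.t.pure e x = h C'" "C' \<in> carrier (quotient_module Y Q)"
        by (rule imageE)
      obtain y where y: "C' = Q +>\<^bsub>Y\<^esub> y" "y \<in> carrier Y"
        using C'(2) unfolding Y.quotient_hom(2)[OF Q, symmetric] by (rule imageE)
      let ?\<pi> = "\<lambda>y. h (Q +>\<^bsub>Y\<^esub> y)"
      have \<pi>: "?\<pi> \<in> module_homs A Y ?X"
        by (rule module_homs_comp[OF Y.quotient_hom(1)[OF Q] h(1)])
      have "\<Psi> y = \<zero>\<^bsub>U\<^esub>" unfolding \<Psi>_def using imageI[OF fN[OF y(2)], of W.Phi] N0 by simp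
      then have "e \<odot>\<^bsub>Y\<^esub> y \<in> jspan J Y" using zero[OF y(2)] by simp
      then have "?\<pi> (e \<odot>\<^bsub>Y\<^esub> y) \<in> jspan J ?X"
        by (rule Y.jspan_hom[OF J.ideal_axioms \<pi> X.t.abelian_group_TP])
      then have "e \<odot>\<^bsub>?X\<^esub> X.t.pure e x \<in> jspan J ?X"
        using module_homsD(3)[OF \<pi> e_closed y(2)] C'(1)[unfolded y(1)] by simp
      then have "X.Phi (X.t.pure e x) = \<zero>\<^bsub>U\<^esub>"
        using X.Phi_jspan X.Phi_e[OF X.pure_e_closed[OF x]] by simp
      then show ?thesis using X.Phi_pure_e[OF x] by simp
    qed
    then have "carrier U = {\<zero>\<^bsub>U\<^esub>}" using W.U.M.zero_closed by blast
    then show False using ind by (simp add: indecomposable_def)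
  qed
  then have N0: "W.Phi ` N' = {\<zero>\<^bsub>U\<^esub>}" using cases by blast
  have surj: "W.Phi ` N = carrier U"
  proof (intro equalityI subsetI)
    fix x assume "x \<in> carrier U"
    then obtain n z where "n \<in> W.Phi ` N" "z \<in> W.Phi ` N'" "x = n \<oplus>\<^bsub>U\<^esub> z"
      by (rule W.U.complementary_decomp[OF compl])
    then show "x \<in> W.Phi ` N" using N0 W.U.submoduleD(1)[OF sub[OF N(1)]] by auto
  qed (use W.U.submoduleD(1)[OF sub[OF N(1)]] in blast)
  have "top_map U Y \<Psi>"
    unfolding top_map_def
  proof (intro conjI ballI zero)
    show "add_hom Y U \<Psi>"
      unfolding add_hom_def \<Psi>_def
    proof (intro conjI ballI funcsetI)
      fix x assume "x \<in> carrier Y"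
      then show "W.Phi (f x) \<in> carrier U" by (intro W.Phi_closed Nc fN)
    next
      fix x y assume xy: "x \<in> carrier Y" "y \<in> carrier Y"
      have "f (x \<oplus>\<^bsub>Y\<^esub> y) = f x \<oplus>\<^bsub>?W\<^esub> f y" using module_homsD(2)[OF f(1) xy] by simp
      then show "W.Phi (f (x \<oplus>\<^bsub>Y\<^esub> y)) = W.Phi (f x) \<oplus>\<^bsub>U\<^esub> W.Phi (f y)"
        by (simp only: W.Phi_add[OF Nc[OF fN[OF xy(1)]] Nc[OF fN[OF xy(2)]]])
    qed
    have "f ` carrier Y = N" using f(2) by (simp add: bij_betw_def)
    then show "\<Psi> ` carrier Y = carrier U" unfolding \<Psi>_def surj[symmetric] by blast
    fix c y assume cy: "c \<in> C" "y \<in> carrier Y"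
    show "\<Psi> (c \<odot>\<^bsub>Y\<^esub> y) = pr c \<odot>\<^bsub>U\<^esub> \<Psi> y"
      unfolding \<Psi>_def fe[OF C_carrier[OF cy(1)] cy(2)] by (rule W.Phi_C[OF cy(1) Nc[OF fN[OF cy(2)]]])
  qed
  then show ?thesis by (rule that)
qed

end

text \<open>The modules are arbitrary members of their isomorphism classes and may live on unrelated
  types, so the statement covers every construction of the Young modules. Both pairs belong to the
  same layer and hence to the same idempotent and ideal.\<close>

theorem corollary11:
  fixes K :: "'k ring" and q :: 'k and A :: "('k, 'a) module"
    and D :: "('k, 'b, 'v, 'a) strat_data"
    and n :: "nat \<Rightarrow> nat" and T :: "nat \<Rightarrow> (nat \<Rightarrow> nat) \<Rightarrow> 'b"
    and l :: nat and lam kap :: "nat list"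
    and U :: "('b, 'x) module" and U' :: "('b, 'w) module"
    and Y :: "('a, 'y) module" and Y' :: "('a, 'z) module"
  assumes "algebraically_closed K" and "q \<in> Units K"
    and "cellularly_stratified K A D"
    and "\<forall>l\<le>top_layer D. group_algebra_basis K (n l) (inp D l) (T l) \<or>
           hecke_algebra_basis K q (n l) (inp D l) (T l)"
    and "\<forall>l\<le>top_layer D. algebra_embedding K (inp D l) (corner A (idem K D l)) (emb K D l)"
    and "\<forall>l\<le>top_layer D. bimodule_split K A D l"
    and "(l, lam) \<in> Lambda (top_layer D) n" and "(l, kap) \<in> Lambda (top_layer D) n"
    and "young_module K q (n l) (inp D l) (T l) lam U"
    and "young_module K q (n l) (inp D l) (T l) kap U'"
    and "strat_young_module K A D l U Y" and "strat_young_module K A D l U' Y'"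
    and "(l, lam) \<noteq> (l, kap)"
  shows "\<not> module_isomorphic A Y Y'"
proof
  assume iso: "module_isomorphic A Y Y'"
  have l: "l \<le> top_layer D" and lam: "partition_of lam (n l)" and kap: "partition_of kap (n l)"
    using assms(7,8) by (simp_all add: Lambda_def)
  interpret strat_layer K A D l using assms(3,5) l by unfold_locales simp_all
  note U = young_module_indecomposable[OF assms(2) lam assms(9)]
  note U' = young_module_indecomposable[OF assms(2) kap assms(10)]
  obtain \<Psi> where \<Psi>: "top_map U Y \<Psi>" by (rule top_map_exists[OF U(2,1) assms(11)])
  obtain \<Psi>' where \<Psi>': "top_map U' Y' \<Psi>'" by (rule top_map_exists[OF U'(2,1) assms(12)])
  have "left_module A Y" "left_module A Y'" using assms(11,12) by (simp_all add: strat_young_module_def)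
  then have "module_isomorphic (inp D l) U U'" by (rule top_map_iso[OF U(2) U'(2) _ _ \<Psi> \<Psi>' iso])
  then have "lam = kap" by (rule young_module_inj[OF assms(2) lam kap assms(9,10)])
  then show False using assms(13) by simp
qed

end
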